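(* Let $x>0$ and $y>0$, and for each $n$ let $p_n=\lfloor x n^{1/2}\rfloor$ and $q_n=\lfloor y n^{1/2}\rfloor$. Let $\mathbf{\Gamma}_n$ be a random $n\times n$ matrix distributed according to the normalized Haar measure on $O(n)$, let $Z_n$ be its $p_n\times q_n$ upper left block, let $\mathcal{L}(\sqrt{n}Z_n)$ be the joint distribution of the entries of $\sqrt{n}Z_n$, and let $G_n$ be the joint distribution of $p_nq_n$ independent standard normals. Then $$\liminf_{n\to\infty}\|\mathcal{L}(\sqrt{n}Z_n)-G_n\|\ge \phi(x,y)>0,$$ where $\phi(x,y):=E\left|\exp\!\left(-\frac{x^2y^2}{8}+\frac{xy}{4}\xi\right)-1\right|$ with $\xi$ a standard normal random variable, and moreover $\phi(x,y)\in(0,1)$.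
   Context: For probability measures $\mu,\nu$ on $(\mathbb{R}^m,\mathcal{B})$, the variation distance is $\|\mu-\nu\|=2\sup_{A\in\mathcal{B}}|\mu(A)-\nu(A)|$, which equals $\int|f-g|\,dx$ when $\mu,\nu$ have Lebesgue densities $f,g$. $\lfloor a\rfloor$ denotes the integer part of $a$. *)

theory Defs
  imports "HOL-Probability.Probability"
begin

text \<open>Real matrices with index set {..<p} x {..<q} are represented as (extensional)
  functions nat x nat => real, i.e. points of the product measure space below
  (this is R^(p*q) with its Borel sigma-algebra).\<close>

definition mat_space :: "nat \<Rightarrow> nat \<Rightarrow> (nat \<times> nat \<Rightarrow> real) measure" where
  "mat_space p q = PiM ({..<p} \<times> {..<q}) (\<lambda>_. lborel)"

definition orthogonal_mat :: "nat \<Rightarrow> (nat \<times> nat \<Rightarrow> real) \<Rightarrow> bool" where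
  "orthogonal_mat n M \<longleftrightarrow> M \<in> extensional ({..<n} \<times> {..<n}) \<and>
     (\<forall>i<n. \<forall>j<n. (\<Sum>k<n. M (k, i) * M (k, j)) = (if i = j then 1 else 0))"

definition mat_mult :: "nat \<Rightarrow> (nat \<times> nat \<Rightarrow> real) \<Rightarrow> (nat \<times> nat \<Rightarrow> real) \<Rightarrow> (nat \<times> nat \<Rightarrow> real)" where
  "mat_mult n U M = (\<lambda>(i, j) \<in> {..<n} \<times> {..<n}. \<Sum>k<n. U (i, k) * M (k, j))"

definition haar_orthogonal :: "nat \<Rightarrow> (nat \<times> nat \<Rightarrow> real) measure \<Rightarrow> bool" where
  "haar_orthogonal n H \<longleftrightarrow>
     prob_space H \<and> sets H = sets (mat_space n n) \<and>
     measure H {M \<in> space (mat_space n n). orthogonal_mat n M} = 1 \<and>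
     (\<forall>U. orthogonal_mat n U \<longrightarrow> distr H (mat_space n n) (mat_mult n U) = H)"

definition scaled_block_law ::
  "nat \<Rightarrow> nat \<Rightarrow> nat \<Rightarrow> (nat \<times> nat \<Rightarrow> real) measure \<Rightarrow> (nat \<times> nat \<Rightarrow> real) measure" where
  "scaled_block_law n p q H =
     distr H (mat_space p q) (\<lambda>M. \<lambda>(i, j) \<in> {..<p} \<times> {..<q}. sqrt (real n) * M (i, j))"

definition gauss_mat :: "nat \<Rightarrow> nat \<Rightarrow> (nat \<times> nat \<Rightarrow> real) measure" where
  "gauss_mat p q = PiM ({..<p} \<times> {..<q}) (\<lambda>_. density lborel std_normal_density)"

definition var_dist :: "'a measure \<Rightarrow> 'a measure \<Rightarrow> real" where
  "var_dist \<mu> \<nu> = 2 * (SUP A \<in> sets \<mu>. \<bar>measure \<mu> A - measure \<nu> A\<bar>)"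

definition phi :: "real \<Rightarrow> real \<Rightarrow> real" where
  "phi x y = (\<integral>t. std_normal_density t * \<bar>exp (- (x\<^sup>2 * y\<^sup>2) / 8 + x * y / 4 * t) - 1\<bar> \<partial>lborel)"

end

theory Submission
  imports Defs "HOL-Real_Asymp.Real_Asymp"
begin

text \<open>A lower bound on the variation distance only needs one event on which the two laws differ,
  so densities are avoided altogether. The event is a sublevel set of a statistic S of the Gram matrix
  C of the columns, S = (sum over j, l with j \<noteq> l of C(j,l) squared) - 2 (q - 1) trace C, which up to a
  constant is a degenerate U-statistic of the columns under the Gaussian law.

  If Y is the scaled Haar block and W an independent p x p Wishart matrix with n degrees of freedom
  divided by n, then Y' W Y has the law of the Gram matrix of a Gaussian p x q matrix. Conditionally on
  Y, the passage from Y' Y to Y' W Y increases S by p^2 q^2 / n up to an error o(n) in probability.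
  Hence the law of S under the Haar block is a shift of its Gaussian law by about d = (x y)^2 n, while
  its Gaussian variance v is about 4 (x y)^2 n^2. A law with variance at most v charges some window of
  length d with mass at least d / sqrt (12 v + d^2), so with s = x y the variation distance is
  asymptotically at least 2 s / sqrt (48 + s^2). This exceeds phi, because the Cauchy--Schwarz
  inequality gives phi < 1 and phi \<le> s / 4.\<close>

section \<open>Elementary bounds on phi\<close>

text \<open>The trace term is the Hoeffding projection of the off-diagonal sum. Without it the
  variance of S would gain 8 p q (q - 1)^2, again of order n^2, and the resulting bound would drop
  below phi when y / x is large. A trace is linear in C, so averaging over W does not move it and
  the shift survives. The shift arises because, given Y, the (j,l) entry of Y' W Y has variance
  (C(j,j) C(l,l) + C(j,l)^2) / n; summed over pairs this is close to (trace C)^2 / n, and trace C is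
  close to p q.

  Of the Haar measure only left invariance and almost sure orthogonality are used. No moment of a
  Haar matrix is computed: the trace, the squared Frobenius norm and the trace of the cube are
  convex and W has mean identity, so their Haar means are at most the Gaussian ones.

  The 48 is 12 times the 4 in the variance. The bounds 1 and s / 4 on phi both equal 2 s / sqrt (48
  + s^2) at s = 4. Strictness of the comparison lets a small fixed fraction of the shift pay for all
  errors.\<close>

lemma std_normal_density_tilt:
  "std_normal_density t * exp (c * t) = exp (c\<^sup>2 / 2) * normal_density c 1 t"
  by (simp add: normal_density_def mult_exp_exp power2_eq_square field_simps exp_add[symmetric])

lemma std_normal_mgf:
  shows "integrable lborel (\<lambda>t. std_normal_density t * exp (c * t))"
    and "(\<integral>t. std_normal_density t * exp (c * t) \<partial>lborel) = exp (c\<^sup>2 / 2)"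
  unfolding std_normal_density_tilt by simp_all

text \<open>With a = x y / 4 the integrand is the modulus of Z = exp(-2 a^2 + a t) - 1, whose first
  two moments are explicit: E Z = m - 1 and E Z^2 = r. The first gives positivity since the mean of
  the modulus dominates the modulus of the mean; the second bounds \<open>phi\<close> by sqrt r, and
  r is compared with 1 and with a^2.\<close>

lemma phi_bounds:
  assumes "x > 0" "y > 0"
  shows "0 < phi x y" "phi x y < 1" "phi x y \<le> x * y / 4"
proof -
  define a where "a = x * y / 4"
  define u where "u = a\<^sup>2"
  define Z where "Z t = exp (- 2 * u + a * t) - 1" for t :: real
  define m where "m = exp (- 3 / 2 * u)"
  define r where "r = exp (- 2 * u) - 2 * m + 1"
  have a: "a > 0" and u: "u > 0" using assms by (auto simp: a_def u_def)
  have m1: "m < 1" using u by (simp add: m_def)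
  have phi: "phi x y = (\<integral>t. std_normal_density t * \<bar>Z t\<bar> \<partial>lborel)"
    unfolding phi_def Z_def u_def a_def by (simp add: power_mult_distrib power_divide)
  have Z1: "std_normal_density t * Z t = exp (- 2 * u) * (std_normal_density t * exp (a * t)) - std_normal_density t" for t
    unfolding Z_def exp_add by (simp add: algebra_simps)
  have Z2: "std_normal_density t * (Z t)\<^sup>2 = exp (- 4 * u) * (std_normal_density t * exp (2 * a * t))
     - 2 * exp (- 2 * u) * (std_normal_density t * exp (a * t)) + std_normal_density t" for t
  proof -
    have *: "(Z t)\<^sup>2 = exp (- 4 * u) * exp (2 * a * t) - 2 * (exp (- 2 * u) * exp (a * t)) + 1"
      by (simp add: Z_def power2_eq_square algebra_simps flip: exp_add)
    show ?thesis
      unfolding * by (simp add: algebra_simps)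
  qed
  have i1: "integrable lborel (\<lambda>t. std_normal_density t * Z t)"
    unfolding Z1 by (intro Bochner_Integration.integrable_diff integrable_mult_right std_normal_mgf) auto
  have i2: "integrable lborel (\<lambda>t. std_normal_density t * (Z t)\<^sup>2)"
    unfolding Z2 by (intro Bochner_Integration.integrable_add Bochner_Integration.integrable_diff integrable_mult_right std_normal_mgf) auto
  have ia: "integrable lborel (\<lambda>t. std_normal_density t * \<bar>Z t\<bar>)"
    using integrable_abs[OF i1] by (simp add: abs_mult)
  have e1: "(\<integral>t. std_normal_density t * Z t \<partial>lborel) = m - 1"
    unfolding Z1 using std_normal_mgf
    by (subst Bochner_Integration.integral_diff) (auto simp: m_def u_def simp flip: exp_add)
  have e2: "(\<integral>t. std_normal_density t * (Z t)\<^sup>2 \<partial>lborel) = r"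
    unfolding Z2 using std_normal_mgf[of a] std_normal_mgf[of "2 * a"]
    apply (subst Bochner_Integration.integral_add)
      apply (auto intro!: Bochner_Integration.integrable_diff)
    by (simp add: m_def r_def u_def mult.assoc flip: exp_add)
  have "1 - m \<le> phi x y"
    using integral_abs_bound[of lborel "\<lambda>t. std_normal_density t * Z t"] e1 m1
    by (simp add: phi abs_mult)
  with m1 show pos: "0 < phi x y" by simp
  \<comment> \<open>Cauchy--Schwarz in integrated form: 2 c |Z| <= Z^2 + c^2 with
    \<open>c = phi x y\<close> integrates to 2 c^2 <= r + c^2.\<close>
  have sq: "(phi x y)\<^sup>2 \<le> r"
  proof -
    define c where "c = phi x y"
    have "2 * c * (std_normal_density t * \<bar>Z t\<bar>) \<le> std_normal_density t * (Z t)\<^sup>2 + c\<^sup>2 * std_normal_density t" for t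
    proof -
      have "2 * c * \<bar>Z t\<bar> \<le> (Z t)\<^sup>2 + c\<^sup>2"
        using sum_squares_bound[of c "\<bar>Z t\<bar>"] by simp
      from mult_left_mono[OF this, of "std_normal_density t"] show ?thesis
        by (simp add: algebra_simps)
    qed
    then have "(\<integral>t. 2 * c * (std_normal_density t * \<bar>Z t\<bar>) \<partial>lborel) \<le>
      (\<integral>t. std_normal_density t * (Z t)\<^sup>2 + c\<^sup>2 * std_normal_density t \<partial>lborel)"
      using ia i2 by (intro integral_mono) auto
    also have "\<dots> = r + c\<^sup>2"
      using i2 by (subst Bochner_Integration.integral_add) (auto simp: e2)
    finally show ?thesis
      by (simp add: phi[symmetric] c_def power2_eq_square)
  qed
  have "r < 1"
  proof -
    have "exp (- 2 * u) = exp (- 1 / 2 * u) * m" by (simp add: m_def flip: exp_add)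
    also have "\<dots> \<le> 1 * m" using u by (intro mult_right_mono) (auto simp: m_def)
    finally show ?thesis unfolding r_def using exp_gt_zero[of "- 3 / 2 * u"] m_def by linarith
  qed
  with sq have "(phi x y)\<^sup>2 < 1\<^sup>2" by simp
  then show "phi x y < 1"
    using power_less_imp_less_base by fastforce
  have "r \<le> u"
  proof -
    \<comment> \<open>\<open>h 0 = 0\<close> and \<open>h u = u - r\<close>. Substituting w = exp(-v
      / 2) turns the derivative into a polynomial that splits into nonnegative factors for 0 < w <=
      1.\<close>
    define h where "h v = v - exp (- 2 * v) + 2 * exp (- 3 / 2 * v) - 1" for v :: real
    have "h 0 \<le> h u"
    proof (rule DERIV_nonneg_imp_nondecreasing[of 0 u h])
      fix v :: real assume v: "0 \<le> v" "v \<le> u"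
      define w where "w = exp (- v / 2)"
      have w: "0 < w" "w \<le> 1" using v by (auto simp: w_def)
      have w4: "exp (- 2 * v) = w ^ 4" and w3: "exp (- 3 / 2 * v) = w ^ 3"
        by (simp_all add: w_def flip: exp_of_nat_mult)
      have "(h has_real_derivative (1 + 2 * exp (- 2 * v) - 3 * exp (- 3 / 2 * v))) (at v)"
        unfolding h_def by (auto intro!: derivative_eq_intros)
      moreover have "0 \<le> 1 + 2 * w ^ 4 - 3 * w ^ 3"
      proof -
        have "1 + 2 * w ^ 4 - 3 * w ^ 3 = (1 - w) * ((1 - w ^ 3) + w * (1 - w ^ 2) + w ^ 2)"
          by algebra
        then show ?thesis using w power_le_one[of w 3] power_le_one[of w 2] by simp
      qed
      ultimately show "\<exists>y. (h has_real_derivative y) (at v) \<and> 0 \<le> y"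
        unfolding w4 w3 by blast
    qed (use u in auto)
    then show ?thesis by (simp add: h_def r_def m_def)
  qed
  with sq have "(phi x y)\<^sup>2 \<le> a\<^sup>2" by (simp add: u_def)
  then show "phi x y \<le> x * y / 4"
    using a power2_le_imp_le[of "phi x y" a] by (simp add: a_def)
qed

section \<open>Concentration in short windows\<close>

text \<open>Negative values lower the left side, while \<open>ennreal\<close> cuts them off on the
  right. This lets integrands of varying sign enter Tonelli arguments.\<close>

lemma ennreal_integral_le:
  fixes f :: "'a \<Rightarrow> real"
  assumes "integrable M f"
  shows "ennreal (\<integral>x. f x \<partial>M) \<le> (\<integral>\<^sup>+x. ennreal (f x) \<partial>M)"
proof -
  have "(\<integral>x. f x \<partial>M) \<le> (\<integral>x. max 0 (f x) \<partial>M)"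
    using assms by (intro integral_mono) auto
  then have "ennreal (\<integral>x. f x \<partial>M) \<le> ennreal (\<integral>x. max 0 (f x) \<partial>M)"
    by (rule ennreal_leI)
  also have "\<dots> = (\<integral>\<^sup>+x. ennreal (max 0 (f x)) \<partial>M)"
    using assms by (intro nn_integral_eq_integral[symmetric]) auto
  also have "\<dots> = (\<integral>\<^sup>+x. ennreal (f x) \<partial>M)"
    by (intro nn_integral_cong) (auto simp: max_def ennreal_neg)
  finally show ?thesis .
qed

text \<open>Averaging the windows against a parabolic weight makes the second moment bound
  applicable; the resulting constant is the one attained by the uniform distribution.\<close>

lemma (in prob_space) concentration_window:
  fixes S :: "'a \<Rightarrow> real"
  assumes S[measurable]: "S \<in> borel_measurable M"
    and int: "integrable M (\<lambda>\<omega>. (S \<omega> - \<mu>)\<^sup>2)"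
    and var: "expectation (\<lambda>\<omega>. (S \<omega> - \<mu>)\<^sup>2) \<le> v"
    and pos: "v > 0" "\<delta> > 0" and b: "b < \<delta> / sqrt (12 * v + \<delta>\<^sup>2)"
  shows "\<exists>t. b < prob {\<omega> \<in> space M. t < S \<omega> \<and> S \<omega> \<le> t + \<delta>}"
proof (rule ccontr)
  assume "\<not> ?thesis"
  then have small: "prob {\<omega> \<in> space M. t < S \<omega> \<and> S \<omega> \<le> t + \<delta>} \<le> b" for t
    by (simp add: not_less)
  have b0: "0 \<le> b" using small[of 0] measure_nonneg order_trans by blast
  \<comment> \<open>Smoothing \<open>S\<close> by an independent uniform variable on an interval of
    length \<open>\<delta>\<close> gives a density of at most b / \<delta> and a variance of at most
    v + \<delta>^2 / 12. The uniform law on an interval of half-length m has variance m^2 / 3, and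
    \<open>m\<close> makes the two variances equal.\<close>
  define m where "m = sqrt (3 * v + \<delta>\<^sup>2 / 4)"
  have m2: "m\<^sup>2 = 3 * v + \<delta>\<^sup>2 / 4" and m: "m > 0"
    using pos by (auto simp: m_def add_pos_pos add_nonneg_nonneg)
  \<comment> \<open>The starting points t of windows that contain s fill the interval from s -
    \<delta> to s, whose midpoint is \<open>c\<close> for s = \<mu>. With this centring the linear
    term of \<open>Wdiff\<close> cancels, so that only the second moment about \<mu> enters.\<close>
  define c where "c = \<mu> - \<delta> / 2"
  define w where "w t = 1 - (t - c)\<^sup>2 / m\<^sup>2" for t
  define W where "W t = t - (t - c) ^ 3 / (3 * m\<^sup>2)" for t
  have [measurable]: "w \<in> borel_measurable borel" unfolding w_def by measurable
  have W: "(W has_real_derivative w t) (at t)" for t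
    unfolding W_def w_def using m by (auto intro!: derivative_eq_intros simp: power2_eq_square field_simps)
  \<comment> \<open>Only an inequality: where the parabola is negative, \<open>ennreal\<close>
    replaces it by 0 and enlarges the right side.\<close>
  have inner: "ennreal (W s - W (s - \<delta>)) \<le> (\<integral>\<^sup>+t. ennreal (w t) * indicator {t. t < s \<and> s \<le> t + \<delta>} t \<partial>lborel)" for s
  proof -
    have "has_bochner_integral lborel (\<lambda>t. w t * indicator {s - \<delta>..s} t) (W s - W (s - \<delta>))"
      using pos m by (intro has_bochner_integral_FTC_Icc_real W) (auto simp: w_def intro!: continuous_intros)
    then have i: "integrable lborel (\<lambda>t. w t * indicator {s - \<delta>..s} t)"
      and e: "(\<integral>t. w t * indicator {s - \<delta>..s} t \<partial>lborel) = W s - W (s - \<delta>)"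
      by (auto simp: has_bochner_integral_iff)
    have "ennreal (W s - W (s - \<delta>)) \<le> (\<integral>\<^sup>+t. ennreal (w t * indicator {s - \<delta>..s} t) \<partial>lborel)"
      using ennreal_integral_le[OF i] by (simp add: e)
    also have "\<dots> = (\<integral>\<^sup>+t. ennreal (w t) * indicator {t. t < s \<and> s \<le> t + \<delta>} t \<partial>lborel)"
      using AE_lborel_singleton[of s]
      by (intro nn_integral_cong_AE) (auto elim!: eventually_mono split: split_indicator)
    finally show ?thesis .
  qed
  have Wdiff: "W s - W (s - \<delta>) = \<delta> * (1 - \<delta>\<^sup>2 / (12 * m\<^sup>2)) - \<delta> / m\<^sup>2 * (s - \<mu>)\<^sup>2" for s
    unfolding W_def c_def using m by (simp add: field_simps) (simp add: power2_eq_square power3_eq_cube algebra_simps)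
  have iW: "integrable M (\<lambda>\<omega>. W (S \<omega>) - W (S \<omega> - \<delta>))"
    unfolding Wdiff using int by auto
  have "2 * \<delta> / 3 \<le> \<delta> * (1 - \<delta>\<^sup>2 / (12 * m\<^sup>2)) - \<delta> / m\<^sup>2 * v"
  proof -
    have "\<delta>\<^sup>2 / (12 * m\<^sup>2) + v / m\<^sup>2 = 1 / 3"
    proof -
      have "\<delta>\<^sup>2 / (12 * m\<^sup>2) + v / m\<^sup>2 = (\<delta>\<^sup>2 / 12 + v) / m\<^sup>2"
        by (simp add: add_divide_distrib)
      also have "\<delta>\<^sup>2 / 12 + v = m\<^sup>2 / 3" by (simp add: m2)
      finally show ?thesis using m by simp
    qed
    then have "1 - \<delta>\<^sup>2 / (12 * m\<^sup>2) - v / m\<^sup>2 = 2 / 3" by simp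
    then have "\<delta> * (1 - \<delta>\<^sup>2 / (12 * m\<^sup>2) - v / m\<^sup>2) = \<delta> * (2 / 3)" by simp
    then show ?thesis by (simp add: algebra_simps)
  qed
  also have "\<dots> \<le> \<delta> * (1 - \<delta>\<^sup>2 / (12 * m\<^sup>2)) - \<delta> / m\<^sup>2 * expectation (\<lambda>\<omega>. (S \<omega> - \<mu>)\<^sup>2)"
    using var pos m by (intro diff_left_mono mult_left_mono) auto
  also have "\<dots> = expectation (\<lambda>\<omega>. W (S \<omega>) - W (S \<omega> - \<delta>))"
    unfolding Wdiff using int by (simp add: prob_space)
  finally have "ennreal (2 * \<delta> / 3) \<le> ennreal (expectation (\<lambda>\<omega>. W (S \<omega>) - W (S \<omega> - \<delta>)))"
    by (rule ennreal_leI)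
  also have "\<dots> \<le> (\<integral>\<^sup>+\<omega>. ennreal (W (S \<omega>) - W (S \<omega> - \<delta>)) \<partial>M)"
    by (rule ennreal_integral_le[OF iW])
  also have "\<dots> \<le> (\<integral>\<^sup>+\<omega>. (\<integral>\<^sup>+t. ennreal (w t) * indicator {t. t < S \<omega> \<and> S \<omega> \<le> t + \<delta>} t \<partial>lborel) \<partial>M)"
    by (intro nn_integral_mono inner)
  also have "\<dots> = (\<integral>\<^sup>+t. (\<integral>\<^sup>+\<omega>. ennreal (w t) * indicator {t. t < S \<omega> \<and> S \<omega> \<le> t + \<delta>} t \<partial>M) \<partial>lborel)"
  proof -
    interpret p: pair_sigma_finite M lborel ..
    show ?thesis by (rule p.Fubini'[symmetric]) measurable
  qed
  also have "\<dots> = (\<integral>\<^sup>+t. ennreal (w t) * emeasure M {\<omega> \<in> space M. t < S \<omega> \<and> S \<omega> \<le> t + \<delta>} \<partial>lborel)"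
  proof (rule nn_integral_cong)
    fix t
    have "(\<integral>\<^sup>+\<omega>. ennreal (w t) * indicator {t. t < S \<omega> \<and> S \<omega> \<le> t + \<delta>} t \<partial>M)
      = (\<integral>\<^sup>+\<omega>. ennreal (w t) * indicator {\<omega> \<in> space M. t < S \<omega> \<and> S \<omega> \<le> t + \<delta>} \<omega> \<partial>M)"
      by (intro nn_integral_cong) (auto split: split_indicator)
    then show "(\<integral>\<^sup>+\<omega>. ennreal (w t) * indicator {t. t < S \<omega> \<and> S \<omega> \<le> t + \<delta>} t \<partial>M)
      = ennreal (w t) * emeasure M {\<omega> \<in> space M. t < S \<omega> \<and> S \<omega> \<le> t + \<delta>}"
      by (simp add: nn_integral_cmult_indicator)
  qed
  also have "\<dots> \<le> (\<integral>\<^sup>+t. ennreal b * (ennreal (w t) * indicator {c - m..c + m} t) \<partial>lborel)"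
  proof (rule nn_integral_mono)
    fix t
    show "ennreal (w t) * emeasure M {\<omega> \<in> space M. t < S \<omega> \<and> S \<omega> \<le> t + \<delta>}
      \<le> ennreal b * (ennreal (w t) * indicator {c - m..c + m} t)"
    proof (cases "t \<in> {c - m..c + m}")
      case True
      then show ?thesis
        using mult_left_mono[OF ennreal_leI[OF small[of t]], of "ennreal (w t)"]
        by (simp add: emeasure_eq_measure mult.commute)
    next
      case False
      then have "m \<le> \<bar>t - c\<bar>" by auto
      then have "m\<^sup>2 \<le> (t - c)\<^sup>2" using m abs_le_square_iff[of m "t - c"] by simp
      then have "w t \<le> 0" using m by (simp add: w_def)
      then show ?thesis by (simp add: ennreal_neg)
    qed
  qed
  also have "\<dots> = ennreal b * ennreal (W (c + m) - W (c - m))"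
  proof -
    have "w t \<ge> 0" if "c - m \<le> t" "t \<le> c + m" for t
    proof -
      have "\<bar>t - c\<bar> \<le> \<bar>m\<bar>" using that by auto
      then have "(t - c)\<^sup>2 \<le> m\<^sup>2" by (rule abs_le_square_iff[THEN iffD1])
      then show ?thesis using m by (simp add: w_def)
    qed
    then have "(\<integral>\<^sup>+t. ennreal (w t) * indicator {c - m..c + m} t \<partial>lborel) = ennreal (W (c + m) - W (c - m))"
      using m W by (intro nn_integral_FTC_Icc) (auto intro: DERIV_subset)
    then show ?thesis by (subst nn_integral_cmult) auto
  qed
  also have "W (c + m) - W (c - m) = 4 * m / 3"
    unfolding W_def using m by (simp add: field_simps power2_eq_square power3_eq_cube)
  also have "ennreal b * ennreal (4 * m / 3) = ennreal (b * (4 * m / 3))"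
    using b0 m by (intro ennreal_mult[symmetric]) auto
  finally have "2 * \<delta> / 3 \<le> b * (4 * m / 3)"
    using b0 m by (simp add: ennreal_le_iff)
  then have "\<delta> \<le> b * (2 * m)" by simp
  moreover have "2 * m = sqrt (12 * v + \<delta>\<^sup>2)"
    using m by (intro real_sqrt_unique[symmetric]) (auto simp: power_mult_distrib m2)
  ultimately have "b < \<delta> / (2 * m)"
    using b by simp
  then show False
    using \<open>\<delta> \<le> b * (2 * m)\<close> m pos_less_divide_eq[of "2 * m" b \<delta>] by simp
qed

section \<open>Moments on product spaces\<close>

text \<open>Lying in every L^k is preserved by sums and products, so integrability of any polynomial
  in Gaussian coordinates follows from introduction rules without tracking exponents.\<close>

definition all_moments :: "'a measure \<Rightarrow> ('a \<Rightarrow> real) \<Rightarrow> bool" where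
  "all_moments M f \<longleftrightarrow> f \<in> borel_measurable M \<and> (\<forall>k. integrable M (\<lambda>x. \<bar>f x\<bar> ^ k))"

lemma all_moments_measurable [measurable_dest]: "all_moments M f \<Longrightarrow> f \<in> borel_measurable M"
  by (simp add: all_moments_def)

lemma all_moments_integrable: "all_moments M f \<Longrightarrow> integrable M f"
proof -
  assume f: "all_moments M f"
  then have "integrable M (\<lambda>x. \<bar>f x\<bar> ^ 1)" unfolding all_moments_def by blast
  with f show ?thesis by (auto simp: all_moments_def intro: integrable_abs_cancel)
qed

context prob_space
begin

lemma all_moments_const: "all_moments M (\<lambda>_. c)"
  by (simp add: all_moments_def)

lemma all_moments_mult:
  assumes "all_moments M f" "all_moments M g"
  shows "all_moments M (\<lambda>x. f x * g x)"
proof -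
  have [measurable]: "f \<in> borel_measurable M" "g \<in> borel_measurable M"
    using assms by (auto simp: all_moments_def)
  have "integrable M (\<lambda>x. \<bar>f x * g x\<bar> ^ k)" for k
  proof (rule Bochner_Integration.integrable_bound)
    show "integrable M (\<lambda>x. \<bar>f x\<bar> ^ (2 * k) + \<bar>g x\<bar> ^ (2 * k))"
      using assms by (auto simp: all_moments_def)
    have "\<bar>f x * g x\<bar> ^ k \<le> \<bar>f x\<bar> ^ (2 * k) + \<bar>g x\<bar> ^ (2 * k)" for x
    proof -
      have "\<bar>f x * g x\<bar> ^ k = \<bar>f x\<bar> ^ k * \<bar>g x\<bar> ^ k" by (simp add: abs_mult power_mult_distrib)
      also have "\<dots> \<le> (\<bar>f x\<bar> ^ k)\<^sup>2 + (\<bar>g x\<bar> ^ k)\<^sup>2"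
      proof -
        have "0 \<le> \<bar>f x\<bar> ^ k * \<bar>g x\<bar> ^ k" by simp
        then show ?thesis
          using sum_squares_bound[of "\<bar>f x\<bar> ^ k" "\<bar>g x\<bar> ^ k"] unfolding mult.assoc by linarith
      qed
      finally show ?thesis by (simp add: power_mult[symmetric] mult.commute)
    qed
    then show "AE x in M. norm (\<bar>f x * g x\<bar> ^ k) \<le> norm (\<bar>f x\<bar> ^ (2 * k) + \<bar>g x\<bar> ^ (2 * k))"
      by (auto intro!: AE_I2)
  qed auto
  then show ?thesis by (auto simp: all_moments_def)
qed

lemma all_moments_add:
  assumes "all_moments M f" "all_moments M g"
  shows "all_moments M (\<lambda>x. f x + g x)"
proof -
  have [measurable]: "f \<in> borel_measurable M" "g \<in> borel_measurable M"
    using assms by (auto simp: all_moments_def)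
  have "integrable M (\<lambda>x. \<bar>f x + g x\<bar> ^ k)" for k
  proof (rule Bochner_Integration.integrable_bound)
    show "integrable M (\<lambda>x. 2 ^ k * (\<bar>f x\<bar> ^ k + \<bar>g x\<bar> ^ k))"
      using assms by (auto simp: all_moments_def)
    have "\<bar>f x + g x\<bar> ^ k \<le> 2 ^ k * (\<bar>f x\<bar> ^ k + \<bar>g x\<bar> ^ k)" for x
    proof -
      have "\<bar>f x + g x\<bar> ^ k \<le> (2 * max \<bar>f x\<bar> \<bar>g x\<bar>) ^ k"
        by (intro power_mono) auto
      also have "\<dots> = 2 ^ k * max \<bar>f x\<bar> \<bar>g x\<bar> ^ k" by (simp add: power_mult_distrib)
      also have "\<dots> \<le> 2 ^ k * (\<bar>f x\<bar> ^ k + \<bar>g x\<bar> ^ k)"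
        by (intro mult_left_mono) (auto simp: max_def)
      finally show ?thesis .
    qed
    then show "AE x in M. norm (\<bar>f x + g x\<bar> ^ k) \<le> norm (2 ^ k * (\<bar>f x\<bar> ^ k + \<bar>g x\<bar> ^ k))"
      by (auto intro!: AE_I2)
  qed auto
  then show ?thesis by (auto simp: all_moments_def)
qed

lemma all_moments_diff:
  assumes "all_moments M f" "all_moments M g"
  shows "all_moments M (\<lambda>x. f x - g x)"
  using all_moments_add[OF assms(1) all_moments_mult[OF all_moments_const[of "-1"] assms(2)]] by simp

lemma all_moments_divide:
  assumes "all_moments M f"
  shows "all_moments M (\<lambda>x. f x / c)"
  using all_moments_mult[OF assms all_moments_const[of "1 / c"]] by simp

lemma all_moments_power:
  assumes "all_moments M f"
  shows "all_moments M (\<lambda>x. f x ^ k)"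
proof (induction k)
  case 0
  show ?case by (simp add: all_moments_const)
next
  case (Suc k)
  then show ?case using all_moments_mult[OF assms Suc] by simp
qed

lemma all_moments_sum:
  assumes "\<And>i. i \<in> A \<Longrightarrow> all_moments M (f i)"
  shows "all_moments M (\<lambda>x. \<Sum>i\<in>A. f i x)"
  using assms
proof (induction A rule: infinite_finite_induct)
  case (insert a A)
  then have "all_moments M (\<lambda>x. f a x + (\<Sum>i\<in>A. f i x))"
    by (intro all_moments_add) auto
  then show ?case using insert.hyps by simp
qed (simp_all add: all_moments_const)

lemmas moment_intros = all_moments_const all_moments_mult all_moments_add all_moments_diff
  all_moments_divide all_moments_power all_moments_sum

end

lemma integral_double_sum:
  fixes f :: "'i \<Rightarrow> 'j \<Rightarrow> 'a \<Rightarrow> real"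
  assumes "\<And>i j. i \<in> A \<Longrightarrow> j \<in> B \<Longrightarrow> integrable M (f i j)"
  shows "(\<integral>x. (\<Sum>i\<in>A. \<Sum>j\<in>B. f i j x) \<partial>M) = (\<Sum>i\<in>A. \<Sum>j\<in>B. \<integral>x. f i j x \<partial>M)"
proof -
  have "(\<integral>x. (\<Sum>i\<in>A. \<Sum>j\<in>B. f i j x) \<partial>M) = (\<Sum>i\<in>A. \<integral>x. (\<Sum>j\<in>B. f i j x) \<partial>M)"
    using assms by (intro Bochner_Integration.integral_sum Bochner_Integration.integrable_sum)
  also have "\<dots> = (\<Sum>i\<in>A. \<Sum>j\<in>B. \<integral>x. f i j x \<partial>M)"
    using assms by (intro sum.cong refl Bochner_Integration.integral_sum)
  finally show ?thesis .
qed

lemma all_moments_distr: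
  assumes X: "X \<in> measurable N M" "distr N M X = M" and f: "all_moments M f"
  shows "all_moments N (\<lambda>x. f (X x))"
proof -
  have f': "all_moments (distr N M X) f" using X f by simp
  have fm: "f \<in> borel_measurable M" using f by (simp add: all_moments_def)
  show ?thesis
    unfolding all_moments_def
  proof (intro conjI allI)
    show "(\<lambda>x. f (X x)) \<in> borel_measurable N" using X(1) fm by simp
    fix k
    have "integrable (distr N M X) (\<lambda>x. \<bar>f x\<bar> ^ k)" using f' by (simp add: all_moments_def)
    then show "integrable N (\<lambda>x. \<bar>f (X x)\<bar> ^ k)"
      using fm by (subst (asm) integrable_distr_eq[OF X(1)]) auto
  qed
qed

context
  fixes M :: "'a measure" and I :: "'i set"
  assumes prob: "prob_space M" and fin: "finite I"
begin

interpretation M: prob_space M by (rule prob)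
interpretation P: prob_space "Pi\<^sub>M I (\<lambda>_. M)" by (rule prob_space_PiM) (rule prob)
interpretation PP: product_prob_space "\<lambda>_. M" I ..

lemma PiM_integral_component:
  fixes f :: "'a \<Rightarrow> real"
  assumes "i \<in> I" and [measurable]: "f \<in> borel_measurable M"
  shows "(\<integral>c. f (c i) \<partial>Pi\<^sub>M I (\<lambda>_. M)) = (\<integral>x. f x \<partial>M)"
proof -
  have [measurable]: "(\<lambda>c. c i) \<in> measurable (Pi\<^sub>M I (\<lambda>_. M)) M" using assms(1) by simp
  have "(\<integral>x. f x \<partial>distr (Pi\<^sub>M I (\<lambda>_. M)) M (\<lambda>c. c i)) = (\<integral>c. f (c i) \<partial>Pi\<^sub>M I (\<lambda>_. M))"
    by (rule integral_distr) measurable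
  then show ?thesis using PP.PiM_component[OF assms(1)] by simp
qed

lemma PiM_all_moments_component:
  assumes "i \<in> I" and "all_moments M f"
  shows "all_moments (Pi\<^sub>M I (\<lambda>_. M)) (\<lambda>c. f (c i))"
  using assms by (intro all_moments_distr[OF _ PP.PiM_component]) auto

text \<open>Fubini with coordinate \<open>i\<close> innermost. The outer integral still runs over
  the whole product, where the old value of that coordinate is overwritten rather than removed, so
  later computations never meet a smaller product space.\<close>

lemma PiM_integral_resample:
  fixes f :: "('i \<Rightarrow> 'a) \<Rightarrow> real"
  assumes i: "i \<in> I" and f: "integrable (Pi\<^sub>M I (\<lambda>_. M)) f"
  shows "integral\<^sup>L (Pi\<^sub>M I (\<lambda>_. M)) f = (\<integral>c. (\<integral>y. f (c(i := y)) \<partial>M) \<partial>Pi\<^sub>M I (\<lambda>_. M))"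
proof -
  define J where "J = I - {i}"
  have J: "finite J" "i \<notin> J" "I = insert i J" using fin i by (auto simp: J_def)
  have fm [measurable]: "f \<in> borel_measurable (Pi\<^sub>M (insert i J) (\<lambda>_. M))"
    using f J(3) by auto
  have [measurable]: "(\<lambda>c. \<integral>y. f (c(i := y)) \<partial>M) \<in> borel_measurable (Pi\<^sub>M J (\<lambda>_. M))"
    by measurable
  have res: "(\<lambda>c. restrict c J) \<in> measurable (Pi\<^sub>M I (\<lambda>_. M)) (Pi\<^sub>M J (\<lambda>_. M))"
    using J by (intro measurable_restrict_subset) auto
  have "integral\<^sup>L (Pi\<^sub>M I (\<lambda>_. M)) f = (\<integral>c. (\<integral>y. f (c(i := y)) \<partial>M) \<partial>Pi\<^sub>M J (\<lambda>_. M))"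
    using f unfolding J(3) by (intro PP.product_integral_insert J(1,2)) auto
  also have "Pi\<^sub>M J (\<lambda>_. M) = distr (Pi\<^sub>M I (\<lambda>_. M)) (Pi\<^sub>M J (\<lambda>_. M)) (\<lambda>c. restrict c J)"
    using J by (intro PP.distr_restrict fin) auto
  also have "(\<integral>c. (\<integral>y. f (c(i := y)) \<partial>M) \<partial>\<dots>) =
     (\<integral>c. (\<integral>y. f ((restrict c J)(i := y)) \<partial>M) \<partial>Pi\<^sub>M I (\<lambda>_. M))"
    by (rule integral_distr[OF res]) measurable
  also have "\<dots> = (\<integral>c. (\<integral>y. f (c(i := y)) \<partial>M) \<partial>Pi\<^sub>M I (\<lambda>_. M))"
  proof (rule Bochner_Integration.integral_cong[OF refl])
    fix c assume "c \<in> space (Pi\<^sub>M I (\<lambda>_. M))"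
    then have "(restrict c J)(i := y) = c(i := y)" for y
      using J by (auto simp: fun_eq_iff space_PiM PiE_def extensional_def)
    then show "(\<integral>y. f ((restrict c J)(i := y)) \<partial>M) = (\<integral>y. f (c(i := y)) \<partial>M)" by simp
  qed
  finally show ?thesis .
qed

lemma sum_iid_second_moment:
  fixes f :: "'a \<Rightarrow> real"
  assumes f: "all_moments M f" and centered: "(\<integral>x. f x \<partial>M) = 0"
  shows "(\<integral>c. (\<Sum>i\<in>I. f (c i))\<^sup>2 \<partial>Pi\<^sub>M I (\<lambda>_. M)) = card I * (\<integral>x. (f x)\<^sup>2 \<partial>M)"
proof -
  have fm [measurable]: "f \<in> borel_measurable M" using f by (simp add: all_moments_def)
  have am: "all_moments (Pi\<^sub>M I (\<lambda>_. M)) (\<lambda>c. f (c i))" if "i \<in> I" for i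
    using that f by (rule PiM_all_moments_component)
  have zero: "(\<integral>c. f (c i) * f (c j) \<partial>Pi\<^sub>M I (\<lambda>_. M)) = 0" if "i \<in> I" "j \<in> I" "i \<noteq> j" for i j
  proof -
    have "integrable (Pi\<^sub>M I (\<lambda>_. M)) (\<lambda>c. f (c i) * f (c j))"
      using that am by (intro all_moments_integrable P.all_moments_mult)
    from PiM_integral_resample[OF that(1) this] show ?thesis
      using that(3) by (simp add: centered)
  qed
  have "(\<integral>c. (\<Sum>i\<in>I. f (c i))\<^sup>2 \<partial>Pi\<^sub>M I (\<lambda>_. M)) = (\<integral>c. (\<Sum>i\<in>I. \<Sum>j\<in>I. f (c i) * f (c j)) \<partial>Pi\<^sub>M I (\<lambda>_. M))"
    by (simp add: power2_eq_square sum_product)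
  also have "\<dots> = (\<Sum>i\<in>I. \<Sum>j\<in>I. \<integral>c. f (c i) * f (c j) \<partial>Pi\<^sub>M I (\<lambda>_. M))"
    using am by (intro integral_double_sum all_moments_integrable P.all_moments_mult)
  also have "\<dots> = (\<Sum>i\<in>I. \<Sum>j\<in>I. if i = j then (\<integral>x. (f x)\<^sup>2 \<partial>M) else 0)"
  proof (intro sum.cong refl)
    fix i j assume ij: "i \<in> I" "j \<in> I"
    show "(\<integral>c. f (c i) * f (c j) \<partial>Pi\<^sub>M I (\<lambda>_. M)) = (if i = j then (\<integral>x. (f x)\<^sup>2 \<partial>M) else 0)"
      using zero[OF ij] PiM_integral_component[OF ij(1), of "\<lambda>x. (f x)\<^sup>2"] by (auto simp: power2_eq_square)
  qed
  also have "\<dots> = card I * (\<integral>x. (f x)\<^sup>2 \<partial>M)"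
    using fin by simp
  finally show ?thesis .
qed

text \<open>Degeneracy makes two ordered pairs uncorrelated as soon as one has an index that the
  other lacks. A pair then correlates only with itself and its reversal, which gives the factor
  2.\<close>

lemma degenerate_ustat_second_moment:
  fixes k :: "'a \<Rightarrow> 'a \<Rightarrow> real" and s :: real
  assumes sym: "\<And>a b. k a b = k b a"
    and mom: "\<And>i j. i \<in> I \<Longrightarrow> j \<in> I \<Longrightarrow> i \<noteq> j \<Longrightarrow> all_moments (Pi\<^sub>M I (\<lambda>_. M)) (\<lambda>c. k (c i) (c j))"
    and deg: "\<And>b. (\<integral>a. k a b \<partial>M) = 0"
    and sec: "\<And>i j. i \<in> I \<Longrightarrow> j \<in> I \<Longrightarrow> i \<noteq> j \<Longrightarrow> (\<integral>c. (k (c i) (c j))\<^sup>2 \<partial>Pi\<^sub>M I (\<lambda>_. M)) \<le> s"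
    and s: "s \<ge> 0"
  shows "(\<integral>c. (\<Sum>i\<in>I. \<Sum>j\<in>I-{i}. k (c i) (c j))\<^sup>2 \<partial>Pi\<^sub>M I (\<lambda>_. M)) \<le> 2 * (card I)\<^sup>2 * s"
proof -
  define A where "A = (SIGMA i:I. I - {i})"
  define K where "K \<pi> c = k (c (fst \<pi>)) (c (snd \<pi>))" for \<pi> :: "'i \<times> 'i" and c
  have A: "finite A" and cA: "card A \<le> (card I)\<^sup>2"
    using fin card_mono[of "I \<times> I" A] by (auto simp: A_def card_cartesian_product power2_eq_square)
  have am: "all_moments (Pi\<^sub>M I (\<lambda>_. M)) (K \<pi>)" if "\<pi> \<in> A" for \<pi>
    using that unfolding K_def by (intro mom) (auto simp: A_def)
  have zero: "(\<integral>c. k (c i) (c j) * k (c r) (c t) \<partial>Pi\<^sub>M I (\<lambda>_. M)) = 0"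
    if "i \<in> I" "j \<in> I" "r \<in> I" "t \<in> I" "i \<noteq> j" "i \<noteq> r" "i \<noteq> t" "r \<noteq> t" for i j r t
  proof -
    have "integrable (Pi\<^sub>M I (\<lambda>_. M)) (\<lambda>c. k (c i) (c j) * k (c r) (c t))"
      using that mom by (intro all_moments_integrable P.all_moments_mult)
    from PiM_integral_resample[OF that(1) this] show ?thesis
      using that by (simp add: deg)
  qed
  have KK: "(\<integral>c. K \<pi> c * K \<rho> c \<partial>Pi\<^sub>M I (\<lambda>_. M)) = 0"
    if \<pi>: "\<pi> \<in> A" and \<rho>: "\<rho> \<in> A" and ne: "\<rho> \<notin> {\<pi>, prod.swap \<pi>}" for \<pi> \<rho>
  proof -
    obtain i j r t where [simp]: "\<pi> = (i, j)" "\<rho> = (r, t)" by (metis surj_pair)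
    have "(i \<noteq> r \<and> i \<noteq> t) \<or> (j \<noteq> r \<and> j \<noteq> t)"
      using ne \<pi> \<rho> by (auto simp: A_def)
    then show ?thesis
    proof
      assume "i \<noteq> r \<and> i \<noteq> t"
      then show ?thesis using zero[of i j r t] \<pi> \<rho> by (auto simp: A_def K_def)
    next
      assume "j \<noteq> r \<and> j \<noteq> t"
      then have "(\<integral>c. k (c j) (c i) * k (c r) (c t) \<partial>Pi\<^sub>M I (\<lambda>_. M)) = 0"
        using zero[of j i r t] \<pi> \<rho> by (auto simp: A_def)
      moreover have "K \<pi> c * K \<rho> c = k (c j) (c i) * k (c r) (c t)" for c
        by (simp add: K_def sym[of "c i"])
      ultimately show ?thesis by simp
    qed
  qed
  have bound: "(\<Sum>\<rho>\<in>A. \<integral>c. K \<pi> c * K \<rho> c \<partial>Pi\<^sub>M I (\<lambda>_. M)) \<le> 2 * s" if \<pi>: "\<pi> \<in> A" for \<pi>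
  proof -
    have sw: "prod.swap \<pi> \<in> A" "prod.swap \<pi> \<noteq> \<pi>" using \<pi> by (auto simp: A_def)
    have "(\<Sum>\<rho>\<in>A. \<integral>c. K \<pi> c * K \<rho> c \<partial>Pi\<^sub>M I (\<lambda>_. M)) = (\<Sum>\<rho>\<in>{\<pi>, prod.swap \<pi>}. \<integral>c. K \<pi> c * K \<rho> c \<partial>Pi\<^sub>M I (\<lambda>_. M))"
      using \<pi> sw A KK by (intro sum.mono_neutral_right) auto
    also have "\<dots> = 2 * (\<integral>c. (K \<pi> c)\<^sup>2 \<partial>Pi\<^sub>M I (\<lambda>_. M))"
    proof -
      have "K (prod.swap \<pi>) c = K \<pi> c" for c by (simp add: K_def) (rule sym)
      then show ?thesis using sw by (simp add: power2_eq_square)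
    qed
    also have "(\<integral>c. (K \<pi> c)\<^sup>2 \<partial>Pi\<^sub>M I (\<lambda>_. M)) \<le> s"
      unfolding K_def using \<pi> by (intro sec) (auto simp: A_def)
    finally show ?thesis by simp
  qed
  have "(\<integral>c. (\<Sum>i\<in>I. \<Sum>j\<in>I-{i}. k (c i) (c j))\<^sup>2 \<partial>Pi\<^sub>M I (\<lambda>_. M)) = (\<integral>c. (\<Sum>\<pi>\<in>A. K \<pi> c)\<^sup>2 \<partial>Pi\<^sub>M I (\<lambda>_. M))"
    using fin by (simp add: A_def K_def sum.Sigma case_prod_beta)
  also have "\<dots> = (\<integral>c. (\<Sum>\<pi>\<in>A. \<Sum>\<rho>\<in>A. K \<pi> c * K \<rho> c) \<partial>Pi\<^sub>M I (\<lambda>_. M))"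
    by (simp add: power2_eq_square sum_product)
  also have "\<dots> = (\<Sum>\<pi>\<in>A. \<Sum>\<rho>\<in>A. \<integral>c. K \<pi> c * K \<rho> c \<partial>Pi\<^sub>M I (\<lambda>_. M))"
    using am by (intro integral_double_sum all_moments_integrable P.all_moments_mult)
  also have "\<dots> \<le> (\<Sum>\<pi>\<in>A. 2 * s)"
    by (intro sum_mono bound)
  also have "\<dots> = 2 * real (card A) * s" by simp
  also have "\<dots> \<le> 2 * real ((card I)\<^sup>2) * s"
    using cA s by (intro mult_right_mono mult_left_mono of_nat_mono) auto
  finally show ?thesis by simp
qed

end

section \<open>Gaussian vectors\<close>

text \<open>Vectors are functions on \<open>nat\<close> read only below \<open>p\<close>, so one
  type serves the dimensions p, q and n alike.\<close>

definition dot :: "nat \<Rightarrow> (nat \<Rightarrow> real) \<Rightarrow> (nat \<Rightarrow> real) \<Rightarrow> real" where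
  "dot p u v = (\<Sum>i<p. u i * v i)"

definition gvec :: "nat \<Rightarrow> (nat \<Rightarrow> real) measure" where
  "gvec p = PiM {..<p} (\<lambda>_. std_normal_distribution)"

lemma prob_space_std_normal: "prob_space std_normal_distribution"
  by (rule prob_space_normal_density) simp

lemma prob_space_gvec: "prob_space (gvec p)"
  unfolding gvec_def by (intro prob_space_PiM prob_space_std_normal)

interpretation gvec: prob_space "gvec p" for p
  by (rule prob_space_gvec)

lemma integrable_std_normal_abs_power:
  "integrable std_normal_distribution (\<lambda>x. \<bar>x\<bar> ^ k)"
  using integrable_std_normal_moment_abs[of k] by (subst integrable_density) (auto simp: normal_density_nonneg)

lemma all_moments_std_normal: "all_moments std_normal_distribution (\<lambda>x. x)"
  unfolding all_moments_def using integrable_std_normal_abs_power by auto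

definition std_moment :: "nat \<Rightarrow> real" where
  "std_moment k = (\<integral>x. x ^ k \<partial>std_normal_distribution)"

lemma std_moment_simps:
  "std_moment 0 = 1" "std_moment (Suc 0) = 0" "std_moment 2 = 1" "std_moment 3 = 0" "std_moment 4 = 3"
  "std_moment 6 = 15"
proof -
  have ev: "std_moment (2 * k) = fact (2 * k) / (2 ^ k * fact k)" for k
    unfolding std_moment_def by (subst integral_density) (auto simp: normal_density_nonneg integral_std_normal_moment_even)
  have od: "std_moment (2 * k + 1) = 0" for k
    unfolding std_moment_def using integral_std_normal_moment_odd[of k]
    by (subst integral_density) (auto simp: normal_density_nonneg)
  show "std_moment 0 = 1" "std_moment (Suc 0) = 0" "std_moment 2 = 1" "std_moment 3 = 0" "std_moment 4 = 3"
    "std_moment 6 = 15"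
    using ev[of 0] od[of 0] ev[of 1] od[of 1] ev[of 2] ev[of 3] by (simp_all add: fact_numeral)
qed

lemma std_moment_Suc:
  "std_moment 0 = 1" "std_moment (Suc 0) = 0" "std_moment (Suc (Suc 0)) = 1"
  "std_moment (Suc (Suc (Suc 0))) = 0" "std_moment (Suc (Suc (Suc (Suc 0)))) = 3"
  using std_moment_simps by (simp_all add: eval_nat_numeral)

lemma gvec_all_moments [intro]: "i < p \<Longrightarrow> all_moments (gvec p) (\<lambda>g. g i)"
  unfolding gvec_def
  by (intro PiM_all_moments_component[OF prob_space_std_normal] all_moments_std_normal) auto

lemma gvec_moment_prod:
  fixes e :: "nat \<Rightarrow> nat"
  shows
  "(\<integral>g. (\<Prod>r<p. g r ^ e r) \<partial>gvec p) = (\<Prod>r<p. std_moment (e r))"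
proof -
  interpret product_sigma_finite "\<lambda>_::nat. std_normal_distribution"
    by (intro product_sigma_finite.intro prob_space_imp_sigma_finite prob_space_std_normal)
  interpret N: prob_space std_normal_distribution by (rule prob_space_std_normal)
  show ?thesis
    unfolding gvec_def std_moment_def
    by (rule product_integral_prod) (auto intro!: all_moments_integrable N.all_moments_power all_moments_std_normal)
qed

lemma gvec_second_moment:
  assumes "i < p" "j < p"
  shows "(\<integral>g. g i * g j \<partial>gvec p) = of_bool (i = j)"
proof -
  define e :: "nat \<Rightarrow> nat" where "e r = of_bool (r = i) + of_bool (r = j)" for r
  have "(\<Prod>r<p. g r ^ e r) = g i * g j" for g :: "nat \<Rightarrow> real"
    using assms by (simp add: e_def power_add prod.distrib of_bool_def if_distrib[where f = "\<lambda>k. _ ^ k"] cong: if_cong)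
  then have "(\<integral>g. g i * g j \<partial>gvec p) = (\<Prod>r<p. std_moment (e r))"
    using gvec_moment_prod[of p e] by simp
  also have "\<dots> = (\<Prod>r\<in>{i, j}. std_moment (e r))"
    using assms by (intro prod.mono_neutral_right) (auto simp: e_def std_moment_Suc)
  also have "\<dots> = of_bool (i = j)"
    by (cases "i = j") (auto simp: e_def std_moment_Suc)
  finally show ?thesis .
qed

text \<open>Wick's formula. \<open>e r\<close> counts the occurrences of coordinate r, the
  expectation factors over coordinates, and odd multiplicities kill the product.\<close>

lemma gvec_fourth_moment:
  assumes "i < p" "j < p" "k < p" "l < p"
  shows "(\<integral>g. g i * g j * g k * g l \<partial>gvec p) =
    of_bool (i = j \<and> k = l) + of_bool (i = k \<and> j = l) + of_bool (i = l \<and> j = k)"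
proof -
  define e :: "nat \<Rightarrow> nat" where "e r = of_bool (r = i) + of_bool (r = j) + of_bool (r = k) + of_bool (r = l)" for r
  have "(\<Prod>r<p. g r ^ e r) = g i * g j * g k * g l" for g :: "nat \<Rightarrow> real"
    using assms by (simp add: e_def power_add prod.distrib of_bool_def if_distrib[where f = "\<lambda>k. _ ^ k"] cong: if_cong)
  then have "(\<integral>g. g i * g j * g k * g l \<partial>gvec p) = (\<Prod>r<p. std_moment (e r))"
    using gvec_moment_prod[of p e] by simp
  also have "\<dots> = (\<Prod>r\<in>{i, j, k, l}. std_moment (e r))"
    using assms by (intro prod.mono_neutral_right) (auto simp: e_def std_moment_Suc)
  also have "\<dots> = of_bool (i = j \<and> k = l) + of_bool (i = k \<and> j = l) + of_bool (i = l \<and> j = k)"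
    by (cases "i = j"; cases "i = k"; cases "i = l"; cases "j = k"; cases "j = l"; cases "k = l")
      (auto simp: e_def std_moment_Suc prod.insert_if)
  finally show ?thesis .
qed

lemma gvec_sixth_moment:
  assumes "i < p"
  shows "(\<integral>g. g i ^ 6 \<partial>gvec p) = 15"
  using PiM_integral_component[OF prob_space_std_normal, of "{..<p}" i "\<lambda>x. x ^ 6"] assms
    std_moment_simps(6)
  by (simp add: gvec_def std_moment_def)

lemma gvec_dot_moments [intro]: "all_moments (gvec p) (\<lambda>g. dot p u g)"
  unfolding dot_def by (intro gvec.moment_intros) auto

lemma sum_of_bool_eq: "(i::nat) < p \<Longrightarrow> (\<Sum>k<p. f k * of_bool (i = k)) = (f i :: real)"
  by (subst sum.mono_neutral_right[of "{..<p}" "{i}"]) auto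

text \<open>Subtracting the diagonal removes one of the three pairings in Wick's formula, and the
  symmetry of \<open>A\<close> makes the other two contribute equally. The conditional variances of
  the linear term and of the U-statistic kernels all reduce to this identity.\<close>

lemma gvec_quadratic:
  assumes sym: "\<And>i k. A i k = A k i"
  shows "(\<integral>g. (\<Sum>i<p. \<Sum>k<p. A i k * (g i * g k - of_bool (i = k)))\<^sup>2 \<partial>gvec p) = 2 * (\<Sum>i<p. \<Sum>k<p. (A i k)\<^sup>2)"
proof -
  define Q where "Q = {..<p} \<times> {..<p}"
  define h where "h \<pi> g = A (fst \<pi>) (snd \<pi>) * (g (fst \<pi>) * g (snd \<pi>) - of_bool (fst \<pi> = snd \<pi>))" for \<pi> and g :: "nat \<Rightarrow> real"
  have am: "all_moments (gvec p) (h \<pi>)" if "\<pi> \<in> Q" for \<pi>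
    using that unfolding h_def by (intro gvec.moment_intros) (auto simp: Q_def)
  have cov: "(\<integral>g. h \<pi> g * h \<rho> g \<partial>gvec p) = A (fst \<pi>) (snd \<pi>) * A (fst \<rho>) (snd \<rho>) * (of_bool (\<rho> = \<pi>) + of_bool (\<rho> = prod.swap \<pi>))"
    if "\<pi> \<in> Q" "\<rho> \<in> Q" for \<pi> \<rho>
  proof -
    obtain i k j l where [simp]: "\<pi> = (i, k)" "\<rho> = (j, l)" by (metis surj_pair)
    have lt: "i < p" "k < p" "j < p" "l < p" using that by (auto simp: Q_def)
    have "h \<pi> g * h \<rho> g = A i k * A j l * (g i * g k * g j * g l - of_bool (i = k) * (g j * g l)
        - of_bool (j = l) * (g i * g k) + of_bool (i = k) * of_bool (j = l))" for g
      by (simp add: h_def algebra_simps)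
    moreover have "integrable (gvec p) (\<lambda>g. g i * g k * g j * g l)" "integrable (gvec p) (\<lambda>g. g j * g l)" "integrable (gvec p) (\<lambda>g. g i * g k)"
      by (intro all_moments_integrable gvec.all_moments_mult gvec_all_moments lt)+
    ultimately have "(\<integral>g. h \<pi> g * h \<rho> g \<partial>gvec p) = A i k * A j l * ((\<integral>g. g i * g k * g j * g l \<partial>gvec p) - of_bool (i = k) * (\<integral>g. g j * g l \<partial>gvec p)
        - of_bool (j = l) * (\<integral>g. g i * g k \<partial>gvec p) + of_bool (i = k) * of_bool (j = l))"
      by (simp add: gvec.prob_space)
    also have "\<dots> = A i k * A j l * (of_bool (i = j \<and> k = l) + of_bool (i = l \<and> k = j))"
      by (simp add: gvec_fourth_moment gvec_second_moment lt)
    finally show ?thesis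
      by (simp add: conj_commute eq_commute)
  qed
  have "(\<integral>g. (\<Sum>i<p. \<Sum>k<p. A i k * (g i * g k - of_bool (i = k)))\<^sup>2 \<partial>gvec p) = (\<integral>g. (\<Sum>\<pi>\<in>Q. \<Sum>\<rho>\<in>Q. h \<pi> g * h \<rho> g) \<partial>gvec p)"
  proof -
    have "(\<Sum>i<p. \<Sum>k<p. A i k * (g i * g k - of_bool (i = k))) = (\<Sum>\<pi>\<in>Q. h \<pi> g)" for g
      by (simp add: h_def Q_def sum.cartesian_product case_prod_beta)
    then show ?thesis by (simp add: power2_eq_square sum_product)
  qed
  also have "\<dots> = (\<Sum>\<pi>\<in>Q. \<Sum>\<rho>\<in>Q. \<integral>g. h \<pi> g * h \<rho> g \<partial>gvec p)"
    using am by (intro integral_double_sum all_moments_integrable gvec.all_moments_mult)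
  also have "\<dots> = (\<Sum>\<pi>\<in>Q. A (fst \<pi>) (snd \<pi>) * A (fst \<pi>) (snd \<pi>) + A (fst \<pi>) (snd \<pi>) * A (snd \<pi>) (fst \<pi>))"
  proof (intro sum.cong refl)
    fix \<pi> assume \<pi>: "\<pi> \<in> Q"
    have sw: "prod.swap \<pi> \<in> Q" "finite Q" using \<pi> by (auto simp: Q_def)
    define f where "f \<rho> = A (fst \<pi>) (snd \<pi>) * A (fst \<rho>) (snd \<rho>)" for \<rho>
    have delta: "(\<Sum>\<rho>\<in>Q. f \<rho> * of_bool (\<rho> = \<sigma>)) = f \<sigma>" if "\<sigma> \<in> Q" for \<sigma>
      using that sw by (subst sum.mono_neutral_right[of Q "{\<sigma>}"]) auto
    have "(\<Sum>\<rho>\<in>Q. \<integral>g. h \<pi> g * h \<rho> g \<partial>gvec p) = (\<Sum>\<rho>\<in>Q. f \<rho> * of_bool (\<rho> = \<pi>) + f \<rho> * of_bool (\<rho> = prod.swap \<pi>))"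
      using \<pi> by (intro sum.cong refl) (simp only: cov f_def distrib_left)
    also have "\<dots> = f \<pi> + f (prod.swap \<pi>)"
      using \<pi> sw by (simp only: sum.distrib delta)
    also have "\<dots> = A (fst \<pi>) (snd \<pi>) * A (fst \<pi>) (snd \<pi>) + A (fst \<pi>) (snd \<pi>) * A (snd \<pi>) (fst \<pi>)"
      by (simp add: f_def)
    finally show "(\<Sum>\<rho>\<in>Q. \<integral>g. h \<pi> g * h \<rho> g \<partial>gvec p) = \<dots>" .
  qed
  also have "\<dots> = 2 * (\<Sum>\<pi>\<in>Q. (A (fst \<pi>) (snd \<pi>))\<^sup>2)"
  proof -
    have "A (fst \<pi>) (snd \<pi>) * A (snd \<pi>) (fst \<pi>) = A (fst \<pi>) (snd \<pi>) * A (fst \<pi>) (snd \<pi>)" for \<pi> :: "nat \<times> nat"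
      using sym[of "fst \<pi>" "snd \<pi>"] by simp
    then show ?thesis by (simp only: power2_eq_square sum_distrib_left mult_2)
  qed
  finally show ?thesis by (simp add: Q_def sum.cartesian_product case_prod_beta)
qed

lemma gvec_dot_dot: "(\<integral>g. dot p u g * dot p v g \<partial>gvec p) = dot p u v"
proof -
  have "(\<integral>g. dot p u g * dot p v g \<partial>gvec p) = (\<integral>g. (\<Sum>i<p. \<Sum>k<p. u i * v k * (g i * g k)) \<partial>gvec p)"
    by (simp add: dot_def sum_product mult_ac)
  also have "\<dots> = (\<Sum>i<p. \<Sum>k<p. \<integral>g. u i * v k * (g i * g k) \<partial>gvec p)"
    by (intro integral_double_sum all_moments_integrable gvec.moment_intros) auto
  also have "\<dots> = dot p u v"
    by (simp add: gvec_second_moment dot_def of_bool_def if_distrib cong: if_cong)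
  finally show ?thesis .
qed

lemma gvec_quadratic_dot:
  assumes sym: "\<And>j l. B j l = B l j"
  shows "(\<integral>g. (\<Sum>j<q. \<Sum>l<q. B j l * (dot p (y j) g * dot p (y l) g - dot p (y j) (y l)))\<^sup>2 \<partial>gvec p) =
    2 * (\<Sum>i<p. \<Sum>k<p. (\<Sum>j<q. \<Sum>l<q. B j l * y j i * y l k)\<^sup>2)"
proof -
  define A where "A i k = (\<Sum>j<q. \<Sum>l<q. B j l * y j i * y l k)" for i k
  have "A i k = A k i" for i k
    unfolding A_def by (subst sum.swap) (simp add: sym mult_ac)
  moreover have "(\<Sum>j<q. \<Sum>l<q. B j l * (dot p (y j) g * dot p (y l) g - dot p (y j) (y l))) =
      (\<Sum>i<p. \<Sum>k<p. A i k * (g i * g k - of_bool (i = k)))" for g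
  proof -
    have "dot p (y j) g * dot p (y l) g - dot p (y j) (y l) = (\<Sum>i<p. \<Sum>k<p. y j i * y l k * (g i * g k - of_bool (i = k)))" for j l
      by (simp add: right_diff_distrib sum_subtractf sum_of_bool_eq) (simp add: dot_def sum_product mult_ac)
    then have "(\<Sum>j<q. \<Sum>l<q. B j l * (dot p (y j) g * dot p (y l) g - dot p (y j) (y l))) =
       (\<Sum>j<q. \<Sum>l<q. \<Sum>i<p. \<Sum>k<p. B j l * y j i * y l k * (g i * g k - of_bool (i = k)))"
      by (simp add: sum_distrib_left mult.assoc)
    also have "\<dots> = (\<Sum>j<q. \<Sum>i<p. \<Sum>k<p. \<Sum>l<q. B j l * y j i * y l k * (g i * g k - of_bool (i = k)))"
      by (intro sum.cong refl) (subst sum.swap, intro sum.cong refl, rule sum.swap)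
    also have "\<dots> = (\<Sum>i<p. \<Sum>k<p. \<Sum>j<q. \<Sum>l<q. B j l * y j i * y l k * (g i * g k - of_bool (i = k)))"
      by (subst sum.swap) (intro sum.cong refl, rule sum.swap)
    finally show ?thesis by (simp add: A_def sum_distrib_right)
  qed
  ultimately show ?thesis using gvec_quadratic[of A p] by (simp add: A_def)
qed

lemma gvec_dot_centered: "(\<integral>g. dot p u g * dot p v g - dot p u v \<partial>gvec p) = 0"
proof -
  have "integrable (gvec p) (\<lambda>g. dot p u g * dot p v g)"
    by (intro all_moments_integrable gvec.all_moments_mult gvec_dot_moments)
  then show ?thesis by (simp add: gvec_dot_dot gvec.prob_space)
qed

lemma gvec_dot_covariance:
  "(\<integral>g. (dot p u g * dot p v g - dot p u v)\<^sup>2 \<partial>gvec p) = dot p u u * dot p v v + (dot p u v)\<^sup>2"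
proof -
  define A where "A i k = (u i * v k + v i * u k) / 2" for i k
  have "dot p u g * dot p v g - dot p u v = (\<Sum>i<p. \<Sum>k<p. A i k * (g i * g k - of_bool (i = k)))" for g
  proof -
    have "(\<Sum>i<p. \<Sum>k<p. A i k * (g i * g k)) = dot p u g * dot p v g"
    proof -
      have "(\<Sum>i<p. \<Sum>k<p. A i k * (g i * g k)) = (\<Sum>i<p. \<Sum>k<p. (u i * g i) * (v k * g k)) / 2 + (\<Sum>i<p. \<Sum>k<p. (v i * g i) * (u k * g k)) / 2"
        by (simp add: A_def algebra_simps add_divide_distrib sum.distrib sum_divide_distrib)
      then show ?thesis by (simp add: dot_def flip: sum_product)
    qed
    moreover have "(\<Sum>i<p. \<Sum>k<p. A i k * of_bool (i = k)) = dot p u v"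
      by (simp add: A_def dot_def of_bool_def if_distrib cong: if_cong)
    ultimately show ?thesis by (simp add: right_diff_distrib sum_subtractf)
  qed
  then have "(\<integral>g. (dot p u g * dot p v g - dot p u v)\<^sup>2 \<partial>gvec p) = 2 * (\<Sum>i<p. \<Sum>k<p. (A i k)\<^sup>2)"
    using gvec_quadratic[of A p] by (simp add: A_def add.commute)
  also have "\<dots> = (\<Sum>i<p. \<Sum>k<p. (u i * u i) * (v k * v k)) / 2 + (\<Sum>i<p. \<Sum>k<p. (v i * v i) * (u k * u k)) / 2 + (\<Sum>i<p. \<Sum>k<p. (u i * v i) * (u k * v k))"
    by (simp add: A_def power2_eq_square sum_distrib_left sum_divide_distrib add_divide_distrib flip: sum.distrib)
      (intro sum.cong refl, simp add: field_simps)
  finally show ?thesis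
    by (simp add: dot_def power2_eq_square flip: sum_product)
qed

lemma gvec_dot_fourth: "(\<integral>g. dot p u g ^ 4 \<partial>gvec p) = 3 * (dot p u u)\<^sup>2"
proof -
  have "dot p u g ^ 4 = (dot p u g * dot p u g - dot p u u)\<^sup>2 + 2 * dot p u u * (dot p u g * dot p u g - dot p u u) + (dot p u u)\<^sup>2" for g
    by algebra
  then have "(\<integral>g. dot p u g ^ 4 \<partial>gvec p) = (\<integral>g. (dot p u g * dot p u g - dot p u u)\<^sup>2 \<partial>gvec p)
      + 2 * dot p u u * (\<integral>g. dot p u g * dot p u g - dot p u u \<partial>gvec p) + (dot p u u)\<^sup>2"
    by (simp add: gvec.prob_space all_moments_integrable gvec.moment_intros gvec_dot_moments)
  then show ?thesis by (simp add: gvec_dot_covariance gvec_dot_centered) (simp add: power2_eq_square)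
qed

lemma gvec_norm_moments [intro]: "all_moments (gvec p) (\<lambda>g. dot p g g)"
  unfolding dot_def by (intro gvec.moment_intros) auto

lemma gvec_norm_mean: "(\<integral>g. dot p g g \<partial>gvec p) = p"
proof -
  have "integrable (gvec p) (\<lambda>g. g i * g i)" if "i < p" for i
    using that by (intro all_moments_integrable gvec.all_moments_mult gvec_all_moments)
  then show ?thesis by (simp add: dot_def gvec_second_moment)
qed

lemma gvec_norm_variance: "(\<integral>g. (dot p g g - p)\<^sup>2 \<partial>gvec p) = 2 * p"
proof -
  define A :: "nat \<Rightarrow> nat \<Rightarrow> real" where "A i k = of_bool (i = k)" for i k
  have "dot p g g - p = (\<Sum>i<p. \<Sum>k<p. A i k * (g i * g k - of_bool (i = k)))" for g
    by (simp add: mult.commute[of "A _ _"]) (simp add: A_def sum_of_bool_eq dot_def sum_subtractf)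
  moreover have "(\<Sum>i<p. \<Sum>k<p. (A i k)\<^sup>2) = p"
    by (simp add: power2_eq_square) (simp add: A_def sum_of_bool_eq)
  ultimately show ?thesis
    using gvec_quadratic[of A p] by (simp add: A_def eq_commute)
qed

lemma gvec_norm_fourth: "(\<integral>g. (dot p g g)\<^sup>2 \<partial>gvec p) = (real p)\<^sup>2 + 2 * p"
proof -
  have "(dot p g g)\<^sup>2 = (dot p g g - p)\<^sup>2 + 2 * p * dot p g g - (real p)\<^sup>2" for g
    by (simp add: power2_eq_square algebra_simps)
  then have "(\<integral>g. (dot p g g)\<^sup>2 \<partial>gvec p) = (\<integral>g. (dot p g g - p)\<^sup>2 \<partial>gvec p) + 2 * p * (\<integral>g. dot p g g \<partial>gvec p) - (real p)\<^sup>2"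
    by (simp add: gvec.prob_space all_moments_integrable gvec.moment_intros gvec_norm_moments)
  then show ?thesis by (simp add: gvec_norm_variance gvec_norm_mean) (simp add: power2_eq_square)
qed

lemma sum_cube_le:
  fixes a :: "nat \<Rightarrow> real"
  assumes "\<And>i. i < p \<Longrightarrow> a i \<ge> 0"
  shows "(\<Sum>i<p. a i) ^ 3 \<le> (real p)\<^sup>2 * (\<Sum>i<p. a i ^ 3)"
proof (cases "p = 0")
  case False
  have "((\<Sum>i<p. (1 / p) * a i)) ^ 3 \<le> (\<Sum>i<p. (1 / p) * a i ^ 3)"
  proof -
    have "convex_on {0..} (\<lambda>x::real. x ^ 3)" by (rule convex_power_odd) simp
    from convex_on_sum[OF _ _ this, of "{..<p}" "\<lambda>_. 1 / p" a] show ?thesis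
      using assms False by (auto simp: lessThan_empty_iff)
  qed
  then have "(1 / p) ^ 3 * (\<Sum>i<p. a i) ^ 3 \<le> (1 / p) * (\<Sum>i<p. a i ^ 3)"
    by (simp add: sum_divide_distrib[symmetric] power_divide)
  then show ?thesis using False
    by (simp add: field_simps power2_eq_square power3_eq_cube)
qed simp

text \<open>The power mean inequality and E g^6 = 15 replace the exact value p (p + 2) (p + 4); only
  the order p^3 matters, since the bound enters an error term.\<close>

lemma gvec_norm_sixth: "(\<integral>g. (dot p g g) ^ 3 \<partial>gvec p) \<le> 15 * real p ^ 3"
proof -
  have "(\<integral>g. (dot p g g) ^ 3 \<partial>gvec p) \<le> (\<integral>g. (real p)\<^sup>2 * (\<Sum>i<p. g i ^ 6) \<partial>gvec p)"
  proof (rule integral_mono)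
    show "integrable (gvec p) (\<lambda>g. dot p g g ^ 3)"
      by (intro all_moments_integrable gvec.moment_intros) auto
    show "integrable (gvec p) (\<lambda>g. (real p)\<^sup>2 * (\<Sum>i<p. g i ^ 6))"
      by (intro all_moments_integrable gvec.moment_intros) auto
    fix g :: "nat \<Rightarrow> real"
    show "dot p g g ^ 3 \<le> (real p)\<^sup>2 * (\<Sum>i<p. g i ^ 6)"
      using sum_cube_le[of p "\<lambda>i. g i * g i"] by (simp add: dot_def power_mult_distrib flip: power_add)
  qed
  also have "\<dots> = (real p)\<^sup>2 * (\<Sum>i<p. 15)"
  proof -
    have "integrable (gvec p) (\<lambda>g. g i ^ 6)" if "i < p" for i
      using that by (intro all_moments_integrable gvec.all_moments_power gvec_all_moments)
    then show ?thesis by (simp add: gvec_sixth_moment)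
  qed
  finally show ?thesis by (simp add: power2_eq_square power3_eq_cube)
qed

section \<open>Gram matrices\<close>

definition gram :: "nat \<Rightarrow> (nat \<Rightarrow> nat \<Rightarrow> real) \<Rightarrow> nat \<Rightarrow> nat \<Rightarrow> real" where
  "gram p y j l = dot p (y j) (y l)"

definition tr :: "nat \<Rightarrow> (nat \<Rightarrow> nat \<Rightarrow> real) \<Rightarrow> real" where
  "tr q C = (\<Sum>j<q. C j j)"

definition fro :: "nat \<Rightarrow> (nat \<Rightarrow> nat \<Rightarrow> real) \<Rightarrow> real" where
  "fro q C = (\<Sum>j<q. \<Sum>l<q. (C j l)\<^sup>2)"

definition tr3 :: "nat \<Rightarrow> (nat \<Rightarrow> nat \<Rightarrow> real) \<Rightarrow> (nat \<Rightarrow> nat \<Rightarrow> real) \<Rightarrow> (nat \<Rightarrow> nat \<Rightarrow> real) \<Rightarrow> real" where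
  "tr3 q A B C = (\<Sum>j<q. \<Sum>l<q. \<Sum>k<q. A j l * B l k * C k j)"

text \<open>The Gram matrix of the combined columns is B C B'. Writing such products as Gram
  matrices again makes positivity and Cauchy--Schwarz available without any spectral theory.\<close>

definition comb :: "nat \<Rightarrow> (nat \<Rightarrow> nat \<Rightarrow> real) \<Rightarrow> (nat \<Rightarrow> nat \<Rightarrow> real) \<Rightarrow> nat \<Rightarrow> nat \<Rightarrow> real" where
  "comb q B y j i = (\<Sum>l<q. B j l * y l i)"

lemma dot_commute: "dot p u v = dot p v u"
  by (simp add: dot_def mult.commute)

lemma dot_self_nonneg: "0 \<le> dot p u u"
  by (simp add: dot_def sum_nonneg)

lemma dot_Cauchy_Schwarz: "(dot p u v)\<^sup>2 \<le> dot p u u * dot p v v"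
  using Cauchy_Schwarz_ineq_sum[of u v "{..<p}"] by (simp add: dot_def power2_eq_square)

lemma gram_sym: "gram p y j l = gram p y l j"
  by (simp add: gram_def dot_commute)

lemma gram_diag_nonneg: "0 \<le> gram p y j j"
  by (simp add: gram_def dot_self_nonneg)

lemma tr_gram_nonneg: "0 \<le> tr q (gram p y)"
  by (simp add: tr_def sum_nonneg gram_diag_nonneg)

lemma fro_nonneg: "0 \<le> fro q C"
  by (simp add: fro_def sum_nonneg)

lemma gram_Cauchy_Schwarz: "(gram p y j l)\<^sup>2 \<le> gram p y j j * gram p y l l"
  by (simp add: gram_def dot_Cauchy_Schwarz)

lemma fro_gram_le: "fro q (gram p y) \<le> (tr q (gram p y))\<^sup>2"
proof -
  have "fro q (gram p y) \<le> (\<Sum>j<q. \<Sum>l<q. gram p y j j * gram p y l l)"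
    unfolding fro_def by (intro sum_mono gram_Cauchy_Schwarz)
  also have "\<dots> = (tr q (gram p y))\<^sup>2"
    by (simp add: tr_def power2_eq_square sum_product)
  finally show ?thesis .
qed

lemma sum_diag_squares_le_fro: "(\<Sum>j<q. (C j j)\<^sup>2) \<le> fro q C"
  unfolding fro_def by (intro sum_mono member_le_sum) auto

lemma double_sum_Cauchy_Schwarz:
  "(\<Sum>j<q. \<Sum>l<q. A j l * B j l) \<le> sqrt (fro q A) * sqrt (fro q B)"
proof -
  have "(\<Sum>\<pi>\<in>{..<q}\<times>{..<q}. A (fst \<pi>) (snd \<pi>) * B (fst \<pi>) (snd \<pi>))\<^sup>2 \<le>
     (\<Sum>\<pi>\<in>{..<q}\<times>{..<q}. (A (fst \<pi>) (snd \<pi>))\<^sup>2) * (\<Sum>\<pi>\<in>{..<q}\<times>{..<q}. (B (fst \<pi>) (snd \<pi>))\<^sup>2)"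
    by (rule Cauchy_Schwarz_ineq_sum)
  then have "(\<Sum>j<q. \<Sum>l<q. A j l * B j l)\<^sup>2 \<le> fro q A * fro q B"
    by (simp add: fro_def sum.cartesian_product case_prod_beta)
  then show ?thesis
    by (metis real_le_rsqrt real_sqrt_mult)
qed

lemma sum_rotate:
  "(\<Sum>i\<in>A. \<Sum>j\<in>B. \<Sum>k\<in>C. f i j k) = (\<Sum>j\<in>B. \<Sum>k\<in>C. \<Sum>i\<in>A. f i j k)"
  by (subst sum.swap, rule sum.cong[OF refl], rule sum.swap)

lemma gram_comb: "gram p (comb q B y) j k = (\<Sum>l<q. \<Sum>m<q. B j l * B k m * gram p y l m)"
proof -
  have "gram p (comb q B y) j k = (\<Sum>i<p. \<Sum>l<q. \<Sum>m<q. B j l * B k m * (y l i * y m i))"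
    by (simp add: gram_def dot_def comb_def sum_product mult_ac)
  also have "\<dots> = (\<Sum>l<q. \<Sum>m<q. \<Sum>i<p. B j l * B k m * (y l i * y m i))"
    by (rule sum_rotate)
  finally show ?thesis by (simp add: gram_def dot_def sum_distrib_left)
qed

lemma gram_positive: "0 \<le> (\<Sum>l<q. \<Sum>m<q. b l * b m * gram p y l m)"
  using gram_comb[of p q "\<lambda>_. b" y 0 0] gram_diag_nonneg[of p "comb q (\<lambda>_. b) y" 0] by simp

text \<open>For matrices Y and Z with columns y and z, both sides are the trace of Y' Y Z'
  Z.\<close>

lemma sandwich_fro_eq:
  "(\<Sum>i<p. \<Sum>k<p. (\<Sum>j<q. y j i * z j k)\<^sup>2) = (\<Sum>j<q. \<Sum>l<q. gram p y j l * gram p z j l)"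
proof -
  have "(\<Sum>i<p. \<Sum>k<p. (\<Sum>j<q. y j i * z j k)\<^sup>2) = (\<Sum>i<p. \<Sum>k<p. \<Sum>j<q. \<Sum>l<q. (y j i * y l i) * (z j k * z l k))"
    by (simp add: power2_eq_square sum_product mult_ac)
  also have "\<dots> = (\<Sum>i<p. \<Sum>j<q. \<Sum>l<q. \<Sum>k<p. (y j i * y l i) * (z j k * z l k))"
    by (rule sum.cong[OF refl], rule sum_rotate)
  also have "\<dots> = (\<Sum>j<q. \<Sum>l<q. \<Sum>i<p. \<Sum>k<p. (y j i * y l i) * (z j k * z l k))"
    by (rule sum_rotate)
  finally show ?thesis by (simp add: gram_def dot_def sum_product)
qed

lemma sandwich_fro_le:
  "(\<Sum>i<p. \<Sum>k<p. (\<Sum>j<q. y j i * z j k)\<^sup>2) \<le> sqrt (fro q (gram p y)) * tr q (gram p z)"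
proof -
  have "(\<Sum>j<q. \<Sum>l<q. gram p y j l * gram p z j l) \<le> sqrt (fro q (gram p y)) * sqrt (fro q (gram p z))"
    by (rule double_sum_Cauchy_Schwarz)
  also have "sqrt (fro q (gram p z)) \<le> tr q (gram p z)"
    using real_sqrt_le_mono[OF fro_gram_le[of q p z]] tr_gram_nonneg[of q p z] by simp
  finally show ?thesis unfolding sandwich_fro_eq by (simp add: mult_left_mono fro_nonneg)
qed

lemma tr_gram_comb_gram: "tr q (gram p (comb q (gram p y) y)) = tr3 q (gram p y) (gram p y) (gram p y)"
  unfolding tr_def gram_comb tr3_def
  by (intro sum.cong refl) (simp add: gram_sym[of p y _ "_"] mult_ac)

text \<open>Row by row: for a row b of B, the form b C b' is the Frobenius inner product of C with
  the rank one matrix b' b, whose Frobenius norm is |b|^2.\<close>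

lemma tr_gram_comb_le: "tr q (gram p (comb q B y)) \<le> fro q B * sqrt (fro q (gram p y))"
proof -
  have "(\<Sum>l<q. \<Sum>m<q. (B j l * B j m) * gram p y l m) \<le> (\<Sum>l<q. (B j l)\<^sup>2) * sqrt (fro q (gram p y))" for j
  proof -
    have "fro q (\<lambda>l m. B j l * B j m) = (\<Sum>l<q. (B j l)\<^sup>2)\<^sup>2"
      by (simp add: fro_def power_mult_distrib) (simp add: power2_eq_square[of "sum _ _"] sum_product)
    then have "sqrt (fro q (\<lambda>l m. B j l * B j m)) = (\<Sum>l<q. (B j l)\<^sup>2)"
      by (simp add: sum_nonneg)
    then show ?thesis
      using double_sum_Cauchy_Schwarz[where q = q and A = "\<lambda>l m. B j l * B j m" and B = "gram p y"] by simp
  qed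
  then have "tr q (gram p (comb q B y)) \<le> (\<Sum>j<q. (\<Sum>l<q. (B j l)\<^sup>2) * sqrt (fro q (gram p y)))"
    unfolding tr_def gram_comb by (intro sum_mono)
  then show ?thesis by (simp add: fro_def[of q B] sum_distrib_right)
qed

text \<open>This bounds the squared Frobenius norm of Y B Y'. Moving B into one of the two factors
  as combined columns reduces it to the sandwich of Y with Y B', so the two preceding estimates
  apply.\<close>

lemma sandwich_fro_le_fro:
  "(\<Sum>i<p. \<Sum>k<p. (\<Sum>j<q. \<Sum>l<q. B j l * y j i * y l k)\<^sup>2) \<le> fro q (gram p y) * fro q B"
proof -
  have "(\<Sum>i<p. \<Sum>k<p. (\<Sum>j<q. \<Sum>l<q. B j l * y j i * y l k)\<^sup>2) = (\<Sum>i<p. \<Sum>k<p. (\<Sum>j<q. y j i * comb q B y j k)\<^sup>2)"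
    by (simp add: comb_def sum_distrib_left mult_ac)
  also have "\<dots> \<le> sqrt (fro q (gram p y)) * tr q (gram p (comb q B y))"
    by (rule sandwich_fro_le)
  also have "\<dots> \<le> sqrt (fro q (gram p y)) * (fro q B * sqrt (fro q (gram p y)))"
    by (intro mult_left_mono tr_gram_comb_le) (simp add: fro_nonneg)
  also have "\<dots> = fro q (gram p y) * fro q B"
    by (simp add: fro_nonneg)
  finally show ?thesis .
qed

text \<open>Chebyshev's association inequality for the spectral measure of a positive semidefinite matrix C at
  the unit vector j: the product of the (j,j) entries of C and of its square is at most that of its cube.\<close>

lemma diag_times_row_le:
  assumes j: "j < q"
  shows "gram p y j j * (\<Sum>l<q. (gram p y j l)\<^sup>2) \<le> gram p (comb q (gram p y) y) j j"
proof -
  define Q where "Q = (\<Sum>l<q. (gram p y j l)\<^sup>2)"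
  define G where "G = gram p (comb q (gram p y) y) j j"
  define c where "c = gram p y j j"
  have c: "c \<ge> 0" by (simp add: c_def gram_diag_nonneg)
  have Q: "c\<^sup>2 \<le> Q" unfolding Q_def c_def using j by (intro member_le_sum) auto
  \<comment> \<open>The (j,j) entry of C^2 is the inner product of column j of Y with the combined
    column, whose squared norm is the (j,j) entry of C^3. Cauchy--Schwarz then yields Q^2 <= c G,
    and c^2 <= Q finishes.\<close>
  have "Q = dot p (y j) (comb q (gram p y) y j)"
  proof -
    have "dot p (y j) (comb q (gram p y) y j) = (\<Sum>i<p. \<Sum>l<q. gram p y j l * (y j i * y l i))"
      by (simp add: dot_def comb_def sum_distrib_left mult_ac)
    also have "\<dots> = (\<Sum>l<q. gram p y j l * gram p y j l)"
      by (subst sum.swap) (simp add: gram_def[of p y] dot_def sum_distrib_left)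
    finally show ?thesis by (simp add: Q_def power2_eq_square)
  qed
  then have "Q\<^sup>2 \<le> c * G"
    using dot_Cauchy_Schwarz[of p "y j" "comb q (gram p y) y j"] by (simp add: c_def G_def gram_def)
  moreover have "(c * Q) * c \<le> Q\<^sup>2"
    using mult_right_mono[OF Q, of Q] Q by (simp add: power2_eq_square mult_ac) (metis order_trans zero_le_square)
  ultimately have "(c * Q) * c \<le> G * c" by (simp add: mult.commute)
  moreover have "G \<ge> 0" unfolding G_def by (rule gram_diag_nonneg)
  ultimately have "c * Q \<le> G"
    using c by (cases "c = 0") (auto simp: mult_le_cancel_right)
  then show ?thesis by (simp add: c_def Q_def G_def)
qed

lemma gram_scale: "gram p (\<lambda>j k. a j * y j k) j l = a j * a l * gram p y j l"
  by (simp add: gram_def dot_def sum_distrib_left mult_ac)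

text \<open>The left side is the sum of C(j,j) C(l,l) C(j,l)^2. By AM-GM and symmetry both diagonal
  factors may carry the index j; one of them is at most the Frobenius norm, and the other is
  absorbed by \<open>diag_times_row_le\<close>, leaving the trace of C^3.\<close>

lemma sandwich_diag_le:
  "(\<Sum>i<p. \<Sum>k<p. (\<Sum>j<q. gram p y j j * y j i * y j k)\<^sup>2)
    \<le> sqrt (fro q (gram p y)) * tr3 q (gram p y) (gram p y) (gram p y)"
proof -
  let ?c = "gram p y"
  have "(\<Sum>i<p. \<Sum>k<p. (\<Sum>j<q. ?c j j * y j i * y j k)\<^sup>2) = (\<Sum>i<p. \<Sum>k<p. (\<Sum>j<q. y j i * (\<lambda>j k. ?c j j * y j k) j k)\<^sup>2)"
    by (simp add: mult_ac)
  also have "\<dots> = (\<Sum>j<q. \<Sum>l<q. ?c j l * gram p (\<lambda>j k. ?c j j * y j k) j l)"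
    by (rule sandwich_fro_eq)
  also have "\<dots> = (\<Sum>j<q. \<Sum>l<q. (?c j j * ?c l l) * (?c j l)\<^sup>2)"
    unfolding gram_scale by (simp add: power2_eq_square mult_ac)
  also have "\<dots> \<le> (\<Sum>j<q. \<Sum>l<q. ((?c j j)\<^sup>2 + (?c l l)\<^sup>2) / 2 * (?c j l)\<^sup>2)"
    using sum_squares_bound[of "?c _ _" "?c _ _"] by (intro sum_mono mult_right_mono) (auto simp: field_simps)
  also have "\<dots> = (\<Sum>j<q. \<Sum>l<q. (?c j j)\<^sup>2 * (?c j l)\<^sup>2)"
  proof -
    have "(\<Sum>j<q. \<Sum>l<q. (?c l l)\<^sup>2 * (?c j l)\<^sup>2) = (\<Sum>j<q. \<Sum>l<q. (?c j j)\<^sup>2 * (?c j l)\<^sup>2)"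
      by (subst sum.swap) (simp add: gram_sym)
    then show ?thesis
      by (simp add: distrib_right add_divide_distrib sum.distrib flip: sum_divide_distrib)
  qed
  also have "\<dots> \<le> (\<Sum>j<q. sqrt (fro q ?c) * gram p (comb q ?c y) j j)"
  proof (rule sum_mono)
    fix j assume j: "j \<in> {..<q}"
    have "(?c j j)\<^sup>2 \<le> fro q ?c"
      using sum_diag_squares_le_fro[of ?c q] member_le_sum[OF j, of "\<lambda>j. (?c j j)\<^sup>2"] by simp
    then have "?c j j \<le> sqrt (fro q ?c)" by (rule real_le_rsqrt)
    then have "?c j j * (?c j j * (\<Sum>l<q. (?c j l)\<^sup>2)) \<le> sqrt (fro q ?c) * gram p (comb q ?c y) j j"
      using j by (intro mult_mono diag_times_row_le) (auto simp: gram_diag_nonneg fro_nonneg sum_nonneg)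
    then show "(\<Sum>l<q. (?c j j)\<^sup>2 * (?c j l)\<^sup>2) \<le> sqrt (fro q ?c) * gram p (comb q ?c y) j j"
      by (simp add: sum_distrib_left power2_eq_square mult_ac)
  qed
  also have "\<dots> = sqrt (fro q ?c) * tr q (gram p (comb q ?c y))"
    by (simp add: tr_def sum_distrib_left)
  finally show ?thesis by (simp add: tr_gram_comb_gram)
qed

text \<open>Bounding this crudely by the squared Frobenius norm of C times that of B would just fail to make the
  conditional variance of the linear term negligible; the factor with the third moment trace gains a
  power of n.\<close>

lemma sandwich_offdiag_le:
  fixes c :: real and y :: "nat \<Rightarrow> nat \<Rightarrow> real" and p :: nat
  defines "B \<equiv> \<lambda>j l. if j = l then - c else gram p y j l"
  shows "(\<Sum>i<p. \<Sum>k<p. (\<Sum>j<q. \<Sum>l<q. B j l * y j i * y l k)\<^sup>2)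
    \<le> 3 * (2 * sqrt (fro q (gram p y)) * tr3 q (gram p y) (gram p y) (gram p y) + c\<^sup>2 * fro q (gram p y))"
proof -
  let ?c = "gram p y"
  \<comment> \<open>\<open>B\<close> is C minus its diagonal part minus c times the identity;
    \<open>A1\<close>, \<open>A2\<close> and \<open>A3\<close> are the corresponding three parts of
    Y B Y'.\<close>
  define A1 where "A1 i k = (\<Sum>j<q. y j i * comb q ?c y j k)" for i k
  define A2 where "A2 i k = (\<Sum>j<q. ?c j j * y j i * y j k)" for i k
  define A3 where "A3 i k = (\<Sum>j<q. y j i * y j k)" for i k
  have "(\<Sum>j<q. \<Sum>l<q. B j l * y j i * y l k) = A1 i k - A2 i k - c * A3 i k" for i k
  proof -
    have "(\<Sum>l<q. B j l * y j i * y l k) = (\<Sum>l<q. ?c j l * y j i * y l k) - ?c j j * y j i * y j k - c * (y j i * y j k)"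
      if "j < q" for j
    proof -
      have "(\<Sum>l<q. B j l * y j i * y l k) = (\<Sum>l<q. ?c j l * y j i * y l k - of_bool (j = l) * ((?c j j + c) * y j i * y j k))"
        by (intro sum.cong) (auto simp: B_def algebra_simps)
      also have "\<dots> = (\<Sum>l<q. ?c j l * y j i * y l k) - (?c j j + c) * y j i * y j k"
        using sum_of_bool_eq[OF that, of "\<lambda>_. (?c j j + c) * y j i * y j k"] by (simp add: sum_subtractf mult.commute)
      finally show ?thesis by (simp add: algebra_simps)
    qed
    then show ?thesis
      by (simp add: A1_def A2_def A3_def comb_def sum_subtractf sum_distrib_left mult_ac)
  qed
  moreover have "(a - b - d)\<^sup>2 \<le> 3 * (a\<^sup>2 + b\<^sup>2 + d\<^sup>2)" for a b d :: real
    using zero_le_power2[of "a + b"] zero_le_power2[of "a + d"] zero_le_power2[of "b - d"]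
    by (simp add: power2_eq_square algebra_simps)
  ultimately have "(\<Sum>i<p. \<Sum>k<p. (\<Sum>j<q. \<Sum>l<q. B j l * y j i * y l k)\<^sup>2) \<le> (\<Sum>i<p. \<Sum>k<p. 3 * ((A1 i k)\<^sup>2 + (A2 i k)\<^sup>2 + (c * A3 i k)\<^sup>2))"
    by (simp add: sum_mono)
  also have "\<dots> = 3 * ((\<Sum>i<p. \<Sum>k<p. (A1 i k)\<^sup>2) + (\<Sum>i<p. \<Sum>k<p. (A2 i k)\<^sup>2) + c\<^sup>2 * (\<Sum>i<p. \<Sum>k<p. (A3 i k)\<^sup>2))"
    by (simp add: sum.distrib power_mult_distrib flip: sum_distrib_left)
  also have "\<dots> \<le> 3 * (sqrt (fro q ?c) * tr3 q ?c ?c ?c + sqrt (fro q ?c) * tr3 q ?c ?c ?c + c\<^sup>2 * fro q ?c)"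
  proof (intro mult_left_mono add_mono)
    show "(\<Sum>i<p. \<Sum>k<p. (A1 i k)\<^sup>2) \<le> sqrt (fro q ?c) * tr3 q ?c ?c ?c"
      unfolding A1_def using sandwich_fro_le[where y = y and z = "comb q ?c y" and p = p and q = q] by (simp add: tr_gram_comb_gram)
    show "(\<Sum>i<p. \<Sum>k<p. (A2 i k)\<^sup>2) \<le> sqrt (fro q ?c) * tr3 q ?c ?c ?c"
      unfolding A2_def by (rule sandwich_diag_le)
    show "(\<Sum>i<p. \<Sum>k<p. (A3 i k)\<^sup>2) \<le> fro q ?c"
      unfolding A3_def sandwich_fro_eq by (simp add: fro_def power2_eq_square)
  qed auto
  finally show ?thesis by (simp add: algebra_simps)
qed

lemma tr3_rotate: "tr3 q A B C = tr3 q B C A"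
proof -
  have "tr3 q A B C = (\<Sum>l<q. \<Sum>k<q. \<Sum>j<q. A j l * B l k * C k j)"
    unfolding tr3_def by (rule sum_rotate)
  then show ?thesis by (simp add: tr3_def mult_ac)
qed

text \<open>The third moment trace is convex along positive semidefinite matrices: with D = V - C the
  remainder of the first order expansion is the trace of D (2 C + V) D.\<close>

lemma tr3_convex:
  fixes C V :: "nat \<Rightarrow> nat \<Rightarrow> real"
  assumes C: "C = gram p y" and V: "V = gram r z"
  shows "tr3 q C C C + 3 * (\<Sum>j<q. \<Sum>l<q. (\<Sum>k<q. C l k * C k j) * (V j l - C j l)) \<le> tr3 q V V V"
proof -
  define D where "D j l = V j l - C j l" for j l
  have lin: "tr3 q (\<lambda>j l. A j l + A' j l) B E = tr3 q A B E + tr3 q A' B E" for A A' B E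
    by (simp add: tr3_def distrib_right sum.distrib)
  have V': "V = (\<lambda>j l. C j l + D j l)" by (simp add: D_def fun_eq_iff)
  have lin2: "tr3 q A (\<lambda>j l. B j l + B' j l) E = tr3 q A B E + tr3 q A B' E" for A B B' E
    using lin tr3_rotate by metis
  have lin3: "tr3 q A B (\<lambda>j l. E j l + E' j l) = tr3 q A B E + tr3 q A B E'" for A B E E'
    using lin tr3_rotate by metis
  \<comment> \<open>Cyclicity groups the eight terms. One of the three terms D C D is joined with D
    D D into D V D, because V is positive semidefinite while D need not be.\<close>
  have "tr3 q V V V = tr3 q C C C + 3 * tr3 q D C C + 2 * tr3 q D C D + tr3 q D V D"
    unfolding V' lin lin2 lin3
    using tr3_rotate[of q C C D] tr3_rotate[of q C D C] tr3_rotate[of q C D D] tr3_rotate[of q D D C] by simp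
  moreover have "tr3 q D (gram p y) D \<ge> 0" for p y
  proof -
    have "D k j = D j k" for j k by (simp add: D_def C V gram_sym)
    then have "tr3 q D (gram p y) D = (\<Sum>j<q. \<Sum>l<q. \<Sum>k<q. D j l * D j k * gram p y l k)"
      by (simp add: tr3_def mult_ac)
    also have "\<dots> \<ge> 0" by (intro sum_nonneg gram_positive)
    finally show ?thesis .
  qed
  moreover have "tr3 q D C C = (\<Sum>j<q. \<Sum>l<q. (\<Sum>k<q. C l k * C k j) * (V j l - C j l))"
    by (simp add: tr3_def D_def sum_distrib_left mult_ac)
  ultimately show ?thesis by (auto simp: C V)
qed

section \<open>The test statistic under a Wishart perturbation\<close>

definition gcols :: "nat \<Rightarrow> nat \<Rightarrow> (nat \<Rightarrow> nat \<Rightarrow> real) measure" where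
  "gcols p n = PiM {..<n} (\<lambda>_. gvec p)"

text \<open>This is Y' W Y with W the average of the matrices g_m g_m', multiplied out so that W
  itself never appears.\<close>

definition wish :: "nat \<Rightarrow> nat \<Rightarrow> (nat \<Rightarrow> nat \<Rightarrow> real) \<Rightarrow> (nat \<Rightarrow> nat \<Rightarrow> real) \<Rightarrow> nat \<Rightarrow> nat \<Rightarrow> real" where
  "wish p n y g j l = (\<Sum>m<n. dot p (y j) (g m) * dot p (y l) (g m)) / n"

definition off :: "nat \<Rightarrow> (nat \<Rightarrow> nat \<Rightarrow> real) \<Rightarrow> real" where
  "off q f = (\<Sum>j<q. \<Sum>l\<in>{..<q}-{j}. f j l)"

definition stat :: "nat \<Rightarrow> (nat \<Rightarrow> nat \<Rightarrow> real) \<Rightarrow> real" where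
  "stat q C = off q (\<lambda>j l. (C j l)\<^sup>2) - 2 * (real q - 1) * tr q C"

lemma prob_space_gcols: "prob_space (gcols p n)"
  unfolding gcols_def by (intro prob_space_PiM prob_space_gvec)

interpretation gcols: prob_space "gcols p n" for p n
  by (rule prob_space_gcols)

lemma off_add: "off q (\<lambda>j l. f j l + g j l) = off q f + off q g"
  by (simp add: off_def sum.distrib)

lemma off_diff: "off q (\<lambda>j l. f j l - g j l) = off q f - off q g"
  by (simp add: off_def sum_subtractf)

lemma off_cmult: "off q (\<lambda>j l. c * f j l) = c * off q f"
  by (simp add: off_def sum_distrib_left)

lemma off_divide: "off q (\<lambda>j l. f j l / c) = off q f / c"
  by (simp add: off_def sum_divide_distrib)

lemma off_mono: "(\<And>j l. f j l \<le> g j l) \<Longrightarrow> off q f \<le> off q g"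
  unfolding off_def by (intro sum_mono)

lemma off_sum: "off q (\<lambda>j l. \<Sum>m\<in>A. f m j l) = (\<Sum>m\<in>A. off q (f m))"
  unfolding off_def by (subst sum.swap, rule sum.cong[OF refl], subst sum.swap, simp)

lemma off_eq: "off q f = (\<Sum>j<q. \<Sum>l<q. f j l) - (\<Sum>j<q. f j j)"
  by (simp add: off_def sum_diff1 sum_subtractf)

lemma off_eq_sum: "off q (\<lambda>j l. f j l * g j l) = (\<Sum>j<q. \<Sum>l<q. (if j = l then 0 else f j l) * g j l)"
  unfolding off_def by (intro sum.cong[OF refl] sum.mono_neutral_cong_left) auto

lemma off_squares_le_fro: "off q (\<lambda>j l. (C j l)\<^sup>2) \<le> fro q C"
  unfolding off_eq fro_def by (simp add: sum_nonneg)

lemma gcols_component [intro]: "m < n \<Longrightarrow> all_moments (gvec p) f \<Longrightarrow> all_moments (gcols p n) (\<lambda>g. f (g m))"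
  unfolding gcols_def by (intro PiM_all_moments_component[OF prob_space_gvec]) auto

lemma gcols_integral_component:
  "m < n \<Longrightarrow> all_moments (gvec p) f \<Longrightarrow> (\<integral>g. f (g m) \<partial>gcols p n) = (\<integral>g. f g \<partial>gvec p)"
  unfolding gcols_def
  by (intro PiM_integral_component[OF prob_space_gvec]) (auto simp: all_moments_def)

lemma gcols_dot: "m < n \<Longrightarrow> all_moments (gcols p n) (\<lambda>g. dot p u (g m))"
  by (rule gcols_component) (auto intro: gvec_dot_moments)

lemma wish_moments: "all_moments (gcols p n) (\<lambda>g. wish p n y g j l)"
  unfolding wish_def by (intro gcols.moment_intros gcols_dot) auto

text \<open>The perturbed matrix is again a Gram matrix, now of n-dimensional vectors, so facts on
  positive semidefinite matrices apply to it.\<close>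

lemma wish_gram: "wish p n y g = gram n (\<lambda>j m. dot p (y j) (g m) / sqrt n)"
  by (simp add: fun_eq_iff wish_def gram_def dot_def[of n] sum_divide_distrib)

lemma wish_mean: "n > 0 \<Longrightarrow> (\<integral>g. wish p n y g j l \<partial>gcols p n) = gram p y j l"
proof -
  assume n: "n > 0"
  have am: "all_moments (gvec p) (\<lambda>g. dot p (y j) g * dot p (y l) g)"
    by (intro gvec.all_moments_mult gvec_dot_moments)
  have "(\<integral>g. wish p n y g j l \<partial>gcols p n) = (\<Sum>m<n. \<integral>g. dot p (y j) (g m) * dot p (y l) (g m) \<partial>gcols p n) / n"
  proof -
    have "integrable (gcols p n) (\<lambda>g. dot p (y j) (g m) * dot p (y l) (g m))" if "m < n" for m
      using gcols_component[OF that am] by (rule all_moments_integrable)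
    then show ?thesis unfolding wish_def by simp
  qed
  also have "(\<Sum>m<n. \<integral>g. dot p (y j) (g m) * dot p (y l) (g m) \<partial>gcols p n) = (\<Sum>m<n. gram p y j l)"
    using gcols_integral_component[OF _ am] by (intro sum.cong) (auto simp: gvec_dot_dot gram_def)
  finally show ?thesis using n by simp
qed

text \<open>The deviations of a Wishart matrix V from C are averages of the centred matrices
  \<zeta> m. The linear term is centred, the off-diagonal part of the quadratic term is a degenerate
  U-statistic, and its diagonal part supplies the shift \<open>(tr V)\<^sup>2 / n\<close> by the Cauchy--Schwarz inequality
  for the sum over m, which makes a separate law of large numbers unnecessary.\<close>

lemma stat_diff_ge:
  fixes a :: "nat \<Rightarrow> nat \<Rightarrow> real" and C V :: "nat \<Rightarrow> nat \<Rightarrow> real"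
  assumes n: "n > 0" and V: "V = (\<lambda>j l. (\<Sum>m<n. a m j * a m l) / n)"
  defines "\<zeta> \<equiv> \<lambda>m j l. a m j * a m l - C j l"
  shows "(tr q V)\<^sup>2 / n - (fro q V + fro q C) / n
      + 2 * (\<Sum>j<q. \<Sum>l<q. (if j = l then - (real q - 1) else C j l) * (V j l - C j l))
      + (\<Sum>m<n. \<Sum>m'\<in>{..<n}-{m}. off q (\<lambda>j l. \<zeta> m j l * \<zeta> m' j l)) / n\<^sup>2
      - (\<Sum>m<n. \<Sum>j<q. a m j ^ 4) / n\<^sup>2 \<le> stat q V - stat q C"
proof -
  define U where "U = (\<Sum>m<n. \<Sum>m'\<in>{..<n}-{m}. off q (\<lambda>j l. \<zeta> m j l * \<zeta> m' j l))"
  define R where "R = (\<Sum>m<n. \<Sum>j<q. a m j ^ 4)"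
  define L where "L = (\<Sum>j<q. \<Sum>l<q. (if j = l then - (real q - 1) else C j l) * (V j l - C j l))"
  define T where "T m = (\<Sum>j<q. (a m j)\<^sup>2)" for m
  have n': "real n > 0" using n by simp
  have D: "V j l - C j l = (\<Sum>m<n. \<zeta> m j l) / n" for j l
    using n' by (simp add: V \<zeta>_def sum_subtractf field_simps)
  \<comment> \<open>The trace term of \<open>stat\<close> is linear, so it can be stored on the
    otherwise free diagonal of the coefficient matrix of the first order term.\<close>
  have L: "L = off q (\<lambda>j l. C j l * (V j l - C j l)) - (real q - 1) * (tr q V - tr q C)"
  proof -
    have "L = (\<Sum>j<q. \<Sum>l<q. (if j = l then 0 else C j l) * (V j l - C j l)) - (\<Sum>j<q. \<Sum>l<q. (real q - 1) * (V j l - C j l) * of_bool (j = l))"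
    proof -
      have "(if j = l then - (real q - 1) else C j l) * (V j l - C j l) =
        (if j = l then 0 else C j l) * (V j l - C j l) - (real q - 1) * (V j l - C j l) * of_bool (j = l)" for j l
        by (simp add: left_diff_distrib)
      then show ?thesis by (simp only: L_def sum_subtractf)
    qed
    moreover have "(\<Sum>j<q. \<Sum>l<q. (real q - 1) * (V j l - C j l) * of_bool (j = l)) = (real q - 1) * (tr q V - tr q C)"
      by (simp add: sum_of_bool_eq tr_def flip: sum_distrib_left sum_subtractf)
    ultimately show ?thesis by (simp only: off_eq_sum)
  qed
  have T: "(tr q V)\<^sup>2 * n \<le> (\<Sum>m<n. (T m)\<^sup>2)"
  proof -
    have tr: "(\<Sum>m<n. T m) = n * tr q V"
      unfolding T_def using n' by (subst sum.swap) (simp add: tr_def V power2_eq_square sum_divide_distrib[symmetric])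
    have "(\<Sum>m<n. 1 * T m)\<^sup>2 \<le> (\<Sum>m<n. 1\<^sup>2) * (\<Sum>m<n. (T m)\<^sup>2)"
      by (rule Cauchy_Schwarz_ineq_sum)
    then have "n * (n * (tr q V)\<^sup>2) \<le> n * (\<Sum>m<n. (T m)\<^sup>2)"
      by (simp add: tr power2_eq_square mult_ac)
    then show ?thesis using n' by (simp add: mult.commute)
  qed
  \<comment> \<open>Expanding the square and dropping the nonnegative term
    \<open>(C j l)\<^sup>2\<close>.\<close>
  have "(\<Sum>m<n. off q (\<lambda>j l. (\<zeta> m j l)\<^sup>2)) \<ge> (\<Sum>m<n. off q (\<lambda>j l. (a m j)\<^sup>2 * (a m l)\<^sup>2 - 2 * (C j l * (a m j * a m l))))"
    unfolding \<zeta>_def by (intro sum_mono off_mono) (simp add: power2_eq_square algebra_simps)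
  also have "(\<Sum>m<n. off q (\<lambda>j l. (a m j)\<^sup>2 * (a m l)\<^sup>2 - 2 * (C j l * (a m j * a m l))))
      = (\<Sum>m<n. off q (\<lambda>j l. (a m j)\<^sup>2 * (a m l)\<^sup>2)) - 2 * n * off q (\<lambda>j l. C j l * V j l)"
  proof -
    have "(\<Sum>m<n. off q (\<lambda>j l. C j l * (a m j * a m l))) = n * off q (\<lambda>j l. C j l * V j l)"
    proof -
      have "(\<Sum>m<n. C j l * (a m j * a m l)) = n * (C j l * V j l)" for j l
        unfolding V using n' by (simp flip: sum_distrib_left)
      then show ?thesis by (simp only: off_sum[symmetric] off_cmult[symmetric])
    qed
    then show ?thesis by (simp add: off_diff off_cmult sum_subtractf flip: sum_distrib_left)
  qed
  also have "(\<Sum>m<n. off q (\<lambda>j l. (a m j)\<^sup>2 * (a m l)\<^sup>2)) = (\<Sum>m<n. (T m)\<^sup>2) - R"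
  proof -
    have "off q (\<lambda>j l. (a m j)\<^sup>2 * (a m l)\<^sup>2) = (T m)\<^sup>2 - (\<Sum>j<q. a m j ^ 4)" for m
      unfolding off_eq T_def by (simp add: power2_eq_square[of "sum _ _"] sum_product flip: power_add)
    then show ?thesis by (simp add: R_def sum_subtractf)
  qed
  finally have zz: "(\<Sum>m<n. (T m)\<^sup>2) - R - 2 * n * off q (\<lambda>j l. C j l * V j l) \<le> (\<Sum>m<n. off q (\<lambda>j l. (\<zeta> m j l)\<^sup>2))" .
  have cv: "2 * off q (\<lambda>j l. C j l * V j l) \<le> fro q C + fro q V"
  proof -
    have "off q (\<lambda>j l. 2 * (C j l * V j l)) \<le> off q (\<lambda>j l. (C j l)\<^sup>2 + (V j l)\<^sup>2)"
      using sum_squares_bound by (intro off_mono) (simp add: mult.assoc)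
    also have "\<dots> \<le> fro q C + fro q V"
      unfolding off_add by (intro add_mono off_squares_le_fro)
    finally show ?thesis by (simp add: off_cmult)
  qed
  have DD: "off q (\<lambda>j l. (V j l - C j l)\<^sup>2) = ((\<Sum>m<n. off q (\<lambda>j l. (\<zeta> m j l)\<^sup>2)) + U) / n\<^sup>2"
  proof -
    have "(\<Sum>m<n. \<zeta> m j l)\<^sup>2 = (\<Sum>m<n. (\<zeta> m j l)\<^sup>2) + (\<Sum>m<n. \<Sum>m'\<in>{..<n}-{m}. \<zeta> m j l * \<zeta> m' j l)" for j l
    proof -
      have "(\<Sum>m<n. \<zeta> m j l)\<^sup>2 = (\<Sum>m<n. \<Sum>m'<n. \<zeta> m j l * \<zeta> m' j l)"
        by (simp add: power2_eq_square sum_product)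
      also have "\<dots> = (\<Sum>m<n. (\<zeta> m j l)\<^sup>2 + (\<Sum>m'\<in>{..<n}-{m}. \<zeta> m j l * \<zeta> m' j l))"
        by (intro sum.cong refl, subst sum.remove) (auto simp: power2_eq_square)
      finally show ?thesis by (simp add: sum.distrib)
    qed
    then show ?thesis
      unfolding D power_divide off_divide by (simp add: off_add off_sum U_def)
  qed
  have "stat q V - stat q C = 2 * L + off q (\<lambda>j l. (V j l - C j l)\<^sup>2)"
  proof -
    have "off q (\<lambda>j l. (V j l)\<^sup>2) = off q (\<lambda>j l. (C j l)\<^sup>2 + 2 * (C j l * (V j l - C j l)) + (V j l - C j l)\<^sup>2)"
      by (intro arg_cong[where f = "off q"] ext) (simp add: power2_eq_square algebra_simps)
    also have "\<dots> = off q (\<lambda>j l. (C j l)\<^sup>2) + 2 * off q (\<lambda>j l. C j l * (V j l - C j l)) + off q (\<lambda>j l. (V j l - C j l)\<^sup>2)"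
      by (simp only: off_add off_cmult)
    finally show ?thesis
      unfolding stat_def L by algebra
  qed
  moreover have "((tr q V)\<^sup>2 * n - R - n * (fro q C + fro q V) + U) / n\<^sup>2 \<le> off q (\<lambda>j l. (V j l - C j l)\<^sup>2)"
  proof -
    have "n * (2 * off q (\<lambda>j l. C j l * V j l)) \<le> n * (fro q C + fro q V)"
      using cv by (intro mult_left_mono) auto
    with zz T have "(tr q V)\<^sup>2 * n - R - n * (fro q C + fro q V) + U \<le> (\<Sum>m<n. off q (\<lambda>j l. (\<zeta> m j l)\<^sup>2)) + U"
      by simp
    then show ?thesis unfolding DD by (rule divide_right_mono) simp
  qed
  moreover have "((tr q V)\<^sup>2 * n - R - n * (fro q C + fro q V) + U) / n\<^sup>2 =
     (tr q V)\<^sup>2 / n - (fro q V + fro q C) / n + U / n\<^sup>2 - R / n\<^sup>2"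
    using n' by (simp add: power2_eq_square add_divide_distrib diff_divide_distrib)
  ultimately show ?thesis unfolding U_def[symmetric] R_def[symmetric] L_def[symmetric] by linarith
qed


section \<open>Second moments of the fluctuation terms, given the columns\<close>

definition pair_kernel :: "nat \<Rightarrow> nat \<Rightarrow> (nat \<Rightarrow> nat \<Rightarrow> real) \<Rightarrow> (nat \<Rightarrow> real) \<Rightarrow> (nat \<Rightarrow> real) \<Rightarrow> real" where
  "pair_kernel p q y g h = off q (\<lambda>j l. (dot p (y j) g * dot p (y l) g - gram p y j l) * (dot p (y j) h * dot p (y l) h - gram p y j l))"

lemma pair_kernel_sum:
  "pair_kernel p q y g h = (\<Sum>j<q. \<Sum>l<q. (if j = l then 0 else dot p (y j) h * dot p (y l) h - gram p y j l)
     * (dot p (y j) g * dot p (y l) g - dot p (y j) (y l)))"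
  unfolding pair_kernel_def by (subst mult.commute, subst off_eq_sum) (simp add: gram_def)

lemma pair_kernel_mean: "(\<integral>g. pair_kernel p q y g h \<partial>gvec p) = 0"
proof -
  have "(\<integral>g. pair_kernel p q y g h \<partial>gvec p) = (\<Sum>j<q. \<Sum>l<q. \<integral>g. (if j = l then 0 else dot p (y j) h * dot p (y l) h - gram p y j l)
     * (dot p (y j) g * dot p (y l) g - dot p (y j) (y l)) \<partial>gvec p)"
    unfolding pair_kernel_sum
    by (intro integral_double_sum all_moments_integrable gvec.moment_intros gvec_dot_moments)
  then show ?thesis by (simp add: gvec_dot_centered)
qed

text \<open>For fixed \<open>h\<close> the kernel is a centred quadratic form in \<open>g\<close>
  with a symmetric coefficient matrix depending on \<open>h\<close>, so its second moment is exact
  up to the sandwich bound.\<close>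

lemma pair_kernel_second_le:
  "(\<integral>g. (pair_kernel p q y g h)\<^sup>2 \<partial>gvec p)
    \<le> 2 * fro q (gram p y) * fro q (\<lambda>j l. dot p (y j) h * dot p (y l) h - gram p y j l)"
proof -
  define N where "N j l = (if j = l then 0 else dot p (y j) h * dot p (y l) h - gram p y j l)" for j l
  have "(\<integral>g. (pair_kernel p q y g h)\<^sup>2 \<partial>gvec p) = 2 * (\<Sum>i<p. \<Sum>k<p. (\<Sum>j<q. \<Sum>l<q. N j l * y j i * y l k)\<^sup>2)"
    unfolding pair_kernel_sum N_def[symmetric]
    by (rule gvec_quadratic_dot) (auto simp: N_def gram_sym mult.commute)
  also have "\<dots> \<le> 2 * (fro q (gram p y) * fro q N)"
    by (intro mult_left_mono sandwich_fro_le_fro) auto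
  also have "\<dots> \<le> 2 * (fro q (gram p y) * fro q (\<lambda>j l. dot p (y j) h * dot p (y l) h - gram p y j l))"
    by (intro mult_left_mono fro_nonneg) (auto simp: fro_def N_def intro!: sum_mono)
  finally show ?thesis by simp
qed

lemma gvec_zeta_fro:
  "(\<integral>h. fro q (\<lambda>j l. dot p (y j) h * dot p (y l) h - gram p y j l) \<partial>gvec p) \<le> 2 * (tr q (gram p y))\<^sup>2"
proof -
  have "(\<integral>h. fro q (\<lambda>j l. dot p (y j) h * dot p (y l) h - gram p y j l) \<partial>gvec p)
    = (\<Sum>j<q. \<Sum>l<q. \<integral>h. (dot p (y j) h * dot p (y l) h - gram p y j l)\<^sup>2 \<partial>gvec p)"
    unfolding fro_def by (intro integral_double_sum all_moments_integrable gvec.moment_intros gvec_dot_moments)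
  also have "\<dots> = (\<Sum>j<q. \<Sum>l<q. gram p y j j * gram p y l l + (gram p y j l)\<^sup>2)"
    by (simp add: gram_def gvec_dot_covariance)
  also have "\<dots> = (tr q (gram p y))\<^sup>2 + fro q (gram p y)"
    by (simp add: sum.distrib tr_def fro_def power2_eq_square[of "sum _ _"] sum_product)
  finally show ?thesis using fro_gram_le[of q p y] by simp
qed

text \<open>The second moment of one kernel is found by conditioning on its second argument. For
  typical columns the squared Frobenius norm is of order n^(3/2) and the trace of order n, so after
  division by n^4 the bound is of order n^(3/2), negligible against the squared shift n^2.\<close>

lemma ustat_second_moment:
  "(\<integral>g. (\<Sum>m<n. \<Sum>m'\<in>{..<n}-{m}. pair_kernel p q y (g m) (g m'))\<^sup>2 \<partial>gcols p n)
    \<le> 8 * (real n)\<^sup>2 * fro q (gram p y) * (tr q (gram p y))\<^sup>2"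
proof -
  let ?F = "fro q (gram p y)"
  let ?z = "\<lambda>h. fro q (\<lambda>j l. dot p (y j) h * dot p (y l) h - gram p y j l)"
  have zm: "all_moments (gvec p) ?z"
    unfolding fro_def by (intro gvec.moment_intros gvec_dot_moments)
  have km: "all_moments (gcols p n) (\<lambda>g. pair_kernel p q y (g m) (g m'))" if "m < n" "m' < n" for m m'
    unfolding pair_kernel_def off_def using that by (intro gcols.moment_intros gcols_dot)
  have sec: "(\<integral>g. (pair_kernel p q y (g m) (g m'))\<^sup>2 \<partial>gcols p n) \<le> 4 * ?F * (tr q (gram p y))\<^sup>2"
    if "m < n" "m' < n" "m \<noteq> m'" for m m'
  proof -
    have "(\<integral>g. (pair_kernel p q y (g m) (g m'))\<^sup>2 \<partial>gcols p n) =
      (\<integral>g. (\<integral>h. (pair_kernel p q y h (g m'))\<^sup>2 \<partial>gvec p) \<partial>gcols p n)"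
      using PiM_integral_resample[OF prob_space_gvec finite_lessThan, of m n p "\<lambda>g. (pair_kernel p q y (g m) (g m'))\<^sup>2"]
        that all_moments_integrable[OF gcols.all_moments_power[OF km[OF that(1,2)]]]
      by (simp add: gcols_def)
    also have "\<dots> \<le> (\<integral>g. 2 * ?F * ?z (g m') \<partial>gcols p n)"
    proof (rule integral_mono')
      show "integrable (gcols p n) (\<lambda>g. 2 * ?F * ?z (g m'))"
        using gcols_component[OF that(2) zm] by (intro all_moments_integrable gcols.moment_intros)
      fix g
      show "(\<integral>h. (pair_kernel p q y h (g m'))\<^sup>2 \<partial>gvec p) \<le> 2 * ?F * ?z (g m')"
        by (rule pair_kernel_second_le)
      show "0 \<le> 2 * ?F * ?z (g m')" by (simp add: fro_nonneg)
    qed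
    also have "\<dots> = 2 * ?F * (\<integral>h. ?z h \<partial>gvec p)"
      using gcols_integral_component[OF that(2) zm] by simp
    also have "\<dots> \<le> 2 * ?F * (2 * (tr q (gram p y))\<^sup>2)"
      by (intro mult_left_mono gvec_zeta_fro) (simp add: fro_nonneg)
    finally show ?thesis by simp
  qed
  have "(\<integral>g. (\<Sum>m\<in>{..<n}. \<Sum>m'\<in>{..<n}-{m}. pair_kernel p q y (g m) (g m'))\<^sup>2 \<partial>PiM {..<n} (\<lambda>_. gvec p))
     \<le> 2 * (card {..<n})\<^sup>2 * (4 * ?F * (tr q (gram p y))\<^sup>2)"
  proof (rule degenerate_ustat_second_moment[OF prob_space_gvec finite_lessThan])
    show "pair_kernel p q y a b = pair_kernel p q y b a" for a b
      by (simp add: pair_kernel_def mult.commute)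
    show "(\<integral>a. pair_kernel p q y a b \<partial>gvec p) = 0" for b by (rule pair_kernel_mean)
  qed (use km sec in \<open>auto simp: gcols_def[symmetric] fro_nonneg\<close>)
  then show ?thesis by (simp add: gcols_def mult_ac)
qed

lemma linear_second_moment:
  assumes n: "n > 0" and sym: "\<And>j l. B j l = B l j"
  shows "(\<integral>g. (\<Sum>j<q. \<Sum>l<q. B j l * (wish p n y g j l - gram p y j l))\<^sup>2 \<partial>gcols p n)
    = 2 / n * (\<Sum>i<p. \<Sum>k<p. (\<Sum>j<q. \<Sum>l<q. B j l * y j i * y l k)\<^sup>2)"
proof -
  define h where "h g = (\<Sum>j<q. \<Sum>l<q. B j l * (dot p (y j) g * dot p (y l) g - dot p (y j) (y l)))" for g
  have hm: "all_moments (gvec p) h"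
    unfolding h_def by (intro gvec.moment_intros gvec_dot_moments)
  have h0: "(\<integral>g. h g \<partial>gvec p) = 0"
  proof -
    have "(\<integral>g. h g \<partial>gvec p) = (\<Sum>j<q. \<Sum>l<q. \<integral>g. B j l * (dot p (y j) g * dot p (y l) g - dot p (y j) (y l)) \<partial>gvec p)"
      unfolding h_def by (intro integral_double_sum all_moments_integrable gvec.moment_intros gvec_dot_moments)
    then show ?thesis by (simp add: gvec_dot_centered)
  qed
  have "(\<Sum>j<q. \<Sum>l<q. B j l * (wish p n y g j l - gram p y j l)) = (\<Sum>m<n. h (g m)) / n" for g
  proof -
    have "wish p n y g j l - gram p y j l = (\<Sum>m<n. dot p (y j) (g m) * dot p (y l) (g m) - dot p (y j) (y l)) / n" for j l
      using n by (simp add: wish_def gram_def sum_subtractf field_simps)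
    then have "(\<Sum>j<q. \<Sum>l<q. B j l * (wish p n y g j l - gram p y j l)) =
      (\<Sum>j<q. \<Sum>l<q. \<Sum>m<n. B j l * (dot p (y j) (g m) * dot p (y l) (g m) - dot p (y j) (y l))) / n"
      by (simp add: sum_distrib_left sum_divide_distrib)
    also have "(\<Sum>j<q. \<Sum>l<q. \<Sum>m<n. B j l * (dot p (y j) (g m) * dot p (y l) (g m) - dot p (y j) (y l))) = (\<Sum>m<n. h (g m))"
      unfolding h_def by (rule sum_rotate[symmetric])
    finally show ?thesis .
  qed
  then have "(\<integral>g. (\<Sum>j<q. \<Sum>l<q. B j l * (wish p n y g j l - gram p y j l))\<^sup>2 \<partial>gcols p n)
    = (\<integral>g. (\<Sum>m<n. h (g m))\<^sup>2 \<partial>gcols p n) / n\<^sup>2"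
    by (simp add: power_divide)
  also have "(\<integral>g. (\<Sum>m<n. h (g m))\<^sup>2 \<partial>gcols p n) = n * (\<integral>g. (h g)\<^sup>2 \<partial>gvec p)"
    using sum_iid_second_moment[OF prob_space_gvec finite_lessThan hm h0] by (simp add: gcols_def)
  also have "(\<integral>g. (h g)\<^sup>2 \<partial>gvec p) = 2 * (\<Sum>i<p. \<Sum>k<p. (\<Sum>j<q. \<Sum>l<q. B j l * y j i * y l k)\<^sup>2)"
    unfolding h_def by (rule gvec_quadratic_dot[OF sym])
  finally show ?thesis using n by (simp add: power2_eq_square)
qed

lemma fourth_sum_mean:
  "(\<integral>g. (\<Sum>m<n. \<Sum>j<q. dot p (y j) (g m) ^ 4) \<partial>gcols p n) \<le> 3 * real n * fro q (gram p y)"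
proof -
  have am: "all_moments (gvec p) (\<lambda>g. dot p (y j) g ^ 4)" for j
    by (intro gvec.all_moments_power gvec_dot_moments)
  have "(\<integral>g. (\<Sum>m<n. \<Sum>j<q. dot p (y j) (g m) ^ 4) \<partial>gcols p n) = (\<Sum>m<n. \<Sum>j<q. \<integral>g. dot p (y j) (g m) ^ 4 \<partial>gcols p n)"
    by (intro integral_double_sum all_moments_integrable gcols_component am) auto
  also have "\<dots> = (\<Sum>m<n. \<Sum>j<q. 3 * (gram p y j j)\<^sup>2)"
    using gcols_integral_component[OF _ am] by (simp add: gvec_dot_fourth gram_def)
  also have "\<dots> = 3 * real n * (\<Sum>j<q. (gram p y j j)\<^sup>2)"
    by (simp add: sum_distrib_left mult_ac)
  also have "\<dots> \<le> 3 * real n * fro q (gram p y)"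
    by (intro mult_left_mono sum_diag_squares_le_fro) auto
  finally show ?thesis .
qed

lemma (in prob_space) Markov_all_moments:
  assumes "all_moments M f" "\<And>x. f x \<ge> 0" "c > 0" "expectation f \<le> e"
  shows "prob {x \<in> space M. f x \<ge> c} \<le> e / c"
proof -
  have "prob {x \<in> space M. f x \<ge> c} \<le> expectation f / c"
    using assms by (intro integral_Markov_inequality_measure[where A = "{}"] all_moments_integrable) auto
  also have "\<dots> \<le> e / c" using assms by (intro divide_right_mono) auto
  finally show ?thesis .
qed

text \<open>Chebyshev for the linear term and the U-statistic and Markov for the fourth powers, each
  at level \<eta>. The 24 collects 4 from squaring 2 L, 2 from the quadratic form and 3 from
  splitting the coefficient matrix. For \<eta> of order n and typical C the three errors are of
  orders n^(-1/4), n^(-1/2) and n^(-1/2). The functionals of the perturbed matrix stay in the event,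
  to be controlled later under its exact Gaussian law.\<close>

lemma conditional_shift:
  fixes y :: "nat \<Rightarrow> nat \<Rightarrow> real" and p q n :: nat and \<eta> :: real
  assumes n: "n > 0" and \<eta>: "\<eta> > 0"
  defines "C \<equiv> gram p y"
  shows "measure (gcols p n) {g \<in> space (gcols p n). stat q (wish p n y g) - stat q C
      < (tr q (wish p n y g))\<^sup>2 / n - (fro q (wish p n y g) + fro q C) / n - 3 * \<eta>}
    \<le> 24 * (2 * sqrt (fro q C) * tr3 q C C C + (real q - 1)\<^sup>2 * fro q C) / (n * \<eta>\<^sup>2)
      + 8 * fro q C * (tr q C)\<^sup>2 / ((real n)\<^sup>2 * \<eta>\<^sup>2) + 3 * fro q C / (n * \<eta>)"
proof -
  define B where "B j l = (if j = l then - (real q - 1) else C j l)" for j l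
  define L where "L g = (\<Sum>j<q. \<Sum>l<q. B j l * (wish p n y g j l - C j l))" for g
  define U where "U g = (\<Sum>m<n. \<Sum>m'\<in>{..<n}-{m}. pair_kernel p q y (g m) (g m'))" for g
  define R where "R g = (\<Sum>m<n. \<Sum>j<q. dot p (y j) (g m) ^ 4)" for g
  have n': "real n > 0" using n by simp
  have mL: "all_moments (gcols p n) L" unfolding L_def
    by (intro gcols.moment_intros wish_moments)
  have mU: "all_moments (gcols p n) U" unfolding U_def pair_kernel_def off_def
    by (intro gcols.moment_intros gcols_dot) auto
  have mR: "all_moments (gcols p n) R" unfolding R_def
    by (intro gcols.moment_intros gcols_dot) auto
  have R0: "0 \<le> R g" for g by (simp add: R_def sum_nonneg)
  have key: "(tr q (wish p n y g))\<^sup>2 / n - (fro q (wish p n y g) + fro q C) / n + 2 * L g + U g / n\<^sup>2 - R g / n\<^sup>2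
    \<le> stat q (wish p n y g) - stat q C" for g
    using stat_diff_ge[OF n, of "wish p n y g" "\<lambda>m j. dot p (y j) (g m)" q C]
    unfolding L_def B_def U_def R_def pair_kernel_def C_def wish_def by simp
  define W where "W = 2 * sqrt (fro q C) * tr3 q C C C + (real q - 1)\<^sup>2 * fro q C"
  have pL: "gcols.prob p n {g \<in> space (gcols p n). (2 * L g)\<^sup>2 \<ge> \<eta>\<^sup>2} \<le>
      (24 * W / n) / \<eta>\<^sup>2"
  proof (rule gcols.Markov_all_moments)
    have "gcols.expectation p n (\<lambda>g. (L g)\<^sup>2) = 2 / n * (\<Sum>i<p. \<Sum>k<p. (\<Sum>j<q. \<Sum>l<q. B j l * y j i * y l k)\<^sup>2)"
      unfolding L_def C_def by (rule linear_second_moment[OF n]) (auto simp: B_def C_def gram_sym)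
    also have "\<dots> \<le> 2 / n * (3 * W)"
      unfolding C_def B_def W_def by (intro mult_left_mono sandwich_offdiag_le) auto
    finally show "gcols.expectation p n (\<lambda>g. (2 * L g)\<^sup>2) \<le> 24 * W / n"
      by (simp add: power_mult_distrib)
  qed (use \<eta> in \<open>auto intro!: gcols.all_moments_power gcols.all_moments_mult gcols.all_moments_const mL\<close>)
  have pU: "gcols.prob p n {g \<in> space (gcols p n). (U g / n\<^sup>2)\<^sup>2 \<ge> \<eta>\<^sup>2} \<le>
      (8 * fro q C * (tr q C)\<^sup>2 / (real n)\<^sup>2) / \<eta>\<^sup>2"
  proof (rule gcols.Markov_all_moments)
    have "gcols.expectation p n (\<lambda>g. (U g)\<^sup>2) \<le> 8 * (real n)\<^sup>2 * fro q C * (tr q C)\<^sup>2"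
      unfolding U_def C_def by (rule ustat_second_moment)
    then have "gcols.expectation p n (\<lambda>g. (U g)\<^sup>2) / (real (n\<^sup>2))\<^sup>2 \<le> 8 * (real n)\<^sup>2 * fro q C * (tr q C)\<^sup>2 / (real (n\<^sup>2))\<^sup>2"
      by (rule divide_right_mono) simp
    then show "gcols.expectation p n (\<lambda>g. (U g / n\<^sup>2)\<^sup>2) \<le> 8 * fro q C * (tr q C)\<^sup>2 / (real n)\<^sup>2"
      using n' by (simp add: power_divide power2_eq_square)
  qed (use \<eta> in \<open>auto intro!: gcols.all_moments_power gcols.all_moments_divide mU\<close>)
  have pR: "gcols.prob p n {g \<in> space (gcols p n). R g / n\<^sup>2 \<ge> \<eta>} \<le> (3 * fro q C / n) / \<eta>"
  proof (rule gcols.Markov_all_moments)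
    have "gcols.expectation p n R \<le> 3 * real n * fro q C"
      unfolding R_def C_def by (rule fourth_sum_mean)
    then have "gcols.expectation p n R / real (n\<^sup>2) \<le> 3 * real n * fro q C / real (n\<^sup>2)"
      by (rule divide_right_mono) simp
    then show "gcols.expectation p n (\<lambda>g. R g / n\<^sup>2) \<le> 3 * fro q C / n"
      using n' by (simp add: power2_eq_square)
  qed (use \<eta> in \<open>auto intro!: gcols.all_moments_divide mR simp: R0\<close>)
  have [measurable]: "L \<in> borel_measurable (gcols p n)" "U \<in> borel_measurable (gcols p n)" "R \<in> borel_measurable (gcols p n)"
    using mL mU mR by (auto simp: all_moments_def)
  let ?bad = "{g \<in> space (gcols p n). stat q (wish p n y g) - stat q C
      < (tr q (wish p n y g))\<^sup>2 / n - (fro q (wish p n y g) + fro q C) / n - 3 * \<eta>}"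
  let ?A1 = "{g \<in> space (gcols p n). (2 * L g)\<^sup>2 \<ge> \<eta>\<^sup>2}"
  let ?A2 = "{g \<in> space (gcols p n). (U g / n\<^sup>2)\<^sup>2 \<ge> \<eta>\<^sup>2}"
  let ?A3 = "{g \<in> space (gcols p n). R g / n\<^sup>2 \<ge> \<eta>}"
  have "?bad \<subseteq> ?A1 \<union> ?A2 \<union> ?A3"
  proof
    fix g assume g: "g \<in> ?bad"
    have sm: "\<bar>t\<bar> < \<eta>" if "\<not> t\<^sup>2 \<ge> \<eta>\<^sup>2" for t :: real
      using that \<eta> abs_le_square_iff[of \<eta> t] by auto
    show "g \<in> ?A1 \<union> ?A2 \<union> ?A3"
    proof (rule ccontr)
      assume "g \<notin> ?A1 \<union> ?A2 \<union> ?A3"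
      then have sm': "\<bar>2 * L g\<bar> < \<eta>" "\<bar>U g / n\<^sup>2\<bar> < \<eta>" "R g / n\<^sup>2 < \<eta>"
        using g sm[of "2 * L g"] sm[of "U g / n\<^sup>2"] by auto
      have "stat q (wish p n y g) - stat q C
        < (tr q (wish p n y g))\<^sup>2 / n - (fro q (wish p n y g) + fro q C) / n - 3 * \<eta>"
        using g by simp
      then show False using key[of g] sm' by linarith
    qed
  qed
  then have "gcols.prob p n ?bad \<le> gcols.prob p n (?A1 \<union> ?A2 \<union> ?A3)"
    by (rule gcols.finite_measure_mono) measurable
  also have "\<dots> \<le> gcols.prob p n ?A1 + gcols.prob p n ?A2 + gcols.prob p n ?A3"
    by (intro order_trans[OF measure_Un_le] add_mono measure_Un_le order_refl) measurable
  finally show ?thesis using pL pU pR unfolding W_def[symmetric] by (simp add: mult_ac)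
qed

section \<open>Moments of Gaussian Gram matrices\<close>

lemma tr_wish_mean: "n > 0 \<Longrightarrow> (\<integral>g. tr q (wish p n y g) \<partial>gcols p n) = tr q (gram p y)"
  unfolding tr_def
  by (subst Bochner_Integration.integral_sum)
    (auto intro!: sum.cong wish_mean all_moments_integrable[OF wish_moments])

lemma fro_wish_moments: "all_moments (gcols p n) (\<lambda>g. fro q (wish p n y g))"
  unfolding fro_def by (intro gcols.moment_intros wish_moments)

lemma tr_wish_moments: "all_moments (gcols p n) (\<lambda>g. tr q (wish p n y g))"
  unfolding tr_def by (intro gcols.moment_intros wish_moments)

lemma tr3_wish_moments: "all_moments (gcols p n) (\<lambda>g. tr3 q (wish p n y g) (wish p n y g) (wish p n y g))"
  unfolding tr3_def by (intro gcols.moment_intros wish_moments)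

text \<open>Jensen's inequality, through the tangent V^2 >= 2 C V - C^2 entry by entry; the mean of
  V is C.\<close>

lemma fro_wish_mean_ge:
  assumes n: "n > 0"
  shows "fro q (gram p y) \<le> (\<integral>g. fro q (wish p n y g) \<partial>gcols p n)"
proof -
  let ?C = "gram p y"
  have "fro q ?C = (\<Sum>j<q. \<Sum>l<q. 2 * ?C j l * (\<integral>g. wish p n y g j l \<partial>gcols p n) - (?C j l)\<^sup>2)"
    by (simp add: wish_mean[OF n] fro_def power2_eq_square)
  also have "\<dots> = (\<Sum>j<q. \<Sum>l<q. \<integral>g. 2 * ?C j l * wish p n y g j l - (?C j l)\<^sup>2 \<partial>gcols p n)"
    by (intro sum.cong refl) (simp add: all_moments_integrable[OF wish_moments] gcols.prob_space)
  also have "\<dots> = (\<integral>g. (\<Sum>j<q. \<Sum>l<q. 2 * ?C j l * wish p n y g j l - (?C j l)\<^sup>2) \<partial>gcols p n)"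
    by (rule integral_double_sum[symmetric], intro all_moments_integrable gcols.moment_intros wish_moments)
  also have "\<dots> \<le> (\<integral>g. fro q (wish p n y g) \<partial>gcols p n)"
  proof (rule integral_mono)
    show "integrable (gcols p n) (\<lambda>g. \<Sum>j<q. \<Sum>l<q. 2 * ?C j l * wish p n y g j l - (?C j l)\<^sup>2)"
      by (intro all_moments_integrable gcols.moment_intros wish_moments)
    show "integrable (gcols p n) (\<lambda>g. fro q (wish p n y g))"
      by (intro all_moments_integrable fro_wish_moments)
    fix g
    have "2 * ?C j l * wish p n y g j l - (?C j l)\<^sup>2 \<le> (wish p n y g j l)\<^sup>2" for j l
      using sum_squares_bound[of "?C j l" "wish p n y g j l"] by simp
    then show "(\<Sum>j<q. \<Sum>l<q. 2 * ?C j l * wish p n y g j l - (?C j l)\<^sup>2) \<le> fro q (wish p n y g)"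
      unfolding fro_def by (intro sum_mono)
  qed
  finally show ?thesis .
qed

text \<open>Jensen's inequality again, with \<open>tr3_convex\<close> as the supporting tangent; its
  linear part has mean zero.\<close>

lemma tr3_wish_mean_ge:
  assumes n: "n > 0"
  shows "tr3 q (gram p y) (gram p y) (gram p y) \<le> (\<integral>g. tr3 q (wish p n y g) (wish p n y g) (wish p n y g) \<partial>gcols p n)"
proof -
  let ?C = "gram p y"
  define C2 where "C2 j l = (\<Sum>k<q. ?C l k * ?C k j)" for j l
  define F where "F g = tr3 q ?C ?C ?C + 3 * (\<Sum>j<q. \<Sum>l<q. C2 j l * (wish p n y g j l - ?C j l))" for g
  have Fm: "all_moments (gcols p n) F"
    unfolding F_def by (intro gcols.moment_intros wish_moments)
  have "(\<integral>g. (\<Sum>j<q. \<Sum>l<q. C2 j l * (wish p n y g j l - ?C j l)) \<partial>gcols p n) =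
     (\<Sum>j<q. \<Sum>l<q. \<integral>g. C2 j l * (wish p n y g j l - ?C j l) \<partial>gcols p n)"
    by (intro integral_double_sum all_moments_integrable gcols.moment_intros wish_moments)
  also have "\<dots> = 0"
    by (intro sum.neutral ballI) (simp add: all_moments_integrable[OF wish_moments] gcols.prob_space wish_mean[OF n])
  finally have z: "(\<integral>g. (\<Sum>j<q. \<Sum>l<q. C2 j l * (wish p n y g j l - ?C j l)) \<partial>gcols p n) = 0" .
  have zi: "integrable (gcols p n) (\<lambda>g. \<Sum>j<q. \<Sum>l<q. C2 j l * (wish p n y g j l - ?C j l))"
    by (intro all_moments_integrable gcols.moment_intros wish_moments)
  have "tr3 q ?C ?C ?C = (\<integral>g. F g \<partial>gcols p n)"
    unfolding F_def using z zi by (simp add: gcols.prob_space)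
  also have "\<dots> \<le> (\<integral>g. tr3 q (wish p n y g) (wish p n y g) (wish p n y g) \<partial>gcols p n)"
  proof (rule integral_mono)
    show "F g \<le> tr3 q (wish p n y g) (wish p n y g) (wish p n y g)" for g
      unfolding F_def C2_def by (rule tr3_convex[OF refl wish_gram])
  qed (intro all_moments_integrable Fm tr3_wish_moments)+
  finally show ?thesis .
qed

section \<open>Explicit moments of Gram matrices with Gaussian columns\<close>

lemma gcols_gram_moments:
  assumes "j < q" "l < q"
  shows "all_moments (gcols p q) (\<lambda>x. gram p x j l)"
proof -
  have "all_moments (gcols p q) (\<lambda>x. x m i)" if "m < q" "i < p" for m i
    using gcols_component[OF that(1) gvec_all_moments[OF that(2)]] .
  then show ?thesis
    unfolding gram_def dot_def using assms by (intro gcols.moment_intros) auto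
qed

lemma gcols_resample:
  assumes "j < q" and "all_moments (gcols p q) f"
  shows "(\<integral>x. f x \<partial>gcols p q) = (\<integral>x. (\<integral>u. f (x(j := u)) \<partial>gvec p) \<partial>gcols p q)"
  using PiM_integral_resample[OF prob_space_gvec finite_lessThan, of j q p f] assms
    all_moments_integrable[OF assms(2)] by (simp add: gcols_def)

lemma gcols_norm_mean: "j < q \<Longrightarrow> (\<integral>x. gram p x j j \<partial>gcols p q) = p"
  unfolding gram_def using gcols_integral_component[of j q p "\<lambda>u. dot p u u"]
  by (simp add: gvec_norm_moments gvec_norm_mean)

lemma gcols_norm_fourth: "j < q \<Longrightarrow> (\<integral>x. (gram p x j j)\<^sup>2 \<partial>gcols p q) = (real p)\<^sup>2 + 2 * p"
  unfolding gram_def using gcols_integral_component[of j q p "\<lambda>u. (dot p u u)\<^sup>2"]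
  by (simp add: gvec_norm_moments gvec.all_moments_power gvec_norm_fourth)

lemma gcols_norm_sixth: "j < q \<Longrightarrow> (\<integral>x. (gram p x j j) ^ 3 \<partial>gcols p q) \<le> 15 * real p ^ 3"
  unfolding gram_def using gcols_integral_component[of j q p "\<lambda>u. (dot p u u) ^ 3"]
  by (simp add: gvec_norm_moments gvec.all_moments_power gvec_norm_sixth)

lemma gcols_inner_second:
  assumes "j < q" "l < q" "j \<noteq> l"
  shows "(\<integral>x. (gram p x j l)\<^sup>2 \<partial>gcols p q) = p"
proof -
  have "(\<integral>x. (gram p x j l)\<^sup>2 \<partial>gcols p q) = (\<integral>x. (\<integral>u. (gram p (x(j := u)) j l)\<^sup>2 \<partial>gvec p) \<partial>gcols p q)"
    using assms by (intro gcols_resample gcols.all_moments_power gcols_gram_moments)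
  also have "\<dots> = (\<integral>x. gram p x l l \<partial>gcols p q)"
  proof (rule Bochner_Integration.integral_cong[OF refl])
    fix x
    have "(gram p (x(j := u)) j l)\<^sup>2 = dot p (x l) u * dot p (x l) u" for u
      using assms by (simp add: gram_def dot_commute[of p u] power2_eq_square)
    then show "(\<integral>u. (gram p (x(j := u)) j l)\<^sup>2 \<partial>gvec p) = gram p x l l"
      by (simp add: gvec_dot_dot gram_def)
  qed
  finally show ?thesis using assms by (simp add: gcols_norm_mean)
qed

lemma gcols_tr_mean: "(\<integral>x. tr q (gram p x) \<partial>gcols p q) = real p * real q"
proof -
  have "(\<integral>x. tr q (gram p x) \<partial>gcols p q) = (\<Sum>j<q. \<integral>x. gram p x j j \<partial>gcols p q)"
    unfolding tr_def by (intro Bochner_Integration.integral_sum all_moments_integrable gcols_gram_moments) auto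
  then show ?thesis by (simp add: gcols_norm_mean mult.commute)
qed

lemma gcols_tr_variance: "(\<integral>x. (tr q (gram p x) - real p * real q)\<^sup>2 \<partial>gcols p q) = 2 * real p * real q"
proof -
  have m: "all_moments (gvec p) (\<lambda>u. dot p u u - p)"
    by (intro gvec.moment_intros gvec_norm_moments)
  have 0: "(\<integral>u. dot p u u - p \<partial>gvec p) = 0"
    using all_moments_integrable[OF gvec_norm_moments[of p]] by (simp add: gvec_norm_mean gvec.prob_space)
  have "tr q (gram p x) - real p * real q = (\<Sum>j<q. dot p (x j) (x j) - p)" for x
    by (simp add: tr_def gram_def sum_subtractf mult.commute)
  then show ?thesis
    using sum_iid_second_moment[OF prob_space_gvec finite_lessThan m 0, of q] by (simp add: gcols_def gvec_norm_variance)
qed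

lemma gcols_fro_mean: "(\<integral>x. fro q (gram p x) \<partial>gcols p q) \<le> (real q)\<^sup>2 * p + q * ((real p)\<^sup>2 + 2 * p)"
proof -
  have "(\<integral>x. fro q (gram p x) \<partial>gcols p q) = (\<Sum>j<q. \<Sum>l<q. \<integral>x. (gram p x j l)\<^sup>2 \<partial>gcols p q)"
    unfolding fro_def
    by (intro integral_double_sum all_moments_integrable gcols.all_moments_power gcols_gram_moments) auto
  also have "\<dots> \<le> (\<Sum>j<q. \<Sum>l<q. real p + ((real p)\<^sup>2 + 2 * p) * of_bool (j = l))"
  proof (intro sum_mono)
    fix j l assume jl: "j \<in> {..<q}" "l \<in> {..<q}"
    show "(\<integral>x. (gram p x j l)\<^sup>2 \<partial>gcols p q) \<le> real p + ((real p)\<^sup>2 + 2 * p) * of_bool (j = l)"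
      using jl by (cases "j = l") (simp_all add: gcols_norm_fourth gcols_inner_second)
  qed
  also have "\<dots> = (real q)\<^sup>2 * p + q * ((real p)\<^sup>2 + 2 * p)"
    by (simp add: sum.distrib sum_of_bool_eq) (simp add: power2_eq_square algebra_simps)
  finally show ?thesis by simp
qed

lemma gcols_triple_moments:
  assumes "j < q" "l < q" "k < q"
  shows "all_moments (gcols p q) (\<lambda>x. gram p x j l * gram p x l k * gram p x k j)"
  using assms by (intro gcols.all_moments_mult gcols_gram_moments)

lemma gcols_triple_distinct:
  assumes "j < q" "l < q" "k < q" and "j \<noteq> l" "l \<noteq> k" "k \<noteq> j"
  shows "(\<integral>x. gram p x j l * gram p x l k * gram p x k j \<partial>gcols p q) = p"
proof -
  have "(\<integral>x. gram p x j l * gram p x l k * gram p x k j \<partial>gcols p q) =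
    (\<integral>x. (\<integral>u. gram p (x(j := u)) j l * gram p (x(j := u)) l k * gram p (x(j := u)) k j \<partial>gvec p) \<partial>gcols p q)"
    using assms by (intro gcols_resample gcols_triple_moments)
  also have "\<dots> = (\<integral>x. (gram p x l k)\<^sup>2 \<partial>gcols p q)"
  proof (rule Bochner_Integration.integral_cong[OF refl])
    fix x
    have "gram p (x(j := u)) j l * gram p (x(j := u)) l k * gram p (x(j := u)) k j =
      gram p x l k * (dot p (x l) u * dot p (x k) u)" for u
      using assms by (simp add: gram_def dot_commute[of p u])
    then show "(\<integral>u. gram p (x(j := u)) j l * gram p (x(j := u)) l k * gram p (x(j := u)) k j \<partial>gvec p) = (gram p x l k)\<^sup>2"
      using gvec_dot_dot[of p "x l" "x k"] by (simp add: gram_def power2_eq_square)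
  qed
  finally show ?thesis using assms by (simp add: gcols_inner_second)
qed

lemma gcols_triple_pair:
  assumes "j < q" "k < q" "k \<noteq> j"
  shows "(\<integral>x. gram p x j j * (gram p x j k)\<^sup>2 \<partial>gcols p q) = (real p)\<^sup>2 + 2 * p"
proof -
  have "(\<integral>x. gram p x j j * (gram p x j k)\<^sup>2 \<partial>gcols p q) =
    (\<integral>x. (\<integral>u. gram p (x(k := u)) j j * (gram p (x(k := u)) j k)\<^sup>2 \<partial>gvec p) \<partial>gcols p q)"
    using assms by (intro gcols_resample gcols.moment_intros gcols_gram_moments)
  also have "\<dots> = (\<integral>x. (gram p x j j)\<^sup>2 \<partial>gcols p q)"
  proof (rule Bochner_Integration.integral_cong[OF refl])
    fix x
    have "gram p (x(k := u)) j j * (gram p (x(k := u)) j k)\<^sup>2 = gram p x j j * (dot p (x j) u * dot p (x j) u)" for u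
      using assms by (simp add: gram_def power2_eq_square)
    then show "(\<integral>u. gram p (x(k := u)) j j * (gram p (x(k := u)) j k)\<^sup>2 \<partial>gvec p) = (gram p x j j)\<^sup>2"
      by (simp add: gvec_dot_dot) (simp add: gram_def power2_eq_square)
  qed
  finally show ?thesis using assms by (simp add: gcols_norm_fourth)
qed

text \<open>The triples are sorted by coincidences of j, l and k: distinct indices contribute p,
  exactly two equal ones p^2 + 2 p, three equal ones a sixth moment. All terms together are of order
  n^2.\<close>

lemma gcols_tr3_mean:
  "(\<integral>x. tr3 q (gram p x) (gram p x) (gram p x) \<partial>gcols p q)
    \<le> real q ^ 3 * p + 3 * (real q)\<^sup>2 * ((real p)\<^sup>2 + 2 * p) + q * (15 * real p ^ 3)"
proof -
  define b where "b = (real p)\<^sup>2 + 2 * p"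
  define s where "s = 15 * real p ^ 3"
  have bs: "b \<ge> 0" "s \<ge> 0" by (auto simp: b_def s_def)
  have "(\<integral>x. tr3 q (gram p x) (gram p x) (gram p x) \<partial>gcols p q)
    = (\<Sum>j<q. \<Sum>l<q. \<integral>x. (\<Sum>k<q. gram p x j l * gram p x l k * gram p x k j) \<partial>gcols p q)"
    unfolding tr3_def
    by (intro integral_double_sum all_moments_integrable gcols.all_moments_sum gcols_triple_moments) auto
  also have "\<dots> = (\<Sum>j<q. \<Sum>l<q. \<Sum>k<q. \<integral>x. gram p x j l * gram p x l k * gram p x k j \<partial>gcols p q)"
    by (intro sum.cong refl Bochner_Integration.integral_sum all_moments_integrable gcols_triple_moments) auto
  \<comment> \<open>The indicators dominate every coincidence pattern; overlaps only add nonnegative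
    amounts.\<close>
  also have "\<dots> \<le> (\<Sum>j<q. \<Sum>l<q. \<Sum>k<q. real p + b * of_bool (j = l) + b * of_bool (l = k) + b * of_bool (j = k) + s * of_bool (j = l) * of_bool (j = k))"
  proof (intro sum_mono)
    fix j l k assume "j \<in> {..<q}" "l \<in> {..<q}" "k \<in> {..<q}"
    then have lt: "j < q" "l < q" "k < q" by auto
    let ?E = "\<integral>x. gram p x j l * gram p x l k * gram p x k j \<partial>gcols p q"
    have pair: "?E = b" if "j = l \<and> k \<noteq> j \<or> l = k \<and> j \<noteq> l \<or> j = k \<and> l \<noteq> j"
    proof -
      have "gram p x j l * gram p x l k * gram p x k j =
        (if j = l then gram p x j j * (gram p x j k)\<^sup>2 else if l = k then gram p x l l * (gram p x l j)\<^sup>2 else gram p x j j * (gram p x j l)\<^sup>2)" for x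
        using that by (auto simp: power2_eq_square gram_sym)
      then show ?thesis
        using that lt gcols_triple_pair[of j q k p] gcols_triple_pair[of l q j p] gcols_triple_pair[of j q l p]
        by (auto simp: b_def)
    qed
    have all: "?E \<le> s" if "j = l" "l = k"
      using gcols_norm_sixth[of j q p] that lt by (simp add: s_def power3_eq_cube)
    show "?E \<le> real p + b * of_bool (j = l) + b * of_bool (l = k) + b * of_bool (j = k) + s * of_bool (j = l) * of_bool (j = k)"
      using gcols_triple_distinct[OF lt] pair all bs
      by (cases "j = l"; cases "l = k"; cases "j = k") auto
  qed
  also have "\<dots> = real q ^ 3 * p + 3 * (real q)\<^sup>2 * b + q * s"
    by (simp add: sum.distrib sum_of_bool_eq flip: sum_distrib_left)
      (simp add: power2_eq_square power3_eq_cube algebra_simps)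
  finally show ?thesis by (simp add: b_def s_def)
qed

text \<open>The summand is (u.v)^2 minus its conditional means given u and given v, plus its mean:
  Hoeffding's degenerate kernel. Each squared norm occurs in 2 (q - 1) ordered pairs, which is the
  origin of the coefficient of the trace in \<open>stat\<close>.\<close>

lemma stat_gram_eq:
  "stat q (gram p x) + real q * (real q - 1) * p =
    (\<Sum>j<q. \<Sum>l\<in>{..<q}-{j}. (dot p (x j) (x l))\<^sup>2 - dot p (x j) (x j) - dot p (x l) (x l) + p)"
proof -
  have "(\<Sum>j<q. \<Sum>l\<in>{..<q}-{j}. (dot p (x j) (x l))\<^sup>2 - dot p (x j) (x j) - dot p (x l) (x l) + p) =
     off q (\<lambda>j l. (gram p x j l)\<^sup>2) - off q (\<lambda>j l. gram p x j j) - off q (\<lambda>j l. gram p x l l) + off q (\<lambda>j l. real p)"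
    by (simp only: off_add[symmetric] off_diff[symmetric]) (simp add: off_def gram_def)
  then show ?thesis
    unfolding off_eq[of q "\<lambda>j l. gram p x j j"] off_eq[of q "\<lambda>j l. gram p x l l"] off_eq[of q "\<lambda>j l. real p"] stat_def
    by (simp add: tr_def algebra_simps flip: sum_distrib_left)
qed

text \<open>For fixed v the kernel is the centred quadratic form with matrix v v' - I, so its second
  moment is 2 (|v|^4 - 2 |v|^2 + p), with mean 2 p (p + 1) over v. The U-statistic bound multiplies
  this by 2 q^2.\<close>

lemma gcols_stat_variance:
  "(\<integral>x. (stat q (gram p x) + real q * (real q - 1) * p)\<^sup>2 \<partial>gcols p q) \<le> 4 * (real q)\<^sup>2 * p * (p + 1)"
proof -
  define k where "k u v = (dot p u v)\<^sup>2 - dot p u u - dot p v v + p" for u v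
  have k2: "(\<integral>u. (k u v)\<^sup>2 \<partial>gvec p) = 2 * ((dot p v v)\<^sup>2 - 2 * dot p v v + p)" for v
  proof -
    define A where "A i j = v i * v j - of_bool (i = j)" for i j
    have "k u v = (\<Sum>i<p. \<Sum>j<p. A i j * (u i * u j - of_bool (i = j)))" for u
    proof -
      have "A i j * (u i * u j - of_bool (i = j)) = (u i * v i) * (u j * v j) - v i * v j * of_bool (i = j) - u i * u j * of_bool (i = j) + 1 * of_bool (i = j)" for i j
        by (simp add: A_def algebra_simps)
      then have "(\<Sum>i<p. \<Sum>j<p. A i j * (u i * u j - of_bool (i = j))) =
         (\<Sum>i<p. \<Sum>j<p. (u i * v i) * (u j * v j)) - dot p v v - dot p u u + p"
        by (simp only: sum.distrib sum_subtractf sum_of_bool_eq lessThan_iff cong: sum.cong) (simp add: dot_def)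
      then show ?thesis by (simp add: k_def dot_def power2_eq_square sum_product)
    qed
    then have "(\<integral>u. (k u v)\<^sup>2 \<partial>gvec p) = 2 * (\<Sum>i<p. \<Sum>j<p. (A i j)\<^sup>2)"
      using gvec_quadratic[of A p] by (simp add: A_def mult.commute eq_commute)
    also have "(\<Sum>i<p. \<Sum>j<p. (A i j)\<^sup>2) = (\<Sum>i<p. \<Sum>j<p. (v i * v i) * (v j * v j) - 2 * (v i * v j) * of_bool (i = j) + 1 * of_bool (i = j))"
      by (intro sum.cong refl) (simp add: A_def power2_eq_square algebra_simps)
    also have "\<dots> = (dot p v v)\<^sup>2 - 2 * dot p v v + p"
      by (simp only: sum.distrib sum_subtractf sum_of_bool_eq lessThan_iff cong: sum.cong)
        (simp add: dot_def power2_eq_square flip: sum_product sum_distrib_left sum_distrib_right)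
    finally show ?thesis .
  qed
  have vm: "all_moments (gcols p q) (\<lambda>x. (dot p (x l) (x l)))" if "l < q" for l
    using gcols_gram_moments[OF that that] by (simp add: gram_def)
  have km: "all_moments (gcols p q) (\<lambda>x. k (x j) (x l))" if "j < q" "l < q" for j l
    unfolding k_def using that vm gcols_gram_moments[OF that, unfolded gram_def] by (intro gcols.moment_intros)
  have "(\<integral>x. (\<Sum>j\<in>{..<q}. \<Sum>l\<in>{..<q}-{j}. k (x j) (x l))\<^sup>2 \<partial>PiM {..<q} (\<lambda>_. gvec p))
     \<le> 2 * (card {..<q})\<^sup>2 * (2 * real p * (p + 1))"
  proof (rule degenerate_ustat_second_moment[OF prob_space_gvec finite_lessThan])
    show "k a b = k b a" for a b by (simp add: k_def dot_commute[of p a b])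
    show "(\<integral>a. k a b \<partial>gvec p) = 0" for b
    proof -
      have "k a b = (dot p b a * dot p b a - dot p b b) - (dot p a a - p)" for a
        by (simp add: k_def dot_commute[of p a b] power2_eq_square)
      moreover have "integrable (gvec p) (\<lambda>a. dot p b a * dot p b a - dot p b b)" "integrable (gvec p) (\<lambda>a. dot p a a)"
        by (intro all_moments_integrable gvec.moment_intros gvec_dot_moments gvec_norm_moments)+
      ultimately show ?thesis
        by (simp add: gvec_dot_centered gvec_norm_mean gvec.prob_space)
    qed
    fix j l assume jl: "j \<in> {..<q}" "l \<in> {..<q}" "j \<noteq> l"
    show "all_moments (Pi\<^sub>M {..<q} (\<lambda>_. gvec p)) (\<lambda>x. k (x j) (x l))"
      using km jl by (simp add: gcols_def)
    have "(\<integral>x. (k (x j) (x l))\<^sup>2 \<partial>gcols p q) = (\<integral>x. (\<integral>u. (k u (x l))\<^sup>2 \<partial>gvec p) \<partial>gcols p q)"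
      using gcols_resample[of j q p "\<lambda>x. (k (x j) (x l))\<^sup>2"] gcols.all_moments_power[OF km[of j l]] jl by simp
    also have "\<dots> = 2 * (real p)\<^sup>2 + 2 * p"
    proof -
      have i: "integrable (gcols p q) (\<lambda>x. (dot p (x l) (x l))\<^sup>2)" "integrable (gcols p q) (\<lambda>x. dot p (x l) (x l))"
        using jl by (intro all_moments_integrable gcols.all_moments_power vm; simp)+
      have "(\<integral>x. 2 * ((dot p (x l) (x l))\<^sup>2 - 2 * dot p (x l) (x l) + p) \<partial>gcols p q)
        = 2 * ((\<integral>x. (dot p (x l) (x l))\<^sup>2 \<partial>gcols p q) - 2 * (\<integral>x. dot p (x l) (x l) \<partial>gcols p q) + p)"
        using i by (simp add: gcols.prob_space)
      then show ?thesis
        using gcols_norm_mean[of l q p] gcols_norm_fourth[of l q p] jl by (simp add: k2 gram_def)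
    qed
    finally show "(\<integral>x. (k (x j) (x l))\<^sup>2 \<partial>Pi\<^sub>M {..<q} (\<lambda>_. gvec p)) \<le> 2 * real p * (p + 1)"
      by (simp add: gcols_def power2_eq_square algebra_simps)
  qed auto
  also have "2 * (card {..<q})\<^sup>2 * (2 * real p * (p + 1)) = 4 * (real q)\<^sup>2 * p * (p + 1)"
    by (simp add: algebra_simps)
  finally show ?thesis
    unfolding stat_gram_eq k_def by (simp only: gcols_def)
qed

section \<open>Orthogonal similarity of B B' and B' B\<close>

text \<open>Orthonormality is recorded for rows and for columns, which spares the passage from
  one-sided to two-sided inverses. Entries outside the square are 0, so that the set is compact in
  the product topology on all functions; \<open>orthogonal_mat\<close> has \<open>undefined\<close>
  there.\<close>

definition biorth :: "nat \<Rightarrow> (nat \<times> nat \<Rightarrow> real) set" where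
  "biorth n = {R. (\<forall>i j. \<not> (i < n \<and> j < n) \<longrightarrow> R (i, j) = 0) \<and>
     (\<forall>i<n. \<forall>j<n. (\<Sum>k<n. R (k, i) * R (k, j)) = of_bool (i = j)) \<and>
     (\<forall>i<n. \<forall>j<n. (\<Sum>k<n. R (i, k) * R (j, k)) = of_bool (i = j))}"

text \<open>Tychonoff: a closed subset of a product of copies of [-1, 1] and {0}.\<close>

lemma compact_biorth: "compact (biorth n)"
proof -
  define S where "S \<pi> = (if fst \<pi> < n \<and> snd \<pi> < n then {-1..1} else {0::real})" for \<pi> :: "nat \<times> nat"
  have "compactin (product_topology (\<lambda>_. euclidean) UNIV) (PiE UNIV S)"
    unfolding compactin_PiE by (auto simp: S_def)
  then have cp: "compact (PiE UNIV S)"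
    by (simp add: euclidean_product_topology)
  have cl: "closed (biorth n)"
    unfolding biorth_def
    by (intro closed_Collect_conj closed_Collect_all closed_Collect_imp closed_Collect_eq open_Collect_const
        continuous_intros continuous_on_product_coordinates)
  have "biorth n \<subseteq> PiE UNIV S"
  proof
    fix R assume R: "R \<in> biorth n"
    have "\<bar>R (i, j)\<bar> \<le> 1" if ij: "i < n" "j < n" for i j
    proof -
      have "(R (i, j))\<^sup>2 \<le> (\<Sum>k<n. (R (k, j))\<^sup>2)"
        using ij by (intro member_le_sum) auto
      also have "\<dots> = 1" using R ij by (simp add: biorth_def power2_eq_square)
      finally show ?thesis by (simp add: abs_square_le_1)
    qed
    then show "R \<in> PiE UNIV S"
      using R by (auto simp: S_def biorth_def abs_le_iff)
  qed
  then have "biorth n = biorth n \<inter> PiE UNIV S" by blast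
  then show ?thesis using closed_Int_compact[OF cl cp] by simp
qed

lemma sum_split_two:
  fixes f :: "nat \<Rightarrow> real"
  assumes "a < n" "b < n" "a \<noteq> b"
  shows "(\<Sum>k<n. f k) = f a + f b + (\<Sum>k\<in>{..<n} - {a, b}. f k)"
proof -
  have "(\<Sum>k<n. f k) = f a + (\<Sum>k\<in>{..<n} - {a}. f k)" using assms by (intro sum.remove) auto
  also have "(\<Sum>k\<in>{..<n} - {a}. f k) = f b + (\<Sum>k\<in>{..<n} - {a} - {b}. f k)" using assms by (intro sum.remove) auto
  finally show ?thesis by (simp add: Diff_insert2[symmetric] insert_commute)
qed

lemma biorth_rotate:
  assumes R: "R \<in> biorth n" and ab: "a < n" "b < n" "a \<noteq> b" and cs: "c\<^sup>2 + s\<^sup>2 = 1"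
  defines "R' \<equiv> \<lambda>(i, j). if j = a then c * R (i, a) + s * R (i, b) else if j = b then c * R (i, b) - s * R (i, a) else R (i, j)"
  shows "R' \<in> biorth n"
proof -
  have out: "R' (i, j) = 0" if "\<not> (i < n \<and> j < n)" for i j
    using that R ab by (auto simp: R'_def biorth_def)
  have col: "(\<Sum>k<n. R (k, i) * R (k, j)) = of_bool (i = j)" if "i < n" "j < n" for i j
    using R that by (simp add: biorth_def)
  have "(\<Sum>k<n. R' (k, i) * R' (k, j)) = of_bool (i = j)" if ij: "i < n" "j < n" for i j
  proof -
    \<comment> \<open>One formula for all columns of \<open>R'\<close>: column i is
      \<open>al i\<close> times itself plus \<open>be i\<close> times a partner column
      \<open>si i\<close>, with \<open>be i = 0\<close> when i is neither a nor b.\<close>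
    define al where "al i = (if i = a then c else if i = b then c else 1)" for i
    define be where "be i = (if i = a then s else if i = b then - s else 0)" for i
    define si where "si i = (if i = a then b else a)" for i
    have R': "R' (k, i) = al i * R (k, i) + be i * R (k, si i)" for k i
      using ab by (auto simp: R'_def al_def be_def si_def)
    have si: "si i < n" for i using ab by (simp add: si_def)
    have "(\<Sum>k<n. R' (k, i) * R' (k, j)) = (\<Sum>k<n. al i * al j * (R (k, i) * R (k, j)) + al i * be j * (R (k, i) * R (k, si j))
        + be i * al j * (R (k, si i) * R (k, j)) + be i * be j * (R (k, si i) * R (k, si j)))"
      unfolding R' by (intro sum.cong refl) (simp add: algebra_simps)
    also have "\<dots> = al i * al j * of_bool (i = j) + al i * be j * of_bool (i = si j) + be i * al j * of_bool (si i = j)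
        + be i * be j * of_bool (si i = si j)"
      using ij si by (simp add: sum.distrib col flip: sum_distrib_left)
    also have "\<dots> = of_bool (i = j)"
      using ab cs by (auto simp: al_def be_def si_def power2_eq_square)
    finally show ?thesis .
  qed
  moreover have "(\<Sum>k<n. R' (i, k) * R' (j, k)) = of_bool (i = j)" if ij: "i < n" "j < n" for i j
  proof -
    have "R' (i, a) * R' (j, a) + R' (i, b) * R' (j, b) = (c\<^sup>2 + s\<^sup>2) * (R (i, a) * R (j, a) + R (i, b) * R (j, b))"
      using ab by (simp add: R'_def power2_eq_square algebra_simps)
    moreover have "(\<Sum>k\<in>{..<n} - {a, b}. R' (i, k) * R' (j, k)) = (\<Sum>k\<in>{..<n} - {a, b}. R (i, k) * R (j, k))"
      by (intro sum.cong) (auto simp: R'_def)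
    moreover have "(\<Sum>k<n. R (i, k) * R (j, k)) = of_bool (i = j)"
      using R ij by (simp add: biorth_def)
    ultimately show ?thesis
      unfolding sum_split_two[OF ab, of "\<lambda>k. R' (i, k) * R' (j, k)"] using sum_split_two[OF ab, of "\<lambda>k. R (i, k) * R (j, k)"] cs by simp
  qed
  ultimately show ?thesis
    using out unfolding biorth_def by blast
qed

text \<open>A maximizer of the trace of R'B over the orthogonal group makes R'B symmetric: otherwise a
  small rotation in a coordinate plane would increase the trace.\<close>

lemma procrustes:
  fixes B :: "nat \<Rightarrow> nat \<Rightarrow> real"
  shows "\<exists>R\<in>biorth n. \<forall>a<n. \<forall>b<n. (\<Sum>k<n. R (k, a) * B k b) = (\<Sum>k<n. R (k, b) * B k a)"
proof -
  define F where "F R = (\<Sum>j<n. \<Sum>i<n. R (i, j) * B i j)" for R :: "nat \<times> nat \<Rightarrow> real"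
  have "(\<lambda>(i, j). of_bool (i = j \<and> i < n)) \<in> biorth n" (is "?D \<in> _")
  proof -
    have "(\<Sum>k<n. ?D (k, i) * ?D (k, j)) = of_bool (i = j)" "(\<Sum>k<n. ?D (i, k) * ?D (j, k)) = of_bool (i = j)"
      if "i < n" for i j
    proof -
      have "(\<Sum>k<n. ?D (k, i) * ?D (k, j)) = (\<Sum>k<n. of_bool (k = j) * of_bool (i = k))"
        "(\<Sum>k<n. ?D (i, k) * ?D (j, k)) = (\<Sum>k<n. of_bool (k = j) * of_bool (i = k))"
        using that by (intro sum.cong; auto)+
      then show "(\<Sum>k<n. ?D (k, i) * ?D (k, j)) = of_bool (i = j)" "(\<Sum>k<n. ?D (i, k) * ?D (j, k)) = of_bool (i = j)"
        by (simp_all only: sum_of_bool_eq[OF that])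
    qed
    then show ?thesis by (auto simp: biorth_def)
  qed
  then have ne: "biorth n \<noteq> {}" by blast
  have "continuous_on (biorth n) F"
    unfolding F_def by (intro continuous_intros continuous_on_subset[OF continuous_on_product_coordinates]) auto
  then obtain R where R: "R \<in> biorth n" and max: "\<And>R'. R' \<in> biorth n \<Longrightarrow> F R' \<le> F R"
    using continuous_attains_sup[OF compact_biorth ne] by blast
  define C where "C a b = (\<Sum>k<n. R (k, a) * B k b)" for a b
  have "C a b = C b a" if ab: "a < n" "b < n" "a \<noteq> b" for a b
  proof -
    define u where "u = C a a + C b b"
    define d where "d = C b a - C a b"
    have le: "c * u + s * d \<le> u" if cs: "c\<^sup>2 + s\<^sup>2 = 1" for c s
    proof -
      define R' where "R' = (\<lambda>(i, j). if j = a then c * R (i, a) + s * R (i, b) else if j = b then c * R (i, b) - s * R (i, a) else R (i, j))"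
      have "R' \<in> biorth n" unfolding R'_def by (rule biorth_rotate[OF R ab cs])
      have "(\<Sum>i<n. R' (i, a) * B i a) = c * C a a + s * C b a"
        by (simp add: R'_def C_def sum_distrib_left flip: sum.distrib) (simp add: algebra_simps)
      moreover have "(\<Sum>i<n. R' (i, b) * B i b) = c * C b b - s * C a b"
        using ab by (simp add: R'_def C_def sum_distrib_left flip: sum_subtractf) (simp add: algebra_simps)
      moreover have "(\<Sum>j\<in>{..<n} - {a, b}. \<Sum>i<n. R' (i, j) * B i j) = (\<Sum>j\<in>{..<n} - {a, b}. \<Sum>i<n. R (i, j) * B i j)"
        by (intro sum.cong) (auto simp: R'_def)
      ultimately have "F R' - F R = (c * u + s * d) - u"
        unfolding F_def sum_split_two[OF ab, of "\<lambda>j. \<Sum>i<n. R' (i, j) * B i j"] sum_split_two[OF ab, of "\<lambda>j. \<Sum>i<n. R (i, j) * B i j"]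
        by (simp add: u_def d_def C_def[of a a] C_def[of b b] algebra_simps)
      with max[OF \<open>R' \<in> biorth n\<close>] show ?thesis by simp
    qed
    have "d = 0"
    proof (rule ccontr)
      assume d: "d \<noteq> 0"
      \<comment> \<open>The unit vector (u, d) / r maximizes c u + s d, with value r, which exceeds
        u unless d = 0.\<close>
      define r where "r = sqrt (u\<^sup>2 + d\<^sup>2)"
      have r2: "r\<^sup>2 = u\<^sup>2 + d\<^sup>2" by (simp add: r_def)
      have r: "r > 0" using d by (simp add: r_def sum_power2_gt_zero_iff)
      have "(u / r)\<^sup>2 + (d / r)\<^sup>2 = 1"
        using r by (simp add: power_divide add_divide_distrib[symmetric] r2[symmetric])
      from le[OF this] have "r\<^sup>2 / r \<le> u"
        unfolding r2 by (simp add: power2_eq_square add_divide_distrib)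
      then have "r \<le> u" using r by (simp add: power2_eq_square)
      then have "r\<^sup>2 \<le> u\<^sup>2" using r by (intro power_mono) auto
      then show False using r2 d by simp
    qed
    then show ?thesis by (simp add: d_def)
  qed
  then have "C a b = C b a" if "a < n" "b < n" for a b
    using that by (cases "a = b") auto
  then show ?thesis
    using R unfolding C_def by blast
qed

text \<open>With the symmetric C = R' B one has B = R C and B' R = C, hence R' B B' R = C^2 = B' B:
  a polar decomposition without eigenvalues or square roots. \<open>R\<close> is chosen before
  \<open>G\<close>, as an invariance argument integrating over \<open>G\<close> requires.\<close>

lemma gram_transpose_conj:
  fixes B :: "nat \<Rightarrow> nat \<Rightarrow> real"
  shows "\<exists>R\<in>biorth n. \<forall>(G :: nat \<times> nat \<Rightarrow> real) j l.
    (\<Sum>m<n. (\<Sum>u<n. (\<Sum>a<n. R (u, a) * G (a, j)) * B u m) * (\<Sum>v<n. (\<Sum>a<n. R (v, a) * G (a, l)) * B v m)) =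
    (\<Sum>m<n. (\<Sum>u<n. B m u * G (u, j)) * (\<Sum>v<n. B m v * G (v, l)))"
proof -
  obtain R where R: "R \<in> biorth n" and sym: "\<And>a b. a < n \<Longrightarrow> b < n \<Longrightarrow> (\<Sum>k<n. R (k, a) * B k b) = (\<Sum>k<n. R (k, b) * B k a)"
    using procrustes[of n B] by blast
  define C where "C a b = (\<Sum>k<n. R (k, a) * B k b)" for a b
  have csym: "C a b = C b a" if "a < n" "b < n" for a b using sym[OF that] by (simp add: C_def)
  have col: "(\<Sum>k<n. R (k, i) * R (k, j)) = of_bool (i = j)" if "i < n" "j < n" for i j
    using R that by (simp add: biorth_def)
  have row: "(\<Sum>k<n. R (i, k) * R (j, k)) = of_bool (i = j)" if "i < n" "j < n" for i j
    using R that by (simp add: biorth_def)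
  have B: "B m u = (\<Sum>a<n. R (m, a) * C a u)" if m: "m < n" for m u
  proof -
    have "(\<Sum>a<n. R (m, a) * C a u) = (\<Sum>a<n. \<Sum>k<n. R (m, a) * R (k, a) * B k u)"
      by (simp add: C_def sum_distrib_left mult_ac)
    also have "\<dots> = (\<Sum>k<n. (\<Sum>a<n. R (m, a) * R (k, a)) * B k u)"
      by (subst sum.swap) (simp add: sum_distrib_right)
    also have "\<dots> = (\<Sum>k<n. B k u * of_bool (m = k))"
      using m by (intro sum.cong) (auto simp: row mult.commute)
    also have "\<dots> = B m u" by (rule sum_of_bool_eq[OF m])
    finally show ?thesis by simp
  qed
  have "(\<Sum>m<n. (\<Sum>u<n. (\<Sum>a<n. R (u, a) * G (a, j)) * B u m) * (\<Sum>v<n. (\<Sum>a<n. R (v, a) * G (a, l)) * B v m)) =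
    (\<Sum>m<n. (\<Sum>u<n. B m u * G (u, j)) * (\<Sum>v<n. B m v * G (v, l)))" for G :: "nat \<times> nat \<Rightarrow> real" and j l
  proof -
    define D where "D a j = (\<Sum>u<n. C a u * G (u, j))" for a j
    have left: "(\<Sum>u<n. (\<Sum>a<n. R (u, a) * G (a, j)) * B u m) = D m j" if m: "m < n" for m j
    proof -
      have "(\<Sum>u<n. (\<Sum>a<n. R (u, a) * G (a, j)) * B u m) = (\<Sum>a<n. \<Sum>u<n. R (u, a) * B u m * G (a, j))"
        unfolding sum_distrib_right by (subst sum.swap) (simp add: mult_ac)
      also have "\<dots> = (\<Sum>a<n. C a m * G (a, j))" by (simp add: C_def sum_distrib_right)
      also have "\<dots> = D m j" unfolding D_def using m by (intro sum.cong) (auto simp: csym)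
      finally show ?thesis .
    qed
    have right: "(\<Sum>u<n. B m u * G (u, j)) = (\<Sum>a<n. R (m, a) * D a j)" if m: "m < n" for m j
    proof -
      have "(\<Sum>u<n. B m u * G (u, j)) = (\<Sum>u<n. \<Sum>a<n. R (m, a) * (C a u * G (u, j)))"
        by (simp only: B[OF m] sum_distrib_right mult.assoc)
      also have "\<dots> = (\<Sum>a<n. R (m, a) * D a j)"
        by (subst sum.swap) (simp add: D_def sum_distrib_left)
      finally show ?thesis .
    qed
    have "(\<Sum>m<n. (\<Sum>u<n. B m u * G (u, j)) * (\<Sum>v<n. B m v * G (v, l))) = (\<Sum>m<n. \<Sum>a<n. \<Sum>b<n. R (m, a) * R (m, b) * (D a j * D b l))"
      by (simp add: right sum_product mult_ac)
    also have "\<dots> = (\<Sum>a<n. \<Sum>b<n. (\<Sum>m<n. R (m, a) * R (m, b)) * (D a j * D b l))"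
      by (subst sum_rotate) (simp add: sum_distrib_right)
    also have "\<dots> = (\<Sum>a<n. \<Sum>b<n. (D a j * D b l) * of_bool (a = b))"
      by (intro sum.cong refl) (simp add: col)
    also have "\<dots> = (\<Sum>a<n. D a j * D a l)"
      by (intro sum.cong refl) (simp add: sum_of_bool_eq)
    finally show ?thesis by (simp add: left)
  qed
  with R show ?thesis by blast
qed

section \<open>Rotation invariance of Gaussian measures\<close>

lemma nn_integral_shear:
  fixes g :: "real \<times> real \<Rightarrow> ennreal"
  assumes [measurable]: "g \<in> borel_measurable (lborel \<Otimes>\<^sub>M lborel)"
  shows "(\<integral>\<^sup>+x. \<integral>\<^sup>+y. g (x, y + s * x) \<partial>lborel \<partial>lborel) = (\<integral>\<^sup>+x. \<integral>\<^sup>+y. g (x, y) \<partial>lborel \<partial>lborel)"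
    and "(\<integral>\<^sup>+x. \<integral>\<^sup>+y. g (x - s * y, y) \<partial>lborel \<partial>lborel) = (\<integral>\<^sup>+x. \<integral>\<^sup>+y. g (x, y) \<partial>lborel \<partial>lborel)"
proof -
  have shift: "(\<integral>\<^sup>+y. h (y + t) \<partial>lborel) = (\<integral>\<^sup>+y. h y \<partial>lborel)" if [measurable]: "h \<in> borel_measurable borel" for h :: "real \<Rightarrow> ennreal" and t
    using nn_integral_real_affine[of h 1 t] by (simp add: add.commute)
  have g': "g \<in> borel_measurable (borel \<Otimes>\<^sub>M borel)"
    using assms by (simp cong: measurable_cong_sets sets_pair_measure_cong)
  have [measurable]: "(\<lambda>y. g (x, y)) \<in> borel_measurable borel" "(\<lambda>x. g (x, y)) \<in> borel_measurable borel" for x y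
    using g' by measurable
  show "(\<integral>\<^sup>+x. \<integral>\<^sup>+y. g (x, y + s * x) \<partial>lborel \<partial>lborel) = (\<integral>\<^sup>+x. \<integral>\<^sup>+y. g (x, y) \<partial>lborel \<partial>lborel)"
    by (intro nn_integral_cong shift) measurable
  have "(\<integral>\<^sup>+x. \<integral>\<^sup>+y. g (x - s * y, y) \<partial>lborel \<partial>lborel) = (\<integral>\<^sup>+y. \<integral>\<^sup>+x. g (x - s * y, y) \<partial>lborel \<partial>lborel)"
    using g' by (intro lborel_pair.Fubini') measurable
  also have "\<dots> = (\<integral>\<^sup>+y. \<integral>\<^sup>+x. g (x, y) \<partial>lborel \<partial>lborel)"
  proof (rule nn_integral_cong)
    fix y
    show "(\<integral>\<^sup>+x. g (x - s * y, y) \<partial>lborel) = (\<integral>\<^sup>+x. g (x, y) \<partial>lborel)"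
      using shift[of "\<lambda>x. g (x, y)" "- (s * y)"] by simp
  qed
  also have "\<dots> = (\<integral>\<^sup>+x. \<integral>\<^sup>+y. g (x, y) \<partial>lborel \<partial>lborel)"
    using g' by (intro lborel_pair.Fubini'[symmetric]) measurable
  finally show "(\<integral>\<^sup>+x. \<integral>\<^sup>+y. g (x - s * y, y) \<partial>lborel \<partial>lborel) = (\<integral>\<^sup>+x. \<integral>\<^sup>+y. g (x, y) \<partial>lborel \<partial>lborel)" .
qed

text \<open>A rotation is the composition of three shears unless its sine vanishes; the half turn is
  the square of the quarter turn.\<close>

lemma nn_integral_rotation_lborel:
  fixes g :: "real \<times> real \<Rightarrow> ennreal"
  assumes g: "g \<in> borel_measurable (lborel \<Otimes>\<^sub>M lborel)" and cs: "c\<^sup>2 + s\<^sup>2 = 1"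
  shows "(\<integral>\<^sup>+x. \<integral>\<^sup>+y. g (c * x - s * y, s * x + c * y) \<partial>lborel \<partial>lborel) = (\<integral>\<^sup>+x. \<integral>\<^sup>+y. g (x, y) \<partial>lborel \<partial>lborel)"
proof -
  have main: "(\<integral>\<^sup>+x. \<integral>\<^sup>+y. g (c * x - s * y, s * x + c * y) \<partial>lborel \<partial>lborel) = (\<integral>\<^sup>+x. \<integral>\<^sup>+y. g (x, y) \<partial>lborel \<partial>lborel)"
    if g: "g \<in> borel_measurable (lborel \<Otimes>\<^sub>M lborel)" and cs: "c\<^sup>2 + s\<^sup>2 = 1" and s: "s \<noteq> 0" for g :: "real \<times> real \<Rightarrow> ennreal" and c s
  proof -
    \<comment> \<open>For a rotation by the angle \<theta>, t is tan(\<theta> / 2), the coefficient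
      of the two outer shears; the middle shear has coefficient s.\<close>
    define t where "t = (1 - c) / s"
    have ts: "t * s = 1 - c" using s by (simp add: t_def)
    have tc: "t * (1 + c) = s"
    proof -
      have "(1 - c) * (1 + c) = s * s" using cs by (simp add: power2_eq_square algebra_simps)
      then show ?thesis using s by (simp add: t_def)
    qed
    have g' [measurable]: "g \<in> borel_measurable (borel \<Otimes>\<^sub>M borel)"
      using g by (simp cong: measurable_cong_sets sets_pair_measure_cong)
    define A where "A = (\<lambda>(x, y). g (x - t * y, y))"
    define B where "B = (\<lambda>(x, y). A (x, y + s * x))"
    have A': "A \<in> borel_measurable (borel \<Otimes>\<^sub>M borel)" unfolding A_def by measurable
    then have B': "B \<in> borel_measurable (borel \<Otimes>\<^sub>M borel)" unfolding B_def by measurable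
    have A: "A \<in> borel_measurable (lborel \<Otimes>\<^sub>M lborel)" and B: "B \<in> borel_measurable (lborel \<Otimes>\<^sub>M lborel)"
      using A' B' by (simp_all cong: measurable_cong_sets sets_pair_measure_cong)
    have "g (c * x - s * y, s * x + c * y) = B (x - t * y, y)" for x y
    proof -
      have "y + s * (x - t * y) = s * x + (1 - t * s) * y" by (simp add: algebra_simps)
      then have 1: "y + s * (x - t * y) = s * x + c * y" by (simp add: ts)
      have "x - t * y - t * (s * x + c * y) = (1 - t * s) * x - t * (1 + c) * y" by (simp add: algebra_simps)
      then have 2: "x - t * y - t * (s * x + c * y) = c * x - s * y" by (simp add: ts tc)
      show ?thesis by (simp add: A_def B_def 1 2)
    qed
    then have "(\<integral>\<^sup>+x. \<integral>\<^sup>+y. g (c * x - s * y, s * x + c * y) \<partial>lborel \<partial>lborel) = (\<integral>\<^sup>+x. \<integral>\<^sup>+y. B (x, y) \<partial>lborel \<partial>lborel)"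
      using nn_integral_shear(2)[OF B] by simp
    also have "\<dots> = (\<integral>\<^sup>+x. \<integral>\<^sup>+y. A (x, y) \<partial>lborel \<partial>lborel)"
      using nn_integral_shear(1)[OF A] by (simp add: B_def)
    also have "\<dots> = (\<integral>\<^sup>+x. \<integral>\<^sup>+y. g (x, y) \<partial>lborel \<partial>lborel)"
      using nn_integral_shear(2)[OF g] by (simp add: A_def)
    finally show ?thesis .
  qed
  show ?thesis
  proof (cases "s = 0")
    case False
    then show ?thesis by (rule main[OF g cs])
  next
    case True
    then have "c = 1 \<or> c = - 1" using cs by (simp add: power2_eq_1_iff)
    then show ?thesis
    proof
      assume "c = 1"
      then show ?thesis using True by simp
    next
      assume c: "c = - 1"
      define h where "h = (\<lambda>(x, y). g (0 * x - 1 * y, 1 * x + 0 * y))"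
      have "h \<in> borel_measurable (borel \<Otimes>\<^sub>M borel)"
        using g unfolding h_def by (simp cong: measurable_cong_sets sets_pair_measure_cong)
      then have h: "h \<in> borel_measurable (lborel \<Otimes>\<^sub>M lborel)"
        by (simp cong: measurable_cong_sets sets_pair_measure_cong)
      show ?thesis
        using main[OF h, of 0 1] main[OF g, of 0 1] True c by (simp add: h_def)
    qed
  qed
qed

lemma nn_integral_rotation_normal:
  fixes f :: "real \<times> real \<Rightarrow> ennreal"
  assumes f [measurable]: "f \<in> borel_measurable (borel \<Otimes>\<^sub>M borel)" and cs: "c\<^sup>2 + s\<^sup>2 = 1"
  shows "(\<integral>\<^sup>+x. \<integral>\<^sup>+y. f (c * x - s * y, s * x + c * y) \<partial>std_normal_distribution \<partial>std_normal_distribution)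
    = (\<integral>\<^sup>+x. \<integral>\<^sup>+y. f (x, y) \<partial>std_normal_distribution \<partial>std_normal_distribution)"
proof -
  define E where "E r = ennreal (exp (- r / 2) / (2 * pi))" for r :: real
  have [measurable]: "E \<in> borel_measurable borel" unfolding E_def by measurable
  have dens: "(\<integral>\<^sup>+x. \<integral>\<^sup>+y. h (x, y) \<partial>std_normal_distribution \<partial>std_normal_distribution)
    = (\<integral>\<^sup>+x. \<integral>\<^sup>+y. E (x\<^sup>2 + y\<^sup>2) * h (x, y) \<partial>lborel \<partial>lborel)"
    if [measurable]: "h \<in> borel_measurable (borel \<Otimes>\<^sub>M borel)" for h
  proof -
    have *: "std_normal_density x * std_normal_density y = exp (- (x\<^sup>2 + y\<^sup>2) / 2) / (2 * pi)" for x y :: real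
      by (simp add: normal_density_def mult_exp_exp real_sqrt_mult field_simps)
    have "(\<integral>\<^sup>+x. \<integral>\<^sup>+y. h (x, y) \<partial>std_normal_distribution \<partial>std_normal_distribution)
      = (\<integral>\<^sup>+x. ennreal (std_normal_density x) * (\<integral>\<^sup>+y. ennreal (std_normal_density y) * h (x, y) \<partial>lborel) \<partial>lborel)"
      by (subst nn_integral_density, measurable, subst nn_integral_density, measurable)
    also have "\<dots> = (\<integral>\<^sup>+x. \<integral>\<^sup>+y. ennreal (std_normal_density x * std_normal_density y) * h (x, y) \<partial>lborel \<partial>lborel)"
      by (subst nn_integral_cmult[symmetric], measurable) (simp add: ennreal_mult normal_density_nonneg mult.assoc)
    finally show ?thesis unfolding * E_def .
  qed
  define g where "g = (\<lambda>(x, y). E (x\<^sup>2 + y\<^sup>2) * f (x, y))"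
  have "g \<in> borel_measurable (borel \<Otimes>\<^sub>M borel)" unfolding g_def by measurable
  then have g: "g \<in> borel_measurable (lborel \<Otimes>\<^sub>M lborel)"
    by (simp cong: measurable_cong_sets sets_pair_measure_cong)
  have "(c * x - s * y)\<^sup>2 + (s * x + c * y)\<^sup>2 = x\<^sup>2 + y\<^sup>2" for x y
  proof -
    have "(c * x - s * y)\<^sup>2 + (s * x + c * y)\<^sup>2 = (c\<^sup>2 + s\<^sup>2) * (x\<^sup>2 + y\<^sup>2)" by algebra
    then show ?thesis by (simp add: cs)
  qed
  then show ?thesis
    using nn_integral_rotation_lborel[OF g cs] dens[of "\<lambda>(x, y). f (c * x - s * y, s * x + c * y)"] dens[of f]
    by (simp add: g_def)
qed

text \<open>Fubini makes coordinates \<open>a\<close> and \<open>b\<close> innermost, and the planar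
  rotation applies with the others frozen. Both updates read the old values of the two
  coordinates.\<close>

lemma nn_integral_PiM_rotation:
  fixes f :: "('i \<Rightarrow> real) \<Rightarrow> ennreal" and I :: "'i set"
  defines "P \<equiv> PiM I (\<lambda>_. std_normal_distribution)"
  assumes I: "finite I" "a \<in> I" "b \<in> I" "a \<noteq> b" and f: "f \<in> borel_measurable P" and cs: "c\<^sup>2 + s\<^sup>2 = 1"
  shows "(\<integral>\<^sup>+w. f (w(a := c * w a - s * w b, b := s * w a + c * w b)) \<partial>P) = (\<integral>\<^sup>+w. f w \<partial>P)"
proof -
  define J where "J = I - {a, b}"
  have J: "finite J" "b \<notin> J" "a \<notin> insert b J" "I = insert a (insert b J)"
    using I by (auto simp: J_def)
  interpret N: prob_space std_normal_distribution by (rule prob_space_std_normal)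
  interpret product_sigma_finite "\<lambda>_::'i. std_normal_distribution"
    by (intro product_sigma_finite.intro prob_space_imp_sigma_finite prob_space_std_normal)
  have iter: "(\<integral>\<^sup>+w. h w \<partial>P) = (\<integral>\<^sup>+w. \<integral>\<^sup>+y. \<integral>\<^sup>+x. h (w(b := y, a := x)) \<partial>std_normal_distribution \<partial>std_normal_distribution \<partial>PiM J (\<lambda>_. std_normal_distribution))"
    if h: "h \<in> borel_measurable P" for h
  proof -
    have [measurable]: "h \<in> borel_measurable (PiM (insert a (insert b J)) (\<lambda>_. std_normal_distribution))"
      using h J by (simp add: P_def)
    have "(\<integral>\<^sup>+w. h w \<partial>P) = (\<integral>\<^sup>+w. \<integral>\<^sup>+x. h (w(a := x)) \<partial>std_normal_distribution \<partial>PiM (insert b J) (\<lambda>_. std_normal_distribution))"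
      unfolding P_def J(4) using J by (intro product_nn_integral_insert) auto
    also have "\<dots> = (\<integral>\<^sup>+w. \<integral>\<^sup>+y. \<integral>\<^sup>+x. h (w(b := y, a := x)) \<partial>std_normal_distribution \<partial>std_normal_distribution \<partial>PiM J (\<lambda>_. std_normal_distribution))"
      using J by (intro product_nn_integral_insert) auto
    finally show ?thesis .
  qed
  have fI [measurable]: "f \<in> borel_measurable (PiM I (\<lambda>_. std_normal_distribution))"
    using f by (simp add: P_def)
  have rm: "(\<lambda>w. f (w(a := c * w a - s * w b, b := s * w a + c * w b))) \<in> borel_measurable P"
  proof -
    have "(\<lambda>w. w(a := c * w a - s * w b, b := s * w a + c * w b)) \<in> measurable (PiM I (\<lambda>_. std_normal_distribution)) (PiM I (\<lambda>_. std_normal_distribution))"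
    proof (rule measurable_PiM_single')
      fix i assume "i \<in> I"
      then show "(\<lambda>w. (w(a := c * w a - s * w b, b := s * w a + c * w b)) i) \<in> measurable (PiM I (\<lambda>_. std_normal_distribution)) std_normal_distribution"
        using I by (cases "i = a"; cases "i = b") auto
    qed (use I in \<open>auto simp: space_PiM PiE_def extensional_def\<close>)
    then show ?thesis using measurable_compose[OF _ fI] by (simp add: P_def)
  qed
  have inner: "(\<integral>\<^sup>+y. \<integral>\<^sup>+x. f (w(b := s * x + c * y, a := c * x - s * y)) \<partial>std_normal_distribution \<partial>std_normal_distribution)
     = (\<integral>\<^sup>+y. \<integral>\<^sup>+x. f (w(b := y, a := x)) \<partial>std_normal_distribution \<partial>std_normal_distribution)"
    if w: "w \<in> space (PiM J (\<lambda>_. std_normal_distribution))" for w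
  proof -
    have "(\<lambda>(y, x). w(b := y, a := x)) \<in> measurable (borel \<Otimes>\<^sub>M borel) (PiM I (\<lambda>_. std_normal_distribution))"
    proof (rule measurable_PiM_single')
      fix i assume "i \<in> I"
      then show "(\<lambda>yx. (case yx of (y, x) \<Rightarrow> w(b := y, a := x)) i) \<in> measurable (borel \<Otimes>\<^sub>M borel) std_normal_distribution"
        using I by (cases "i = a"; cases "i = b") (auto simp: case_prod_beta)
    qed (use w J in \<open>auto simp: space_PiM PiE_def extensional_def\<close>)
    from measurable_compose[OF this fI]
    have m: "(\<lambda>(y, x). f (w(b := y, a := x))) \<in> borel_measurable (borel \<Otimes>\<^sub>M borel)"
      by (simp add: case_prod_beta)
    have "c\<^sup>2 + (- s)\<^sup>2 = 1" using cs by simp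
    from nn_integral_rotation_normal[OF m this] show ?thesis
      by (simp add: add.commute)
  qed
  have "(\<integral>\<^sup>+w. f (w(a := c * w a - s * w b, b := s * w a + c * w b)) \<partial>P) =
    (\<integral>\<^sup>+w. \<integral>\<^sup>+y. \<integral>\<^sup>+x. f (w(b := s * x + c * y, a := c * x - s * y)) \<partial>std_normal_distribution \<partial>std_normal_distribution \<partial>PiM J (\<lambda>_. std_normal_distribution))"
    unfolding iter[OF rm] using I(4) by (simp add: fun_upd_twist)
  also have "\<dots> = (\<integral>\<^sup>+w. \<integral>\<^sup>+y. \<integral>\<^sup>+x. f (w(b := y, a := x)) \<partial>std_normal_distribution \<partial>std_normal_distribution \<partial>PiM J (\<lambda>_. std_normal_distribution))"
    by (intro nn_integral_cong inner)
  also have "\<dots> = (\<integral>\<^sup>+w. f w \<partial>P)"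
    by (rule iter[OF f, symmetric])
  finally show ?thesis .
qed

section \<open>Orthonormal frames and Givens rotations\<close>

definition orthonormal_cols :: "nat \<Rightarrow> nat \<Rightarrow> (nat \<Rightarrow> nat \<Rightarrow> real) \<Rightarrow> bool" where
  "orthonormal_cols n q V \<longleftrightarrow> (\<forall>i<q. \<forall>j<q. (\<Sum>k<n. V k i * V k j) = of_bool (i = j))"

definition rot_rows :: "nat \<Rightarrow> nat \<Rightarrow> real \<Rightarrow> real \<Rightarrow> (nat \<Rightarrow> nat \<Rightarrow> real) \<Rightarrow> nat \<Rightarrow> nat \<Rightarrow> real" where
  "rot_rows a b c s V = V(a := \<lambda>j. c * V a j + s * V b j, b := \<lambda>j. c * V b j - s * V a j)"

lemma rot_rows_orthonormal:
  assumes V: "orthonormal_cols n q V" and ab: "a < n" "b < n" "a \<noteq> b" and cs: "c\<^sup>2 + s\<^sup>2 = 1"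
  shows "orthonormal_cols n q (rot_rows a b c s V)"
  unfolding orthonormal_cols_def
proof (intro allI impI)
  fix i j assume ij: "i < q" "j < q"
  let ?W = "rot_rows a b c s V"
  have "?W a i * ?W a j + ?W b i * ?W b j = (c\<^sup>2 + s\<^sup>2) * (V a i * V a j + V b i * V b j)"
    using ab by (simp add: rot_rows_def power2_eq_square algebra_simps)
  moreover have "(\<Sum>k\<in>{..<n} - {a, b}. ?W k i * ?W k j) = (\<Sum>k\<in>{..<n} - {a, b}. V k i * V k j)"
    by (intro sum.cong) (auto simp: rot_rows_def)
  ultimately have "(\<Sum>k<n. ?W k i * ?W k j) = (\<Sum>k<n. V k i * V k j)"
    unfolding sum_split_two[OF ab, of "\<lambda>k. ?W k i * ?W k j"] using sum_split_two[OF ab, of "\<lambda>k. V k i * V k j"] cs by simp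
  then show "(\<Sum>k<n. ?W k i * ?W k j) = of_bool (i = j)"
    using V ij by (simp add: orthonormal_cols_def)
qed

text \<open>An induction principle in place of a factorization: a property that can be pulled back
  along row rotations and holds for the standard frame holds for every orthonormal frame. Since q <
  n there is always a row below the pivot, so a pivot -1 is corrected by a half turn and reflections
  never arise.\<close>

lemma givens_elimination:
  assumes q: "q < n"
    and rot: "\<And>a b c s V. a < n \<Longrightarrow> b < n \<Longrightarrow> a \<noteq> b \<Longrightarrow> c\<^sup>2 + s\<^sup>2 = 1 \<Longrightarrow> P (rot_rows a b c s V) \<Longrightarrow> P V"
    and base: "\<And>V. (\<forall>k<n. \<forall>j<q. V k j = of_bool (k = j)) \<Longrightarrow> P V"
    and V: "orthonormal_cols n q V"
  shows "P V"
proof -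
  define can where "can r V \<longleftrightarrow> (\<forall>k<n. \<forall>j<r. V k j = of_bool (k = j))" for r and V :: "nat \<Rightarrow> nat \<Rightarrow> real"
  have "\<forall>V. orthonormal_cols n q V \<longrightarrow> can 0 V \<longrightarrow> P V"
  proof (rule inc_induct[of 0 q])
    show "\<forall>V. orthonormal_cols n q V \<longrightarrow> can q V \<longrightarrow> P V"
      using base by (auto simp: can_def)
  next
    fix r assume r: "r < q" and IH: "\<forall>V. orthonormal_cols n q V \<longrightarrow> can (Suc r) V \<longrightarrow> P V"
    have rn: "r < n" using r q by simp
    \<comment> \<open>The inner induction raises m: the claim assumes column r to vanish from row m
      on, so at m = n this is no condition, and one rotation of rows r and m leads back from m + 1
      to m.\<close>
    have step: "\<forall>V. orthonormal_cols n q V \<longrightarrow> can r V \<longrightarrow> (\<forall>k<n. m \<le> k \<longrightarrow> V k r = 0) \<longrightarrow> P V" if "Suc r \<le> m" "m \<le> n" for m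
      using that
    proof (induction m rule: dec_induct)
      case base
      show ?case
      proof (intro allI impI)
        fix V assume o: "orthonormal_cols n q V" and c: "can r V" and z: "\<forall>k<n. Suc r \<le> k \<longrightarrow> V k r = 0"
        \<comment> \<open>Above the pivot the entries vanish by orthogonality to the earlier
          columns, which are already standard.\<close>
        have z': "V k r = 0" if k: "k < n" "k \<noteq> r" for k
        proof (cases "k < r")
          case True
          have "(\<Sum>l<n. V l r * of_bool (k = l)) = (\<Sum>l<n. V l k * V l r)"
            using c True by (intro sum.cong) (auto simp: can_def)
          also have "\<dots> = 0" using o True r by (simp add: orthonormal_cols_def)
          finally show ?thesis using k by (simp add: sum_of_bool_eq)
        next
          case False
          then show ?thesis using z k by simp
        qed
        have "(\<Sum>k<n. V k r * V k r) = V r r * V r r"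
          using z' rn by (subst sum.mono_neutral_right[of _ "{r}"]) auto
        then have "V r r * V r r = 1" using o r by (simp add: orthonormal_cols_def)
        then consider "V r r = 1" | "V r r = - 1" by (auto simp: square_eq_1_iff)
        then show "P V"
        proof cases
          case 1
          then have "can (Suc r) V" using c z' by (auto simp: can_def less_Suc_eq)
          with IH o show ?thesis by blast
        next
          case 2
          \<comment> \<open>A half turn of rows r and r + 1. It changes the sign of the pivot, and
            the entries of row r + 1 in the treated columns are 0.\<close>
          let ?W = "rot_rows r (Suc r) (- 1) 0 V"
          have sr: "Suc r < n" using r q by simp
          have "can (Suc r) ?W"
            using c z' 2 sr by (auto simp: can_def less_Suc_eq rot_rows_def)
          moreover have "orthonormal_cols n q ?W"
            using o rn sr by (intro rot_rows_orthonormal) auto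
          ultimately have "P ?W" using IH by blast
          then show ?thesis using rot[of r "Suc r" "- 1" 0 V] rn sr by simp
        qed
      qed
    next
      case (step m)
      show ?case
      proof (intro allI impI)
        fix V assume o: "orthonormal_cols n q V" and c: "can r V" and z: "\<forall>k<n. Suc m \<le> k \<longrightarrow> V k r = 0"
        have m: "m < n" "r \<noteq> m" "r < m" using step by auto
        define u where "u = V r r"
        define v where "v = V m r"
        show "P V"
        proof (cases "v = 0")
          case True
          then have "\<forall>k<n. m \<le> k \<longrightarrow> V k r = 0" using z by (auto simp: v_def le_less Suc_le_eq)
          then show ?thesis using step o c by auto
        next
          case False
          define \<rho> where "\<rho> = sqrt (u\<^sup>2 + v\<^sup>2)"
          have \<rho>2: "\<rho>\<^sup>2 = u\<^sup>2 + v\<^sup>2" by (simp add: \<rho>_def)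
          have \<rho>: "\<rho> \<noteq> 0" using False by (simp add: \<rho>_def sum_power2_eq_zero_iff)
          have cs: "(u / \<rho>)\<^sup>2 + (v / \<rho>)\<^sup>2 = 1"
            using \<rho> by (simp add: power_divide add_divide_distrib[symmetric] \<rho>2[symmetric])
          let ?W = "rot_rows r m (u / \<rho>) (v / \<rho>) V"
          have "can r ?W"
            using c m by (auto simp: can_def rot_rows_def)
          moreover have "\<forall>k<n. m \<le> k \<longrightarrow> ?W k r = 0"
            using z m by (auto simp: rot_rows_def u_def v_def mult.commute)
          moreover have "orthonormal_cols n q ?W"
            using o rn m cs by (intro rot_rows_orthonormal) auto
          ultimately have "P ?W" using step by auto
          then show ?thesis using rot[of r m "u / \<rho>" "v / \<rho>" V] rn m cs by simp
        qed
      qed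
    qed
    from step[of n] show "\<forall>V. orthonormal_cols n q V \<longrightarrow> can r V \<longrightarrow> P V"
      using rn by auto
  qed simp
  then show ?thesis using V by (simp add: can_def)
qed

lemma sets_mat_space: "sets (mat_space p q) = sets (gauss_mat p q)"
  unfolding mat_space_def gauss_mat_def by (intro sets_PiM_cong) auto

text \<open>\<open>nn_integral_PiM_rotation\<close> moves only two entries of K, both taken in one
  row. So each row i of K gets its own frame \<open>U i\<close>, and the frames are reduced row by
  row to the standard one, where the map merely restricts K to its first q columns.\<close>

lemma gauss_mat_block_invariant:
  assumes q: "q < n" and V: "orthonormal_cols n q V" and f: "f \<in> borel_measurable (mat_space p q)"
  shows "(\<integral>\<^sup>+K. f (\<lambda>(i, j)\<in>{..<p} \<times> {..<q}. \<Sum>a<n. K (i, a) * V a j) \<partial>gauss_mat p n) = (\<integral>\<^sup>+X. f X \<partial>gauss_mat p q)"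
proof -
  define blk where "blk U K = (\<lambda>(i, j)\<in>{..<p} \<times> {..<q}. \<Sum>a<n. K (i, a) * U i a j)" for U :: "nat \<Rightarrow> nat \<Rightarrow> nat \<Rightarrow> real" and K :: "nat \<times> nat \<Rightarrow> real"
  define L where "L U = (\<integral>\<^sup>+K. f (blk U K) \<partial>gauss_mat p n)" for U
  have blk: "blk U \<in> measurable (gauss_mat p n) (mat_space p q)" for U
    unfolding blk_def mat_space_def
  proof (rule measurable_restrict)
    fix ij assume "ij \<in> {..<p} \<times> {..<q}"
    then obtain i j where ij: "ij = (i, j)" "i < p" "j < q" by auto
    have "(\<lambda>K. K (i, a)) \<in> borel_measurable (gauss_mat p n)" if "a < n" for a
    proof -
      have "(\<lambda>K. K (i, a)) \<in> measurable (gauss_mat p n) std_normal_distribution"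
        unfolding gauss_mat_def using that ij by (intro measurable_component_singleton) auto
      then show ?thesis by simp
    qed
    then show "(\<lambda>K. case ij of (i, j) \<Rightarrow> \<Sum>a<n. K (i, a) * U i a j) \<in> measurable (gauss_mat p n) lborel"
      unfolding ij by (auto intro!: borel_measurable_sum borel_measurable_times)
  qed
  have fb: "(\<lambda>K. f (blk U K)) \<in> borel_measurable (gauss_mat p n)" for U
    using measurable_compose[OF blk f] .
  \<comment> \<open>Rotating rows a and b of the frame has the same effect on the product as the
    adjoint rotation of the entries (i,a) and (i,b) of K.\<close>
  have rotinv: "L (U(i := rot_rows a b c s W)) = L (U(i := W))"
    if i: "i < p" and ab: "a < n" "b < n" "a \<noteq> b" and cs: "c\<^sup>2 + s\<^sup>2 = 1" for U W i a b c s
  proof -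
    define \<rho> where "\<rho> K = K((i, a) := c * K (i, a) - s * K (i, b), (i, b) := s * K (i, a) + c * K (i, b))" for K :: "nat \<times> nat \<Rightarrow> real"
    have "blk (U(i := rot_rows a b c s W)) K = blk (U(i := W)) (\<rho> K)" for K
    proof -
      have "(\<Sum>k<n. K (i, k) * rot_rows a b c s W k j) = (\<Sum>k<n. \<rho> K (i, k) * W k j)" for j
      proof -
        have "(\<Sum>k\<in>{..<n} - {a, b}. K (i, k) * rot_rows a b c s W k j) = (\<Sum>k\<in>{..<n} - {a, b}. \<rho> K (i, k) * W k j)"
          by (intro sum.cong) (auto simp: rot_rows_def \<rho>_def)
        moreover have "K (i, a) * rot_rows a b c s W a j + K (i, b) * rot_rows a b c s W b j = \<rho> K (i, a) * W a j + \<rho> K (i, b) * W b j"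
          using ab by (simp add: rot_rows_def \<rho>_def algebra_simps)
        ultimately show ?thesis
          unfolding sum_split_two[OF ab, of "\<lambda>k. K (i, k) * rot_rows a b c s W k j"] sum_split_two[OF ab, of "\<lambda>k. \<rho> K (i, k) * W k j"] by simp
      qed
      moreover have "\<rho> K (i', k) = K (i', k)" if "i' \<noteq> i" for i' k
        using that by (simp add: \<rho>_def)
      ultimately show ?thesis by (auto simp: blk_def fun_eq_iff restrict_def)
    qed
    then show ?thesis
      using nn_integral_PiM_rotation[of "{..<p} \<times> {..<n}" "(i, a)" "(i, b)" "\<lambda>K. f (blk (U(i := W)) K)" c s] i ab cs fb
      by (simp add: L_def \<rho>_def gauss_mat_def)
  qed
  \<comment> \<open>\<open>k\<close> is the number of leading rows whose frame may still be
    arbitrary.\<close>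
  have all: "k \<le> p \<Longrightarrow> (\<And>i. i < p \<Longrightarrow> orthonormal_cols n q (U i)) \<Longrightarrow>
    (\<And>i. k \<le> i \<Longrightarrow> i < p \<Longrightarrow> (\<forall>a<n. \<forall>j<q. U i a j = of_bool (a = j))) \<Longrightarrow> L U = (\<integral>\<^sup>+X. f X \<partial>gauss_mat p q)" for k U
  proof (induction k arbitrary: U)
    case 0
    have e1: "blk U K = restrict K ({..<p} \<times> {..<q})" for K
    proof -
      have "(\<Sum>a<n. K (i, a) * U i a j) = K (i, j)" if "i < p" "j < q" for i j
      proof -
        have "(\<Sum>a<n. K (i, a) * U i a j) = (\<Sum>a<n. K (i, a) * of_bool (j = a))"
          using 0 that by (intro sum.cong) auto
        then show ?thesis using sum_of_bool_eq[of j n] that q by simp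
      qed
      then show ?thesis by (auto simp: blk_def fun_eq_iff restrict_def)
    qed
    have e2: "gauss_mat p q = distr (gauss_mat p n) (gauss_mat p q) (\<lambda>K. restrict K ({..<p} \<times> {..<q}))"
    proof -
      interpret product_prob_space "\<lambda>_::nat \<times> nat. std_normal_distribution" "{..<p} \<times> {..<n}"
        by (intro product_prob_spaceI prob_space_std_normal)
      show ?thesis
        unfolding gauss_mat_def using q by (intro distr_restrict) auto
    qed
    have m: "(\<lambda>K. restrict K ({..<p} \<times> {..<q})) \<in> measurable (gauss_mat p n) (gauss_mat p q)"
      unfolding gauss_mat_def using q by (intro measurable_restrict_subset) auto
    have fm: "f \<in> borel_measurable (gauss_mat p q)"
      using f sets_mat_space measurable_cong_sets by blast
    show ?case
      unfolding L_def e1 by (subst e2) (rule nn_integral_distr[OF m, symmetric], simp add: fm)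
  next
    case (Suc k)
    define P where "P W \<longleftrightarrow> L (U(k := W)) = (\<integral>\<^sup>+X. f X \<partial>gauss_mat p q)" for W
    have k: "k < p" using Suc.prems(1) by simp
    have "P (U k)"
    proof (rule givens_elimination[OF q])
      show "P V" if "a < n" "b < n" "a \<noteq> b" "c\<^sup>2 + s\<^sup>2 = 1" "P (rot_rows a b c s V)" for a b c s V
        using that rotinv[OF k that(1-4)] by (simp add: P_def)
      show "P W" if W: "\<forall>k<n. \<forall>j<q. W k j = of_bool (k = j)" for W
        unfolding P_def
      proof (rule Suc.IH)
        have "(\<Sum>k<n. W k i * W k j) = of_bool (i = j)" if "i < q" "j < q" for i j
        proof -
          have "(\<Sum>k<n. W k i * W k j) = (\<Sum>k<n. of_bool (k = j) * of_bool (i = k))"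
            using W that by (intro sum.cong) auto
          then show ?thesis using that q by (simp add: sum_of_bool_eq del: sum.delta sum.delta')
        qed
        then have "orthonormal_cols n q W" by (simp add: orthonormal_cols_def)
        then show "orthonormal_cols n q ((U(k := W)) i)" if "i < p" for i
          using Suc.prems(2)[OF that] by simp
        show "\<forall>a<n. \<forall>j<q. (U(k := W)) i a j = of_bool (a = j)" if "k \<le> i" "i < p" for i
          using Suc.prems(3)[of i] that W by (cases "i = k") auto
      qed (use k in simp)
      show "orthonormal_cols n q (U k)" by (rule Suc.prems(2)[OF k])
    qed
    then show ?case by (simp add: P_def)
  qed
  show ?thesis
    using all[of p "\<lambda>_. V"] V by (simp add: L_def blk_def)
qed

section \<open>Coupling Haar blocks with Gaussian matrices\<close>

definition uncols :: "nat \<Rightarrow> nat \<Rightarrow> (nat \<Rightarrow> nat \<Rightarrow> real) \<Rightarrow> nat \<times> nat \<Rightarrow> real" where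
  "uncols p n c = (\<lambda>(i, m)\<in>{..<p} \<times> {..<n}. c m i)"

definition cols :: "(nat \<times> nat \<Rightarrow> real) \<Rightarrow> nat \<Rightarrow> nat \<Rightarrow> real" where
  "cols X j i = X (i, j)"

text \<open>Restriction to the q x q square turns a matrix of statistics, defined for all indices,
  into a point of \<open>mat_space q q\<close>, so that an equality of laws can be tested by one
  measurable function.\<close>

definition pack :: "nat \<Rightarrow> (nat \<Rightarrow> nat \<Rightarrow> real) \<Rightarrow> nat \<times> nat \<Rightarrow> real" where
  "pack q C = (\<lambda>(j, l)\<in>{..<q} \<times> {..<q}. C j l)"

lemma measurable_gcols_entry [measurable]: "m < n \<Longrightarrow> i < p \<Longrightarrow> (\<lambda>c. c m i) \<in> borel_measurable (gcols p n)"
  using gcols_component[OF _ gvec_all_moments] by (auto simp: all_moments_def)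

lemma measurable_mat_entry: "i < p \<Longrightarrow> j < q \<Longrightarrow> (\<lambda>X. X (i, j)) \<in> borel_measurable (mat_space p q)"
proof -
  assume "i < p" "j < q"
  then have "(\<lambda>X. X (i, j)) \<in> measurable (mat_space p q) lborel"
    unfolding mat_space_def by (intro measurable_component_singleton) auto
  then show ?thesis by simp
qed

lemma measurable_mat_spaceI:
  assumes "\<And>i j. i < p \<Longrightarrow> j < q \<Longrightarrow> (\<lambda>w. f w i j) \<in> borel_measurable M"
  shows "(\<lambda>w. \<lambda>(i, j)\<in>{..<p} \<times> {..<q}. f w i j) \<in> measurable M (mat_space p q)"
  unfolding mat_space_def
proof (rule measurable_restrict)
  fix ij assume "ij \<in> {..<p} \<times> {..<q}"
  then show "(\<lambda>w. case ij of (i, j) \<Rightarrow> f w i j) \<in> measurable M lborel"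
    using assms[of "fst ij" "snd ij"] by (auto simp: case_prod_beta)
qed

lemma measurable_uncols: "uncols p n \<in> measurable (gcols p n) (mat_space p n)"
  unfolding uncols_def by (intro measurable_mat_spaceI) measurable

lemma measurable_pack:
  assumes "\<And>j l. j < q \<Longrightarrow> l < q \<Longrightarrow> (\<lambda>w. C w j l) \<in> borel_measurable M"
  shows "(\<lambda>w. pack q (C w)) \<in> measurable M (mat_space q q)"
  unfolding pack_def using assms by (intro measurable_mat_spaceI)

lemma pack_cong: "(\<And>j l. j < q \<Longrightarrow> l < q \<Longrightarrow> C j l = D j l) \<Longrightarrow> pack q C = pack q D"
  by (auto simp: pack_def fun_eq_iff restrict_def)

lemma distr_uncols: "distr (gcols p n) (mat_space p n) (uncols p n) = gauss_mat p n"
proof -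
  let ?N = std_normal_distribution
  interpret P: product_sigma_finite "\<lambda>_::nat \<times> nat. ?N"
    by (intro product_sigma_finite.intro prob_space_imp_sigma_finite prob_space_std_normal)
  interpret Q: product_sigma_finite "\<lambda>_::nat. ?N"
    by (intro product_sigma_finite.intro prob_space_imp_sigma_finite prob_space_std_normal)
  interpret R: product_sigma_finite "\<lambda>_::nat. gvec p"
    by (intro product_sigma_finite.intro prob_space_imp_sigma_finite prob_space_gvec)
  show ?thesis
    unfolding gauss_mat_def
  proof (rule P.PiM_eqI)
    show "sets (distr (gcols p n) (mat_space p n) (uncols p n)) = sets (PiM ({..<p} \<times> {..<n}) (\<lambda>_. ?N))"
      using sets_mat_space[of p n] by (simp add: gauss_mat_def)
    fix A :: "nat \<times> nat \<Rightarrow> real set"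
    assume A: "\<And>i. i \<in> {..<p} \<times> {..<n} \<Longrightarrow> A i \<in> sets ?N"
    have s1: "PiE ({..<p} \<times> {..<n}) A \<in> sets (mat_space p n)"
      unfolding mat_space_def using A by (intro sets_PiM_I_finite) auto
    have s2: "PiE {..<p} (\<lambda>i. A (i, m)) \<in> sets (gvec p)" if "m < n" for m
      unfolding gvec_def using A that by (intro sets_PiM_I_finite) auto
    have "uncols p n -` PiE ({..<p} \<times> {..<n}) A \<inter> space (gcols p n) = PiE {..<n} (\<lambda>m. PiE {..<p} (\<lambda>i. A (i, m)))"
    proof (intro equalityI subsetI)
      fix c assume "c \<in> uncols p n -` PiE ({..<p} \<times> {..<n}) A \<inter> space (gcols p n)"
      then have c: "uncols p n c \<in> PiE ({..<p} \<times> {..<n}) A" "c \<in> ({..<n} \<rightarrow>\<^sub>E ({..<p} \<rightarrow>\<^sub>E UNIV))"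
        by (auto simp: gcols_def gvec_def space_PiM)
      have "c m i \<in> A (i, m)" if "m < n" "i < p" for m i
        using PiE_mem[OF c(1), of "(i, m)"] that by (simp add: uncols_def)
      then show "c \<in> PiE {..<n} (\<lambda>m. PiE {..<p} (\<lambda>i. A (i, m)))"
        using c(2) by (auto simp: PiE_iff)
    next
      fix c assume "c \<in> PiE {..<n} (\<lambda>m. PiE {..<p} (\<lambda>i. A (i, m)))"
      then show "c \<in> uncols p n -` PiE ({..<p} \<times> {..<n}) A \<inter> space (gcols p n)"
        by (auto simp: gcols_def gvec_def space_PiM PiE_iff uncols_def)
    qed
    then have "emeasure (distr (gcols p n) (mat_space p n) (uncols p n)) (PiE ({..<p} \<times> {..<n}) A)
      = emeasure (gcols p n) (PiE {..<n} (\<lambda>m. PiE {..<p} (\<lambda>i. A (i, m))))"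
      using s1 measurable_uncols by (simp add: emeasure_distr)
    also have "\<dots> = (\<Prod>m<n. emeasure (gvec p) (PiE {..<p} (\<lambda>i. A (i, m))))"
      unfolding gcols_def using s2 by (intro R.emeasure_PiM) auto
    also have "\<dots> = (\<Prod>m<n. \<Prod>i<p. emeasure ?N (A (i, m)))"
      unfolding gvec_def using A by (intro prod.cong refl Q.emeasure_PiM) auto
    also have "\<dots> = (\<Prod>i<p. \<Prod>m<n. emeasure ?N (A (i, m)))"
      by (rule prod.swap)
    also have "\<dots> = (\<Prod>i\<in>{..<p} \<times> {..<n}. emeasure ?N (A i))"
      by (simp add: prod.cartesian_product)
    finally show "emeasure (distr (gcols p n) (mat_space p n) (uncols p n)) (PiE ({..<p} \<times> {..<n}) A) = \<dots>" .
  qed simp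
qed

lemma nn_integral_gauss_mat:
  assumes "f \<in> borel_measurable (mat_space p n)"
  shows "(\<integral>\<^sup>+K. f K \<partial>gauss_mat p n) = (\<integral>\<^sup>+c. f (uncols p n c) \<partial>gcols p n)"
  unfolding distr_uncols[symmetric] using assms by (intro nn_integral_distr measurable_uncols) simp

definition scaled_cols :: "nat \<Rightarrow> (nat \<times> nat \<Rightarrow> real) \<Rightarrow> nat \<Rightarrow> nat \<Rightarrow> real" where
  "scaled_cols n G j i = sqrt (real n) * G (i, j)"

text \<open>The two factors sqrt n cancel the division by n and leave Z' K K' Z, where K has the
  columns \<open>c m\<close>: the form in which K K' can be exchanged with K' K.\<close>

lemma wish_scaled_cols:
  "n > 0 \<Longrightarrow> wish p n (scaled_cols n G) c j l = (\<Sum>m<n. (\<Sum>i<p. G (i, j) * c m i) * (\<Sum>i<p. G (i, l) * c m i))"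
proof -
  assume n: "n > 0"
  have "dot p (scaled_cols n G j) (c m) = sqrt n * (\<Sum>i<p. G (i, j) * c m i)" for m j
    by (simp add: dot_def scaled_cols_def sum_distrib_left mult_ac)
  then have "wish p n (scaled_cols n G) c j l = (\<Sum>m<n. n * ((\<Sum>i<p. G (i, j) * c m i) * (\<Sum>i<p. G (i, l) * c m i))) / n"
    unfolding wish_def by (intro arg_cong2[where f = "(/)"] sum.cong refl) (simp add: mult_ac flip: power2_eq_square)
  then show ?thesis using n by (simp flip: sum_distrib_left)
qed

text \<open>For a fixed Gaussian K, the matrices K' K and K K' padded with zeros are orthogonally similar, so
  left invariance of the Haar measure alone exchanges them. On one side this yields the Gram matrix
  of the columns of K G, which are Gaussian by rotation invariance in K; on the other side it yields
  the Wishart perturbation of the Haar block.\<close>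

lemma haar_coupling:
  assumes H: "haar_orthogonal n H" and n: "q < n" "p \<le> n" and F: "F \<in> borel_measurable (mat_space q q)"
  shows "(\<integral>\<^sup>+G. \<integral>\<^sup>+c. F (pack q (wish p n (scaled_cols n G) c)) \<partial>gcols p n \<partial>H) =
    (\<integral>\<^sup>+x. F (pack q (gram p x)) \<partial>gcols p q)"
proof -
  have n0: "n > 0" using n by simp
  interpret H: prob_space H using H by (simp add: haar_orthogonal_def)
  interpret HG: pair_sigma_finite H "gcols p n" ..
  have sH: "sets H = sets (mat_space n n)" using H by (simp add: haar_orthogonal_def)
  have spH: "space H = space (mat_space n n)" using sH by (rule sets_eq_imp_space_eq)
  have entry [measurable]: "(\<lambda>G. G (i, j)) \<in> borel_measurable H" if "i < n" "j < n" for i j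
    using measurable_mat_entry[OF that] sH measurable_cong_sets by blast
  define Psi where "Psi c G = F (pack q (\<lambda>j l. \<Sum>m<n. (\<Sum>i<p. G (i, j) * c m i) * (\<Sum>i<p. G (i, l) * c m i)))" for c and G :: "nat \<times> nat \<Rightarrow> real"
  define X where "X c G j i = (\<Sum>u<n. c u i * G (u, j))" for c and G :: "nat \<times> nat \<Rightarrow> real" and j i :: nat
  have pair1: "(\<lambda>w. F (pack q (\<lambda>j l. \<Sum>m<n. (\<Sum>i<p. fst w (i, j) * snd w m i) * (\<Sum>i<p. fst w (i, l) * snd w m i)))) \<in> borel_measurable (H \<Otimes>\<^sub>M gcols p n)"
  proof (rule measurable_compose[OF measurable_pack F])
    fix j l assume "j < q" "l < q"
    then have jl: "j < n" "l < n" using n by auto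
    show "(\<lambda>w. \<Sum>m<n. (\<Sum>i<p. fst w (i, j) * snd w m i) * (\<Sum>i<p. fst w (i, l) * snd w m i)) \<in> borel_measurable (H \<Otimes>\<^sub>M gcols p n)"
      using jl n
      by (intro borel_measurable_sum borel_measurable_times measurable_compose[OF measurable_fst entry]
          measurable_compose[OF measurable_snd measurable_gcols_entry]) auto
  qed
  have pair2: "(\<lambda>w. F (pack q (gram p (X (snd w) (fst w))))) \<in> borel_measurable (H \<Otimes>\<^sub>M gcols p n)"
  proof (rule measurable_compose[OF measurable_pack F])
    fix j l assume "j < q" "l < q"
    then have jl: "j < n" "l < n" using n by auto
    show "(\<lambda>w. gram p (X (snd w) (fst w)) j l) \<in> borel_measurable (H \<Otimes>\<^sub>M gcols p n)"
      unfolding gram_def dot_def X_def using jl n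
      by (intro borel_measurable_sum borel_measurable_times measurable_compose[OF measurable_fst entry]
          measurable_compose[OF measurable_snd measurable_gcols_entry]) auto
  qed
  have inner: "(\<integral>\<^sup>+G. Psi c G \<partial>H) = (\<integral>\<^sup>+G. F (pack q (gram p (X c G))) \<partial>H)" for c
  proof -
    \<comment> \<open>K padded with zero rows to a square matrix. The padding restricts the sums
      over u to the first p rows of \<open>G\<close>, that is, to the block.\<close>
    define B where "B u m = (if u < p then c m u else 0)" for u m
    obtain R where R: "R \<in> biorth n" and RB: "\<And>(G :: nat \<times> nat \<Rightarrow> real) j l.
      (\<Sum>m<n. (\<Sum>u<n. (\<Sum>a<n. R (u, a) * G (a, j)) * B u m) * (\<Sum>v<n. (\<Sum>a<n. R (v, a) * G (a, l)) * B v m)) =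
      (\<Sum>m<n. (\<Sum>u<n. B m u * G (u, j)) * (\<Sum>v<n. B m v * G (v, l)))"
      using gram_transpose_conj[of n B] by blast
    define R' where "R' = restrict R ({..<n} \<times> {..<n})"
    have "orthogonal_mat n R'"
      using R by (auto simp: orthogonal_mat_def R'_def biorth_def)
    then have inv: "distr H (mat_space n n) (mat_mult n R') = H"
      using H by (simp add: haar_orthogonal_def)
    have mm: "mat_mult n R' \<in> measurable H (mat_space n n)"
      unfolding mat_mult_def
      by (intro measurable_mat_spaceI borel_measurable_sum borel_measurable_times borel_measurable_const entry) auto
    have bsum: "(\<Sum>u<n. g u * B u m) = (\<Sum>u<p. g u * c m u)" for g :: "nat \<Rightarrow> real" and m
      using n by (intro sum.mono_neutral_cong_right) (auto simp: B_def)
    have Psi: "Psi c \<in> borel_measurable H"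
      unfolding Psi_def using n
      by (intro measurable_compose[OF measurable_pack F] borel_measurable_sum borel_measurable_times borel_measurable_const entry) auto
    then have Psi': "Psi c \<in> borel_measurable (mat_space n n)"
      using sH measurable_cong_sets by blast
    have "(\<integral>\<^sup>+G. Psi c G \<partial>H) = (\<integral>\<^sup>+G. Psi c (mat_mult n R' G) \<partial>H)"
      by (subst inv[symmetric], rule nn_integral_distr[OF mm]) (use Psi' in simp)
    also have "\<dots> = (\<integral>\<^sup>+G. F (pack q (gram p (X c G))) \<partial>H)"
    proof (rule nn_integral_cong)
      fix G
      have "(\<Sum>m<n. (\<Sum>i<p. mat_mult n R' G (i, j) * c m i) * (\<Sum>i<p. mat_mult n R' G (i, l) * c m i)) = gram p (X c G) j l"
        if "j < q" "l < q" for j l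
      proof -
        have mu: "mat_mult n R' G (u, j) = (\<Sum>a<n. R (u, a) * G (a, j))" if "u < n" "j < q" for u j
          using that n by (simp add: mat_mult_def R'_def)
        have "(\<Sum>m<n. (\<Sum>i<p. mat_mult n R' G (i, j) * c m i) * (\<Sum>i<p. mat_mult n R' G (i, l) * c m i)) =
          (\<Sum>m<n. (\<Sum>u<n. (\<Sum>a<n. R (u, a) * G (a, j)) * B u m) * (\<Sum>v<n. (\<Sum>a<n. R (v, a) * G (a, l)) * B v m))"
          unfolding bsum using that n by (intro sum.cong refl arg_cong2[where f = "(*)"]) (auto simp: mu)
        also have "\<dots> = (\<Sum>m<n. (\<Sum>u<n. B m u * G (u, j)) * (\<Sum>v<n. B m v * G (v, l)))"
          by (rule RB)
        also have "\<dots> = (\<Sum>m<p. X c G j m * X c G l m)"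
          using n by (intro sum.mono_neutral_cong_right) (auto simp: B_def X_def)
        finally show ?thesis by (simp add: gram_def dot_def)
      qed
      then show "Psi c (mat_mult n R' G) = F (pack q (gram p (X c G)))"
        unfolding Psi_def by (intro arg_cong[where f = F] pack_cong)
    qed
    finally show ?thesis .
  qed
  \<comment> \<open>For orthogonal \<open>G\<close> the product K G has Gaussian first q columns,
    whatever \<open>G\<close> is. The Givens reduction used here needs q < n.\<close>
  have orth: "(\<integral>\<^sup>+c. F (pack q (gram p (X c G))) \<partial>gcols p n) = (\<integral>\<^sup>+x. F (pack q (gram p x)) \<partial>gcols p q)"
    if G: "orthogonal_mat n G" for G
  proof -
    define f where "f Z = F (pack q (gram p (cols Z)))" for Z :: "nat \<times> nat \<Rightarrow> real"
    have fm: "f \<in> borel_measurable (mat_space p q)"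
      unfolding f_def gram_def dot_def cols_def
      by (intro measurable_compose[OF measurable_pack F] borel_measurable_sum borel_measurable_times measurable_mat_entry) auto
    define b where "b K = (\<lambda>(i, j)\<in>{..<p} \<times> {..<q}. \<Sum>a<n. K (i, a) * G (a, j))" for K :: "nat \<times> nat \<Rightarrow> real"
    have bm: "(\<lambda>K. f (b K)) \<in> borel_measurable (mat_space p n)"
      unfolding b_def
      by (intro measurable_compose[OF measurable_mat_spaceI fm] borel_measurable_sum borel_measurable_times
          borel_measurable_const measurable_mat_entry) auto
    have on: "orthonormal_cols n q (\<lambda>a j. G (a, j))"
      using G n by (auto simp: orthonormal_cols_def orthogonal_mat_def)
    have "(\<integral>\<^sup>+c. F (pack q (gram p (X c G))) \<partial>gcols p n) = (\<integral>\<^sup>+c. f (b (uncols p n c)) \<partial>gcols p n)"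
    proof (intro nn_integral_cong)
      fix c
      have "gram p (X c G) j l = gram p (cols (b (uncols p n c))) j l" if "j < q" "l < q" for j l
        using that by (simp add: gram_def dot_def X_def cols_def b_def uncols_def)
      then show "F (pack q (gram p (X c G))) = f (b (uncols p n c))"
        unfolding f_def by (intro arg_cong[where f = F] pack_cong)
    qed
    also have "\<dots> = (\<integral>\<^sup>+K. f (b K) \<partial>gauss_mat p n)"
      by (rule nn_integral_gauss_mat[OF bm, symmetric])
    also have "\<dots> = (\<integral>\<^sup>+Z. f Z \<partial>gauss_mat p q)"
      unfolding b_def by (rule gauss_mat_block_invariant[OF n(1) on fm])
    also have "\<dots> = (\<integral>\<^sup>+x. f (uncols p q x) \<partial>gcols p q)"
      by (rule nn_integral_gauss_mat[OF fm])
    also have "\<dots> = (\<integral>\<^sup>+x. F (pack q (gram p x)) \<partial>gcols p q)"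
      unfolding f_def
      by (intro nn_integral_cong arg_cong[where f = F] pack_cong) (simp add: gram_def dot_def cols_def uncols_def)
    finally show ?thesis .
  qed
  have "(\<integral>\<^sup>+G. \<integral>\<^sup>+c. F (pack q (wish p n (scaled_cols n G) c)) \<partial>gcols p n \<partial>H) = (\<integral>\<^sup>+G. \<integral>\<^sup>+c. Psi c G \<partial>gcols p n \<partial>H)"
    using n0 by (simp add: Psi_def wish_scaled_cols fun_eq_iff[of "wish _ _ _ _"] cong: pack_cong)
  also have "\<dots> = (\<integral>\<^sup>+c. \<integral>\<^sup>+G. Psi c G \<partial>H \<partial>gcols p n)"
    using pair1 by (intro HG.Fubini'[symmetric]) (simp add: Psi_def case_prod_beta)
  also have "\<dots> = (\<integral>\<^sup>+c. \<integral>\<^sup>+G. F (pack q (gram p (X c G))) \<partial>H \<partial>gcols p n)"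
    by (simp only: inner)
  also have "\<dots> = (\<integral>\<^sup>+G. \<integral>\<^sup>+c. F (pack q (gram p (X c G))) \<partial>gcols p n \<partial>H)"
    using pair2 by (intro HG.Fubini') (simp add: case_prod_beta)
  also have "\<dots> = (\<integral>\<^sup>+G. (\<integral>\<^sup>+x. F (pack q (gram p x)) \<partial>gcols p q) \<partial>H)"
  proof (rule nn_integral_cong_AE)
    \<comment> \<open>\<open>G\<close> is orthogonal only almost surely; on that set the inner
      integral does not depend on \<open>G\<close>.\<close>
    have "AE G in H. G \<in> {M \<in> space (mat_space n n). orthogonal_mat n M}"
      using H by (intro H.AE_prob_1) (simp add: haar_orthogonal_def)
    then show "AE G in H. (\<integral>\<^sup>+c. F (pack q (gram p (X c G))) \<partial>gcols p n) = (\<integral>\<^sup>+x. F (pack q (gram p x)) \<partial>gcols p q)"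
      by (rule eventually_mono) (simp add: orth)
  qed
  also have "\<dots> = (\<integral>\<^sup>+x. F (pack q (gram p x)) \<partial>gcols p q)"
    by (simp add: H.emeasure_space_1)
  finally show ?thesis .
qed

section \<open>Lower bound on the variation distance\<close>

lemma tr3_gram_nonneg: "0 \<le> tr3 q (gram p y) (gram p y) (gram p y)"
  unfolding tr_gram_comb_gram[symmetric] by (rule tr_gram_nonneg)

lemma measurable_stat:
  assumes "\<And>j l. j < q \<Longrightarrow> l < q \<Longrightarrow> (\<lambda>w. C w j l) \<in> borel_measurable M"
  shows "(\<lambda>w. stat q (C w)) \<in> borel_measurable M"
  unfolding stat_def off_def tr_def using assms
  by (intro borel_measurable_diff borel_measurable_times borel_measurable_const borel_measurable_sum borel_measurable_power) auto

lemma measurable_tr: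
  assumes "\<And>j l. j < q \<Longrightarrow> l < q \<Longrightarrow> (\<lambda>w. C w j l) \<in> borel_measurable M"
  shows "(\<lambda>w. tr q (C w)) \<in> borel_measurable M"
  unfolding tr_def using assms by (intro borel_measurable_sum) auto

lemma measurable_fro:
  assumes "\<And>j l. j < q \<Longrightarrow> l < q \<Longrightarrow> (\<lambda>w. C w j l) \<in> borel_measurable M"
  shows "(\<lambda>w. fro q (C w)) \<in> borel_measurable M"
  unfolding fro_def using assms by (intro borel_measurable_sum borel_measurable_power) auto

lemma measurable_tr3:
  assumes "\<And>j l. j < q \<Longrightarrow> l < q \<Longrightarrow> (\<lambda>w. C w j l) \<in> borel_measurable M"
  shows "(\<lambda>w. tr3 q (C w) (C w) (C w)) \<in> borel_measurable M"
  unfolding tr3_def using assms by (intro borel_measurable_sum borel_measurable_times) auto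

definition unpack :: "(nat \<times> nat \<Rightarrow> real) \<Rightarrow> nat \<Rightarrow> nat \<Rightarrow> real" where
  "unpack C j l = C (j, l)"

lemma unpack_pack [simp]:
  "stat q (unpack (pack q C)) = stat q C" "tr q (unpack (pack q C)) = tr q C"
  "fro q (unpack (pack q C)) = fro q C"
  "tr3 q (unpack (pack q C)) (unpack (pack q C)) (unpack (pack q C)) = tr3 q C C C"
  by (auto simp: stat_def off_def tr_def fro_def tr3_def unpack_def pack_def intro!: sum.cong)

lemma measurable_unpack: "j < q \<Longrightarrow> l < q \<Longrightarrow> (\<lambda>C. unpack C j l) \<in> borel_measurable (mat_space q q)"
  unfolding unpack_def by (rule measurable_mat_entry)

lemma (in prob_space) nn_Markov:
  fixes f :: "'a \<Rightarrow> real"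
  assumes [measurable]: "f \<in> borel_measurable M" and le: "(\<integral>\<^sup>+x. ennreal (f x) \<partial>M) \<le> ennreal e" and k: "k > 0" and e: "e \<ge> 0"
  shows "prob {x \<in> space M. k \<le> f x} \<le> e / k"
proof -
  have "ennreal k * emeasure M {x \<in> space M. k \<le> f x} = (\<integral>\<^sup>+x. ennreal k * indicator {x \<in> space M. k \<le> f x} x \<partial>M)"
    by (simp add: nn_integral_cmult_indicator)
  also have "\<dots> \<le> (\<integral>\<^sup>+x. ennreal (f x) \<partial>M)"
    by (intro nn_integral_mono) (auto split: split_indicator intro!: ennreal_leI)
  also have "\<dots> \<le> ennreal e" by (rule le)
  finally have "ennreal (k * prob {x \<in> space M. k \<le> f x}) \<le> ennreal e"
    using k by (simp add: emeasure_eq_measure ennreal_mult)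
  then show ?thesis using k e by (simp add: ennreal_le_iff field_simps)
qed

lemma gcols_tr_moments: "all_moments (gcols p q) (\<lambda>x. tr q (gram p x))"
  unfolding tr_def by (intro gcols.moment_intros gcols_gram_moments) auto

lemma gcols_fro_moments: "all_moments (gcols p q) (\<lambda>x. fro q (gram p x))"
  unfolding fro_def by (intro gcols.moment_intros gcols_gram_moments) auto

lemma gcols_tr3_moments: "all_moments (gcols p q) (\<lambda>x. tr3 q (gram p x) (gram p x) (gram p x))"
  unfolding tr3_def by (intro gcols.moment_intros gcols_gram_moments) auto

text \<open>The bound of \<open>conditional_shift\<close> with the squared Frobenius norm, the trace
  and the trace of the cube replaced by truncation levels k1, k2 and k3.\<close>

definition shift_error :: "nat \<Rightarrow> nat \<Rightarrow> real \<Rightarrow> real \<Rightarrow> real \<Rightarrow> real \<Rightarrow> real" where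
  "shift_error n q \<eta> k1 k2 k3 = 24 * (2 * sqrt k1 * k3 + (real q - 1)\<^sup>2 * k1) / (real n * \<eta>\<^sup>2)
      + 8 * k1 * k2\<^sup>2 / ((real n)\<^sup>2 * \<eta>\<^sup>2) + 3 * k1 / (real n * \<eta>)"

section \<open>Tail bounds for the Haar and the coupled Gram matrices\<close>

context
  fixes n p q :: nat and H :: "(nat \<times> nat \<Rightarrow> real) measure"
  assumes H: "haar_orthogonal n H" and qn: "q < n" and pn: "p \<le> n"
begin

abbreviation "haar_gram G \<equiv> gram p (scaled_cols n G)"
abbreviation "coupled_gram w \<equiv> wish p n (scaled_cols n (fst w)) (snd w)"
abbreviation "coupling_space \<equiv> H \<Otimes>\<^sub>M gcols p n"

interpretation H: prob_space H using H by (simp add: haar_orthogonal_def)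
interpretation HG: pair_prob_space H "gcols p n" ..

lemma haar_entry: "i < n \<Longrightarrow> j < n \<Longrightarrow> (\<lambda>G. G (i, j)) \<in> borel_measurable H"
proof -
  assume "i < n" "j < n"
  moreover have "sets H = sets (mat_space n n)" using H by (simp add: haar_orthogonal_def)
  ultimately show ?thesis using measurable_mat_entry[of i n j n] measurable_cong_sets[of H "mat_space n n" borel borel] by simp
qed

lemma measurable_haar_gram: "j < q \<Longrightarrow> l < q \<Longrightarrow> (\<lambda>G. haar_gram G j l) \<in> borel_measurable H"
  unfolding gram_def dot_def scaled_cols_def using qn pn
  by (intro borel_measurable_sum borel_measurable_times borel_measurable_const haar_entry) auto

lemma measurable_coupled_gram: "j < q \<Longrightarrow> l < q \<Longrightarrow> (\<lambda>w. coupled_gram w j l) \<in> borel_measurable coupling_space"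
  unfolding wish_def dot_def scaled_cols_def using qn pn
  by (intro borel_measurable_sum borel_measurable_times borel_measurable_const borel_measurable_divide
      measurable_compose[OF measurable_fst haar_entry] measurable_compose[OF measurable_snd measurable_gcols_entry]) auto

lemma measurable_gram_cols: "j < q \<Longrightarrow> l < q \<Longrightarrow> (\<lambda>x. gram p x j l) \<in> borel_measurable (gcols p q)"
  using gcols_gram_moments by (auto simp: all_moments_def)

lemma coupling_prob:
  assumes Q: "{D \<in> space (mat_space q q). Q D} \<in> sets (mat_space q q)"
  shows "measure coupling_space {w \<in> space coupling_space. Q (pack q (coupled_gram w))} = gcols.prob p q {x \<in> space (gcols p q). Q (pack q (gram p x))}"
proof -
  define F where "F = (indicator {D \<in> space (mat_space q q). Q D} :: _ \<Rightarrow> ennreal)"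
  have F: "F \<in> borel_measurable (mat_space q q)" unfolding F_def using Q by simp
  have mV: "(\<lambda>w. pack q (coupled_gram w)) \<in> measurable coupling_space (mat_space q q)"
    by (intro measurable_pack measurable_coupled_gram)
  have mX: "(\<lambda>x. pack q (gram p x)) \<in> measurable (gcols p q) (mat_space q q)"
    by (intro measurable_pack measurable_gram_cols)
  define SV where "SV = {w \<in> space coupling_space. Q (pack q (coupled_gram w))}"
  define SX where "SX = {x \<in> space (gcols p q). Q (pack q (gram p x))}"
  have "SV = (\<lambda>w. pack q (coupled_gram w)) -` {D \<in> space (mat_space q q). Q D} \<inter> space coupling_space"
    using measurable_space[OF mV] by (auto simp: SV_def)
  then have sV: "SV \<in> sets coupling_space" using measurable_sets[OF mV Q] by simp
  have "SX = (\<lambda>x. pack q (gram p x)) -` {D \<in> space (mat_space q q). Q D} \<inter> space (gcols p q)"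
    using measurable_space[OF mX] by (auto simp: SX_def)
  then have sX: "SX \<in> sets (gcols p q)" using measurable_sets[OF mX Q] by simp
  have "emeasure coupling_space SV = (\<integral>\<^sup>+w. indicator SV w \<partial>coupling_space)"
    using sV by simp
  also have "\<dots> = (\<integral>\<^sup>+w. F (pack q (coupled_gram w)) \<partial>coupling_space)"
    using measurable_space[OF mV] by (intro nn_integral_cong) (simp add: SV_def F_def indicator_def)
  also have "\<dots> = (\<integral>\<^sup>+G. \<integral>\<^sup>+c. F (pack q (coupled_gram (G, c))) \<partial>gcols p n \<partial>H)"
    using measurable_compose[OF mV F] by (rule gcols.nn_integral_fst[symmetric])
  also have "\<dots> = (\<integral>\<^sup>+x. F (pack q (gram p x)) \<partial>gcols p q)"
    using haar_coupling[OF H qn pn F] by simp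
  also have "\<dots> = (\<integral>\<^sup>+x. indicator SX x \<partial>gcols p q)"
    using measurable_space[OF mX] by (intro nn_integral_cong) (simp add: SX_def F_def indicator_def)
  also have "\<dots> = emeasure (gcols p q) SX"
    using sX by simp
  finally show ?thesis by (simp add: measure_def SV_def SX_def)
qed

text \<open>Jensen given the block, then the coupling: a convex functional has a Haar mean of at
  most its Gaussian mean. Nonnegative integrals make integrability under the Haar law part of the
  conclusion rather than something to establish first.\<close>

lemma haar_mean_le:
  fixes \<phi> :: "(nat \<Rightarrow> nat \<Rightarrow> real) \<Rightarrow> real"
  assumes jensen: "\<And>y. \<phi> (gram p y) \<le> gcols.expectation p n (\<lambda>c. \<phi> (wish p n y c))"
    and int: "\<And>y. integrable (gcols p n) (\<lambda>c. \<phi> (wish p n y c))"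
    and meas: "(\<lambda>D. \<phi> (unpack D)) \<in> borel_measurable (mat_space q q)"
    and pk: "\<And>D. \<phi> (unpack (pack q D)) = \<phi> D"
    and intX: "integrable (gcols p q) (\<lambda>x. \<phi> (gram p x))" and nonneg: "\<And>y. 0 \<le> \<phi> (gram p y)"
    and le: "gcols.expectation p q (\<lambda>x. \<phi> (gram p x)) \<le> e"
  shows "(\<integral>\<^sup>+G. ennreal (\<phi> (haar_gram G)) \<partial>H) \<le> ennreal e"
proof -
  have "(\<integral>\<^sup>+G. ennreal (\<phi> (haar_gram G)) \<partial>H) \<le> (\<integral>\<^sup>+G. \<integral>\<^sup>+c. ennreal (\<phi> (wish p n (scaled_cols n G) c)) \<partial>gcols p n \<partial>H)"
  proof (rule nn_integral_mono)
    fix G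
    show "ennreal (\<phi> (haar_gram G)) \<le> (\<integral>\<^sup>+c. ennreal (\<phi> (wish p n (scaled_cols n G) c)) \<partial>gcols p n)"
      using ennreal_leI[OF jensen] ennreal_integral_le[OF int] by (rule order_trans)
  qed
  also have "\<dots> = (\<integral>\<^sup>+x. ennreal (\<phi> (gram p x)) \<partial>gcols p q)"
    using haar_coupling[OF H qn pn, of "\<lambda>D. ennreal (\<phi> (unpack D))"] meas by (simp add: pk)
  also have "\<dots> = ennreal (gcols.expectation p q (\<lambda>x. \<phi> (gram p x)))"
    using intX nonneg by (intro nn_integral_eq_integral) auto
  also have "\<dots> \<le> ennreal e" by (rule ennreal_leI[OF le])
  finally show ?thesis .
qed

lemma haar_tr_tail:
  assumes "k > 0"
  shows "H.prob {G \<in> space H. k \<le> tr q (haar_gram G)} \<le> real p * real q / k"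
proof (rule H.nn_Markov[OF measurable_tr[OF measurable_haar_gram] haar_mean_le assms])
  show "tr q (gram p y) \<le> gcols.expectation p n (\<lambda>c. tr q (wish p n y c))" for y
    using qn by (simp add: tr_wish_mean)
  show "integrable (gcols p n) (\<lambda>c. tr q (wish p n y c))" for y
    by (rule all_moments_integrable[OF tr_wish_moments])
  show "(\<lambda>D. tr q (unpack D)) \<in> borel_measurable (mat_space q q)"
    by (rule measurable_tr[OF measurable_unpack])
  show "integrable (gcols p q) (\<lambda>x. tr q (gram p x))"
    by (rule all_moments_integrable[OF gcols_tr_moments])
qed (simp_all add: tr_gram_nonneg gcols_tr_mean)

lemma haar_fro_tail:
  assumes "k > 0"
  shows "H.prob {G \<in> space H. k \<le> fro q (haar_gram G)} \<le> ((real q)\<^sup>2 * p + q * ((real p)\<^sup>2 + 2 * p)) / k"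
proof (rule H.nn_Markov[OF measurable_fro[OF measurable_haar_gram] haar_mean_le assms])
  show "fro q (gram p y) \<le> gcols.expectation p n (\<lambda>c. fro q (wish p n y c))" for y
    using qn by (intro fro_wish_mean_ge) simp
  show "integrable (gcols p n) (\<lambda>c. fro q (wish p n y c))" for y
    by (rule all_moments_integrable[OF fro_wish_moments])
  show "(\<lambda>D. fro q (unpack D)) \<in> borel_measurable (mat_space q q)"
    by (rule measurable_fro[OF measurable_unpack])
  show "integrable (gcols p q) (\<lambda>x. fro q (gram p x))"
    by (rule all_moments_integrable[OF gcols_fro_moments])
  show "gcols.expectation p q (\<lambda>x. fro q (gram p x)) \<le> (real q)\<^sup>2 * p + q * ((real p)\<^sup>2 + 2 * p)"
    using gcols_fro_mean[of p q] by simp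
qed (simp_all add: fro_nonneg)

lemma haar_tr3_tail:
  assumes "k > 0"
  shows "H.prob {G \<in> space H. k \<le> tr3 q (haar_gram G) (haar_gram G) (haar_gram G)} \<le>
    (real q ^ 3 * p + 3 * (real q)\<^sup>2 * ((real p)\<^sup>2 + 2 * p) + q * (15 * real p ^ 3)) / k"
proof (rule H.nn_Markov[OF measurable_tr3[OF measurable_haar_gram] haar_mean_le[where \<phi> = "\<lambda>D. tr3 q D D D"] assms])
  show "tr3 q (gram p y) (gram p y) (gram p y) \<le> gcols.expectation p n (\<lambda>c. tr3 q (wish p n y c) (wish p n y c) (wish p n y c))" for y
    using qn by (intro tr3_wish_mean_ge) simp
  show "integrable (gcols p n) (\<lambda>c. tr3 q (wish p n y c) (wish p n y c) (wish p n y c))" for y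
    by (rule all_moments_integrable[OF tr3_wish_moments])
  show "(\<lambda>D. tr3 q (unpack D) (unpack D) (unpack D)) \<in> borel_measurable (mat_space q q)"
    by (rule measurable_tr3[OF measurable_unpack])
  show "integrable (gcols p q) (\<lambda>x. tr3 q (gram p x) (gram p x) (gram p x))"
    by (rule all_moments_integrable[OF gcols_tr3_moments])
  show "gcols.expectation p q (\<lambda>x. tr3 q (gram p x) (gram p x) (gram p x)) \<le>
      real q ^ 3 * p + 3 * (real q)\<^sup>2 * ((real p)\<^sup>2 + 2 * p) + q * (15 * real p ^ 3)"
    using gcols_tr3_mean[of p q] by simp
qed (simp_all add: tr3_gram_nonneg)

text \<open>The coupled Gram matrix has exactly the Gaussian law, so Chebyshev applies with the
  exact variance. The lower tail suffices because the squared trace enters a lower bound on the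
  shift.\<close>

lemma coupled_tr_tail:
  assumes "\<eta> > 0"
  shows "measure coupling_space {w \<in> space coupling_space. tr q (coupled_gram w) \<le> real p * real q - \<eta>} \<le> 2 * real p * real q / \<eta>\<^sup>2"
proof -
  have "measure coupling_space {w \<in> space coupling_space. tr q (unpack (pack q (coupled_gram w))) \<le> real p * real q - \<eta>} =
    gcols.prob p q {x \<in> space (gcols p q). tr q (unpack (pack q (gram p x))) \<le> real p * real q - \<eta>}"
  proof (rule coupling_prob)
    have [measurable]: "(\<lambda>D. tr q (unpack D)) \<in> borel_measurable (mat_space q q)"
      by (rule measurable_tr[OF measurable_unpack])
    show "{D \<in> space (mat_space q q). tr q (unpack D) \<le> real p * real q - \<eta>} \<in> sets (mat_space q q)"
      by measurable
  qed
  also have "\<dots> \<le> gcols.prob p q {x \<in> space (gcols p q). \<eta>\<^sup>2 \<le> (tr q (gram p x) - real p * real q)\<^sup>2}"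
  proof (rule gcols.finite_measure_mono)
    show "{x \<in> space (gcols p q). tr q (unpack (pack q (gram p x))) \<le> real p * real q - \<eta>}
      \<subseteq> {x \<in> space (gcols p q). \<eta>\<^sup>2 \<le> (tr q (gram p x) - real p * real q)\<^sup>2}"
      using assms by (auto intro!: abs_le_square_iff[THEN iffD1])
    show "{x \<in> space (gcols p q). \<eta>\<^sup>2 \<le> (tr q (gram p x) - real p * real q)\<^sup>2} \<in> sets (gcols p q)"
      using all_moments_measurable[OF gcols_tr_moments[of p q]] by measurable
  qed
  also have "\<dots> \<le> 2 * real p * real q / \<eta>\<^sup>2"
  proof (rule gcols.Markov_all_moments)
    show "all_moments (gcols p q) (\<lambda>x. (tr q (gram p x) - real p * real q)\<^sup>2)"
      by (intro gcols.moment_intros gcols_tr_moments)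
  qed (use assms in \<open>simp_all add: gcols_tr_variance\<close>)
  finally show ?thesis by simp
qed

lemma coupled_fro_tail:
  assumes "k > 0"
  shows "measure coupling_space {w \<in> space coupling_space. k \<le> fro q (coupled_gram w)} \<le> ((real q)\<^sup>2 * p + q * ((real p)\<^sup>2 + 2 * p)) / k"
proof -
  have "measure coupling_space {w \<in> space coupling_space. k \<le> fro q (unpack (pack q (coupled_gram w)))} =
    gcols.prob p q {x \<in> space (gcols p q). k \<le> fro q (unpack (pack q (gram p x)))}"
  proof (rule coupling_prob)
    have [measurable]: "(\<lambda>D. fro q (unpack D)) \<in> borel_measurable (mat_space q q)"
      by (rule measurable_fro[OF measurable_unpack])
    show "{D \<in> space (mat_space q q). k \<le> fro q (unpack D)} \<in> sets (mat_space q q)"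
      by measurable
  qed
  also have "\<dots> \<le> ((real q)\<^sup>2 * p + q * ((real p)\<^sup>2 + 2 * p)) / k"
    unfolding unpack_pack
  proof (rule gcols.Markov_all_moments)
    show "all_moments (gcols p q) (\<lambda>x. fro q (gram p x))" by (rule gcols_fro_moments)
    show "gcols.expectation p q (\<lambda>x. fro q (gram p x)) \<le> (real q)\<^sup>2 * p + q * ((real p)\<^sup>2 + 2 * p)"
      using gcols_fro_mean[of p q] by simp
  qed (use assms in \<open>simp_all add: fro_nonneg\<close>)
  finally show ?thesis by simp
qed

lemma measurable_coupling_space:
  "(\<lambda>w. fro q (haar_gram (fst w))) \<in> borel_measurable coupling_space" "(\<lambda>w. tr q (haar_gram (fst w))) \<in> borel_measurable coupling_space"
  "(\<lambda>w. tr3 q (haar_gram (fst w)) (haar_gram (fst w)) (haar_gram (fst w))) \<in> borel_measurable coupling_space" "(\<lambda>w. stat q (haar_gram (fst w))) \<in> borel_measurable coupling_space"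
  "(\<lambda>w. fro q (coupled_gram w)) \<in> borel_measurable coupling_space" "(\<lambda>w. tr q (coupled_gram w)) \<in> borel_measurable coupling_space" "(\<lambda>w. stat q (coupled_gram w)) \<in> borel_measurable coupling_space"
proof -
  have CV: "(\<lambda>w. haar_gram (fst w) j l) \<in> borel_measurable coupling_space" if "j < q" "l < q" for j l
    using measurable_compose[OF measurable_fst measurable_haar_gram[OF that]] .
  show "(\<lambda>w. fro q (haar_gram (fst w))) \<in> borel_measurable coupling_space" by (rule measurable_fro[OF CV])
  show "(\<lambda>w. tr q (haar_gram (fst w))) \<in> borel_measurable coupling_space" by (rule measurable_tr[OF CV])
  show "(\<lambda>w. tr3 q (haar_gram (fst w)) (haar_gram (fst w)) (haar_gram (fst w))) \<in> borel_measurable coupling_space" by (rule measurable_tr3[OF CV])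
  show "(\<lambda>w. stat q (haar_gram (fst w))) \<in> borel_measurable coupling_space" by (rule measurable_stat[OF CV])
  show "(\<lambda>w. fro q (coupled_gram w)) \<in> borel_measurable coupling_space" by (rule measurable_fro[OF measurable_coupled_gram])
  show "(\<lambda>w. tr q (coupled_gram w)) \<in> borel_measurable coupling_space" by (rule measurable_tr[OF measurable_coupled_gram])
  show "(\<lambda>w. stat q (coupled_gram w)) \<in> borel_measurable coupling_space" by (rule measurable_stat[OF measurable_coupled_gram])
qed

text \<open>Fubini over \<open>G\<close>: the slice of an atypical \<open>G\<close> is empty, and
  for a typical one the conditional bound increases with the three functionals of C, so the
  truncation levels replace them by constants.\<close>

lemma conditional_shift_error:
  assumes \<eta>: "\<eta> > 0" and k: "k1 > 0" "k2 > 0" "k3 > 0"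
  shows "measure coupling_space {w \<in> space coupling_space. fro q (haar_gram (fst w)) < k1 \<and> tr q (haar_gram (fst w)) < k2 \<and> tr3 q (haar_gram (fst w)) (haar_gram (fst w)) (haar_gram (fst w)) < k3
     \<and> stat q (coupled_gram w) - stat q (haar_gram (fst w)) < (tr q (coupled_gram w))\<^sup>2 / n - (fro q (coupled_gram w) + fro q (haar_gram (fst w))) / n - 3 * \<eta>}
    \<le> shift_error n q \<eta> k1 k2 k3" (is "measure coupling_space ?A \<le> ?e")
proof -
  have n: "n > 0" using qn by simp
  define r where "r = (real q - 1)\<^sup>2"
  have r: "0 \<le> r" by (simp add: r_def)
  have e: "0 \<le> ?e"
    using \<eta> k by (simp add: shift_error_def)
  have A: "?A \<in> sets coupling_space"
  proof -
    define a1 a2 a3 a4 b1 b2 b3 where "a1 w = fro q (haar_gram (fst w))" and "a2 w = tr q (haar_gram (fst w))"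
      and "a3 w = tr3 q (haar_gram (fst w)) (haar_gram (fst w)) (haar_gram (fst w))" and "a4 w = stat q (haar_gram (fst w))"
      and "b1 w = stat q (coupled_gram w)" and "b2 w = tr q (coupled_gram w)" and "b3 w = fro q (coupled_gram w)"
      for w :: "(nat \<times> nat \<Rightarrow> real) \<times> (nat \<Rightarrow> nat \<Rightarrow> real)"
    have [measurable]: "a1 \<in> borel_measurable coupling_space" "a2 \<in> borel_measurable coupling_space" "a3 \<in> borel_measurable coupling_space"
      "a4 \<in> borel_measurable coupling_space" "b1 \<in> borel_measurable coupling_space" "b2 \<in> borel_measurable coupling_space" "b3 \<in> borel_measurable coupling_space"
      unfolding a1_def a2_def a3_def a4_def b1_def b2_def b3_def by (rule measurable_coupling_space)+
    have "{w \<in> space coupling_space. a1 w < k1 \<and> a2 w < k2 \<and> a3 w < k3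
       \<and> b1 w - a4 w < (b2 w)\<^sup>2 / n - (b3 w + a1 w) / n - 3 * \<eta>} \<in> sets coupling_space"
      by measurable
    then show ?thesis unfolding a1_def a2_def a3_def a4_def b1_def b2_def b3_def .
  qed
  have "emeasure coupling_space ?A = (\<integral>\<^sup>+G. emeasure (gcols p n) (Pair G -` ?A) \<partial>H)"
    by (rule gcols.emeasure_pair_measure_alt[OF A])
  also have "\<dots> \<le> (\<integral>\<^sup>+G. ennreal ?e \<partial>H)"
  proof (rule nn_integral_mono)
    fix G assume G: "G \<in> space H"
    let ?C = "haar_gram G"
    show "emeasure (gcols p n) (Pair G -` ?A) \<le> ennreal ?e"
    proof (cases "fro q ?C < k1 \<and> tr q ?C < k2 \<and> tr3 q ?C ?C ?C < k3")
      case False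
      then have e: "Pair G -` ?A = {}" by auto
      show ?thesis unfolding e by simp
    next
      case True
      have "Pair G -` ?A = {c \<in> space (gcols p n). stat q (wish p n (scaled_cols n G) c) - stat q ?C
        < (tr q (wish p n (scaled_cols n G) c))\<^sup>2 / n - (fro q (wish p n (scaled_cols n G) c) + fro q ?C) / n - 3 * \<eta>}"
        using G True by (auto simp: space_pair_measure)
      then have "gcols.prob p n (Pair G -` ?A) \<le> 24 * (2 * sqrt (fro q ?C) * tr3 q ?C ?C ?C + (real q - 1)\<^sup>2 * fro q ?C) / (n * \<eta>\<^sup>2)
          + 8 * fro q ?C * (tr q ?C)\<^sup>2 / ((real n)\<^sup>2 * \<eta>\<^sup>2) + 3 * fro q ?C / (n * \<eta>)"
        using conditional_shift[OF n \<eta>, where p = p and q = q and y = "scaled_cols n G"] by simp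
      also have "\<dots> \<le> ?e"
        unfolding shift_error_def r_def[symmetric] using True \<eta> k r
        by (intro add_mono divide_right_mono mult_mono power_mono mult_nonneg_nonneg add_nonneg_nonneg)
          (auto simp: fro_nonneg tr_gram_nonneg tr3_gram_nonneg)
      finally show ?thesis by (simp add: gcols.emeasure_eq_measure ennreal_leI)
    qed
  qed
  also have "\<dots> = ennreal ?e" by (simp add: H.emeasure_space_1)
  finally show ?thesis using e by (simp add: measure_def enn2real_leI)
qed

lemma stat_cong: "(\<And>j l. j < q \<Longrightarrow> l < q \<Longrightarrow> D j l = E j l) \<Longrightarrow> stat q D = stat q E"
  using pack_cong[of q D E] unpack_pack(1)[of q D] unpack_pack(1)[of q E] by simp

lemma measure_fst:
  assumes "{G \<in> space H. Q G} \<in> sets H"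
  shows "measure coupling_space {w \<in> space coupling_space. Q (fst w)} = H.prob {G \<in> space H. Q G}"
proof -
  have "{w \<in> space coupling_space. Q (fst w)} = {G \<in> space H. Q G} \<times> space (gcols p n)"
    by (auto simp: space_pair_measure)
  then have "emeasure coupling_space {w \<in> space coupling_space. Q (fst w)} = emeasure H {G \<in> space H. Q G} * emeasure (gcols p n) (space (gcols p n))"
    using gcols.emeasure_pair_measure_Times[OF assms, of "space (gcols p n)"] by simp
  then show ?thesis by (simp add: gcols.emeasure_space_1 measure_def)
qed

section \<open>From the statistic to an event for matrices\<close>

definition event :: "real \<Rightarrow> (nat \<times> nat \<Rightarrow> real) set" where
  "event \<tau> = {Z \<in> space (mat_space p q). stat q (gram p (cols Z)) \<le> \<tau>}"

lemma event_sets: "event \<tau> \<in> sets (mat_space p q)"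
proof -
  define f where "f Z = stat q (gram p (cols Z))" for Z
  have ent: "(\<lambda>Z. gram p (cols Z) j l) \<in> borel_measurable (mat_space p q)" if "j < q" "l < q" for j l
    unfolding gram_def dot_def cols_def using that
    by (intro borel_measurable_sum borel_measurable_times measurable_mat_entry) auto
  have [measurable]: "f \<in> borel_measurable (mat_space p q)"
    unfolding f_def by (rule measurable_stat[OF ent])
  have "{Z \<in> space (mat_space p q). f Z \<le> \<tau>} \<in> sets (mat_space p q)" by measurable
  then show ?thesis by (simp add: event_def f_def)
qed

lemma scaled_block_map_measurable:
  "(\<lambda>M. \<lambda>(i, j)\<in>{..<p} \<times> {..<q}. sqrt (real n) * M (i, j)) \<in> measurable H (mat_space p q)"
  using qn pn by (intro measurable_mat_spaceI borel_measurable_times borel_measurable_const haar_entry) auto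

lemma measure_block_event:
  "measure (scaled_block_law n p q H) (event \<tau>) = H.prob {G \<in> space H. stat q (haar_gram G) \<le> \<tau>}"
proof -
  let ?f = "\<lambda>M. \<lambda>(i, j)\<in>{..<p} \<times> {..<q}. sqrt (real n) * M (i, j)"
  have st: "stat q (gram p (cols (?f G))) = stat q (haar_gram G)" for G
    by (intro stat_cong) (simp add: gram_def dot_def cols_def scaled_cols_def)
  have "?f -` event \<tau> \<inter> space H = {G \<in> space H. stat q (haar_gram G) \<le> \<tau>}"
    using measurable_space[OF scaled_block_map_measurable] st by (auto simp: event_def)
  then show ?thesis
    unfolding scaled_block_law_def using measure_distr[OF scaled_block_map_measurable event_sets] by simp
qed

lemma measure_gauss_event:
  "measure (gauss_mat p q) (event \<tau>) = gcols.prob p q {x \<in> space (gcols p q). stat q (gram p x) \<le> \<tau>}"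
proof -
  have st: "stat q (gram p (cols (uncols p q x))) = stat q (gram p x)" for x
    by (intro stat_cong) (simp add: gram_def dot_def cols_def uncols_def)
  have sp: "uncols p q x \<in> space (mat_space p q)" if "x \<in> space (gcols p q)" for x
    by (rule measurable_space[OF measurable_uncols that])
  have "uncols p q -` event \<tau> \<inter> space (gcols p q) = {x \<in> space (gcols p q). stat q (gram p x) \<le> \<tau>}"
    using sp by (auto simp: event_def st)
  moreover have "measure (gauss_mat p q) (event \<tau>) = gcols.prob p q (uncols p q -` event \<tau> \<inter> space (gcols p q))"
    by (subst distr_uncols[symmetric]) (rule measure_distr[OF measurable_uncols event_sets])
  ultimately show ?thesis by simp
qed

lemma var_dist_event:
  "2 * (measure (scaled_block_law n p q H) (event \<tau>) - measure (gauss_mat p q) (event \<tau>))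
    \<le> var_dist (scaled_block_law n p q H) (gauss_mat p q)"
proof -
  let ?\<mu> = "scaled_block_law n p q H" and ?\<nu> = "gauss_mat p q"
  interpret M: prob_space ?\<mu>
    unfolding scaled_block_law_def by (rule H.prob_space_distr[OF scaled_block_map_measurable])
  interpret N: prob_space ?\<nu>
    unfolding gauss_mat_def by (intro prob_space_PiM prob_space_std_normal)
  have "\<bar>a - b\<bar> \<le> 1" if "0 \<le> a" "a \<le> 1" "0 \<le> b" "b \<le> 1" for a b :: real
    using that by (simp add: abs_le_iff)
  from this[OF measure_nonneg M.prob_le_1 measure_nonneg N.prob_le_1]
  have bdd: "bdd_above ((\<lambda>A. \<bar>measure ?\<mu> A - measure ?\<nu> A\<bar>) ` sets ?\<mu>)"
    by (rule bdd_aboveI2)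
  have ev: "event \<tau> \<in> sets ?\<mu>"
    unfolding scaled_block_law_def sets_distr by (rule event_sets)
  have "\<bar>measure ?\<mu> (event \<tau>) - measure ?\<nu> (event \<tau>)\<bar> \<le> (SUP A\<in>sets ?\<mu>. \<bar>measure ?\<mu> A - measure ?\<nu> A\<bar>)"
    by (rule cSUP_upper[OF ev bdd])
  moreover have "2 * (a - b) \<le> 2 * s" if "\<bar>a - b\<bar> \<le> s" for a b s :: real
    using that by (simp add: abs_le_iff)
  ultimately show ?thesis unfolding var_dist_def by (simp only:)
qed

text \<open>The truncation levels k1, k2 and k3 restrict to Haar blocks whose Gram matrix is typical.\<close>

lemma coupled_union_bound:
  fixes \<eta> k1 k2 k3 :: real
  assumes \<eta>: "\<eta> > 0" "\<eta> \<le> real p * real q" and k: "k1 > 0" "k2 > 0" "k3 > 0" "k1 \<le> n * \<eta>"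
  defines "d \<equiv> (real p * real q - \<eta>)\<^sup>2 / n - 5 * \<eta>"
    and "e2 \<equiv> (real q)\<^sup>2 * p + q * ((real p)\<^sup>2 + 2 * p)"
    and "e3 \<equiv> real q ^ 3 * p + 3 * (real q)\<^sup>2 * ((real p)\<^sup>2 + 2 * p) + q * (15 * real p ^ 3)"
  shows "gcols.prob p q {x \<in> space (gcols p q). stat q (gram p x) \<le> \<tau> + d}
    \<le> H.prob {G \<in> space H. stat q (haar_gram G) \<le> \<tau>} + shift_error n q \<eta> k1 k2 k3
      + e2 / k1 + real p * real q / k2 + e3 / k3 + 2 * real p * real q / \<eta>\<^sup>2 + e2 / (n * \<eta>)"
proof -
  have n: "real n > 0" using qn by simp
  have CH: "(\<lambda>G. fro q (haar_gram G)) \<in> borel_measurable H" "(\<lambda>G. tr q (haar_gram G)) \<in> borel_measurable H"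
    "(\<lambda>G. tr3 q (haar_gram G) (haar_gram G) (haar_gram G)) \<in> borel_measurable H" "(\<lambda>G. stat q (haar_gram G)) \<in> borel_measurable H"
    by (rule measurable_fro[OF measurable_haar_gram] measurable_tr[OF measurable_haar_gram] measurable_tr3[OF measurable_haar_gram] measurable_stat[OF measurable_haar_gram]; assumption)+
  have lev: "{G \<in> space H. t \<le> f G} \<in> sets H" "{G \<in> space H. f G \<le> t} \<in> sets H"
    if [measurable]: "f \<in> borel_measurable H" for f :: "_ \<Rightarrow> real" and t
    by measurable
  define a1 a2 a3 a4 b1 b2 b3 where "a1 w = fro q (haar_gram (fst w))" and "a2 w = tr q (haar_gram (fst w))"
    and "a3 w = tr3 q (haar_gram (fst w)) (haar_gram (fst w)) (haar_gram (fst w))" and "a4 w = stat q (haar_gram (fst w))"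
    and "b1 w = stat q (coupled_gram w)" and "b2 w = tr q (coupled_gram w)" and "b3 w = fro q (coupled_gram w)"
    for w :: "(nat \<times> nat \<Rightarrow> real) \<times> (nat \<Rightarrow> nat \<Rightarrow> real)"
  note ab = a1_def a2_def a3_def a4_def b1_def b2_def b3_def
  have [measurable]: "a1 \<in> borel_measurable coupling_space" "a2 \<in> borel_measurable coupling_space" "a3 \<in> borel_measurable coupling_space"
    "a4 \<in> borel_measurable coupling_space" "b1 \<in> borel_measurable coupling_space" "b2 \<in> borel_measurable coupling_space" "b3 \<in> borel_measurable coupling_space"
    unfolding ab by (rule measurable_coupling_space)+
  define S0 where "S0 = {w \<in> space coupling_space. a4 w \<le> \<tau>}"
  define S1 where "S1 = {w \<in> space coupling_space. a1 w < k1 \<and> a2 w < k2 \<and> a3 w < k3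
     \<and> b1 w - a4 w < (b2 w)\<^sup>2 / n - (b3 w + a1 w) / n - 3 * \<eta>}"
  define S2 where "S2 = {w \<in> space coupling_space. k1 \<le> a1 w}"
  define S3 where "S3 = {w \<in> space coupling_space. k2 \<le> a2 w}"
  define S4 where "S4 = {w \<in> space coupling_space. k3 \<le> a3 w}"
  define S5 where "S5 = {w \<in> space coupling_space. b2 w \<le> real p * real q - \<eta>}"
  define S6 where "S6 = {w \<in> space coupling_space. n * \<eta> \<le> b3 w}"
  have sets: "S0 \<in> sets coupling_space" "S1 \<in> sets coupling_space" "S2 \<in> sets coupling_space" "S3 \<in> sets coupling_space" "S4 \<in> sets coupling_space" "S5 \<in> sets coupling_space" "S6 \<in> sets coupling_space"
    unfolding S0_def S1_def S2_def S3_def S4_def S5_def S6_def by measurable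
  \<comment> \<open>Outside all exceptional sets the statistic grows by at least \<open>d\<close>: 3
    \<eta> are lost in the conditional shift, and 2 \<eta> to the two Frobenius terms, each at most
    \<eta> after division by n thanks to \<open>k1 \<le> n * \<eta>\<close>.\<close>
  have sub: "{w \<in> space coupling_space. b1 w \<le> \<tau> + d} \<subseteq> S0 \<union> S1 \<union> S2 \<union> S3 \<union> S4 \<union> S5 \<union> S6"
  proof
    fix w assume w: "w \<in> {w \<in> space coupling_space. b1 w \<le> \<tau> + d}"
    show "w \<in> S0 \<union> S1 \<union> S2 \<union> S3 \<union> S4 \<union> S5 \<union> S6"
    proof (rule ccontr)
      assume "w \<notin> S0 \<union> S1 \<union> S2 \<union> S3 \<union> S4 \<union> S5 \<union> S6"
      with w have nw: "\<tau> < a4 w" "a1 w < k1" "real p * real q - \<eta> < b2 w" "b3 w < n * \<eta>"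
        "(b2 w)\<^sup>2 / n - (b3 w + a1 w) / n - 3 * \<eta> \<le> b1 w - a4 w"
        by (auto simp: S0_def S1_def S2_def S3_def S4_def S5_def S6_def not_less not_le)
      have "(real p * real q - \<eta>)\<^sup>2 / n \<le> (b2 w)\<^sup>2 / n"
        using nw(3) \<eta> by (intro divide_right_mono power_mono) auto
      moreover have "(b3 w + a1 w) / n \<le> 2 * \<eta>"
      proof -
        have "b3 w + a1 w \<le> 2 * (n * \<eta>)" using nw(2,4) k(4) by linarith
        also have "\<dots> = 2 * \<eta> * n" by simp
        finally show ?thesis using n by (simp add: divide_le_eq)
      qed
      ultimately have "d \<le> b1 w - a4 w"
        using nw(5) by (simp add: d_def)
      then show False using nw(1) w by simp
    qed
  qed
  have "gcols.prob p q {x \<in> space (gcols p q). stat q (gram p x) \<le> \<tau> + d} = measure coupling_space {w \<in> space coupling_space. b1 w \<le> \<tau> + d}"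
  proof -
    have [measurable]: "(\<lambda>D. stat q (unpack D)) \<in> borel_measurable (mat_space q q)"
      by (rule measurable_stat[OF measurable_unpack])
    have "{D \<in> space (mat_space q q). stat q (unpack D) \<le> \<tau> + d} \<in> sets (mat_space q q)"
      by measurable
    from coupling_prob[OF this] show ?thesis by (simp add: b1_def)
  qed
  also have "\<dots> \<le> measure coupling_space (S0 \<union> S1 \<union> S2 \<union> S3 \<union> S4 \<union> S5 \<union> S6)"
    using sub sets by (intro HG.finite_measure_mono) auto
  also have "\<dots> \<le> measure coupling_space S0 + measure coupling_space S1 + measure coupling_space S2 + measure coupling_space S3 + measure coupling_space S4 + measure coupling_space S5 + measure coupling_space S6"
    using sets by (intro order_trans[OF measure_Un_le] add_mono order_refl sets.Un) auto
  also have "\<dots> \<le> H.prob {G \<in> space H. stat q (haar_gram G) \<le> \<tau>} + shift_error n q \<eta> k1 k2 k3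
      + e2 / k1 + real p * real q / k2 + e3 / k3 + 2 * real p * real q / \<eta>\<^sup>2 + e2 / (n * \<eta>)"
  proof (intro add_mono)
    show "measure coupling_space S0 \<le> H.prob {G \<in> space H. stat q (haar_gram G) \<le> \<tau>}"
      unfolding S0_def ab using measure_fst[OF lev(2)[OF CH(4)]] by (rule eq_refl)
    show "measure coupling_space S1 \<le> shift_error n q \<eta> k1 k2 k3"
      unfolding S1_def ab by (rule conditional_shift_error[OF \<eta>(1) k(1-3)])
    show "measure coupling_space S2 \<le> e2 / k1"
      unfolding S2_def ab e2_def measure_fst[OF lev(1)[OF CH(1)]] by (rule haar_fro_tail[OF k(1)])
    show "measure coupling_space S3 \<le> real p * real q / k2"
      unfolding S3_def ab measure_fst[OF lev(1)[OF CH(2)]] by (rule haar_tr_tail[OF k(2)])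
    show "measure coupling_space S4 \<le> e3 / k3"
      unfolding S4_def ab e3_def measure_fst[OF lev(1)[OF CH(3)]] by (rule haar_tr3_tail[OF k(3)])
    show "measure coupling_space S5 \<le> 2 * real p * real q / \<eta>\<^sup>2"
      unfolding S5_def ab by (rule coupled_tr_tail[OF \<eta>(1)])
    show "measure coupling_space S6 \<le> e2 / (n * \<eta>)"
      unfolding S6_def ab e2_def by (rule coupled_fro_tail) (use n \<eta>(1) in simp)
  qed
  finally show ?thesis .
qed

text \<open>The Gaussian statistic is in law the Haar one raised by about d, so Haar blocks favour
  sublevel sets. The Gaussian mass up to \<tau> + d is at most the Haar mass up to \<tau> plus
  errors; subtracting the Gaussian mass up to \<tau> leaves the mass of the window of length d on
  one side and a difference of the two laws on the other.\<close>

lemma var_dist_ge: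
  fixes \<eta> k1 k2 k3 :: real
  assumes \<eta>: "\<eta> > 0" "\<eta> \<le> real p * real q" and k: "k1 > 0" "k2 > 0" "k3 > 0" "k1 \<le> n * \<eta>"
  defines "d \<equiv> (real p * real q - \<eta>)\<^sup>2 / n - 5 * \<eta>"
    and "e2 \<equiv> (real q)\<^sup>2 * p + q * ((real p)\<^sup>2 + 2 * p)"
    and "e3 \<equiv> real q ^ 3 * p + 3 * (real q)\<^sup>2 * ((real p)\<^sup>2 + 2 * p) + q * (15 * real p ^ 3)"
  assumes d: "d > 0"
  shows "2 * (d / sqrt (12 * (4 * (real q)\<^sup>2 * p * (p + 1)) + d\<^sup>2) - (shift_error n q \<eta> k1 k2 k3
      + e2 / k1 + real p * real q / k2 + e3 / k3 + 2 * real p * real q / \<eta>\<^sup>2 + e2 / (n * \<eta>)))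
    \<le> var_dist (scaled_block_law n p q H) (gauss_mat p q)"
proof -
  define err where "err = shift_error n q \<eta> k1 k2 k3
      + e2 / k1 + real p * real q / k2 + e3 / k3 + 2 * real p * real q / \<eta>\<^sup>2 + e2 / (n * \<eta>)"
  define v where "v = 4 * (real q)\<^sup>2 * p * (p + 1)"
  have "real p * real q > 0" using \<eta> by linarith
  then have v: "v > 0" by (auto simp: v_def zero_less_mult_iff)
  have sm: "all_moments (gcols p q) (\<lambda>x. stat q (gram p x))"
    unfolding stat_def off_def tr_def by (intro gcols.moment_intros gcols_gram_moments) auto
  have [measurable]: "(\<lambda>x. stat q (gram p x)) \<in> borel_measurable (gcols p q)"
    using sm by (simp add: all_moments_def)
  \<comment> \<open>The window lemma reaches only values strictly below its constant, so the bound
    is shown for each smaller \<open>b\<close> and closed by \<open>dense_le\<close>.\<close>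
  have "b \<le> var_dist (scaled_block_law n p q H) (gauss_mat p q) / 2 + err" if b: "b < d / sqrt (12 * v + d\<^sup>2)" for b
  proof -
    have "\<exists>\<tau>. b < gcols.prob p q {x \<in> space (gcols p q). \<tau> < stat q (gram p x) \<and> stat q (gram p x) \<le> \<tau> + d}"
    proof (rule gcols.concentration_window[OF _ _ _ v d b])
      let ?\<mu> = "- (real q * (real q - 1) * p)"
      show "integrable (gcols p q) (\<lambda>x. (stat q (gram p x) - ?\<mu>)\<^sup>2)"
        by (intro all_moments_integrable gcols.all_moments_power gcols.all_moments_diff sm gcols.all_moments_const)
      show "gcols.expectation p q (\<lambda>x. (stat q (gram p x) - ?\<mu>)\<^sup>2) \<le> v"
        using gcols_stat_variance[of p q] by (simp add: v_def)
    qed measurable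
    then obtain \<tau> where \<tau>: "b < gcols.prob p q {x \<in> space (gcols p q). \<tau> < stat q (gram p x) \<and> stat q (gram p x) \<le> \<tau> + d}"
      by blast
    have ub: "gcols.prob p q {x \<in> space (gcols p q). stat q (gram p x) \<le> \<tau> + d} \<le> H.prob {G \<in> space H. stat q (haar_gram G) \<le> \<tau>} + err"
      using coupled_union_bound[OF \<eta> k, of \<tau>] unfolding err_def d_def e2_def e3_def by (simp only: add.assoc)
    have sets: "{x \<in> space (gcols p q). stat q (gram p x) \<le> t} \<in> sets (gcols p q)" for t
      by measurable
    have "{x \<in> space (gcols p q). \<tau> < stat q (gram p x) \<and> stat q (gram p x) \<le> \<tau> + d}
      = {x \<in> space (gcols p q). stat q (gram p x) \<le> \<tau> + d} - {x \<in> space (gcols p q). stat q (gram p x) \<le> \<tau>}" (is "?W = ?L - ?M")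
      by auto
    then have f0: "b < gcols.prob p q (?L - ?M)" using \<tau> by (simp only:)
    have "gcols.prob p q (?L - ?M) = gcols.prob p q ?L - gcols.prob p q ?M"
      by (rule gcols.finite_measure_Diff[OF sets sets]) (use d in auto)
    with f0 have f0: "b < gcols.prob p q ?L - gcols.prob p q ?M" by (simp only:)
    have "b < (h - g) + err" if "b < l - g" "l \<le> h + err" for h g l
      using that by simp
    from this[OF f0 ub] have f1: "b < (H.prob {G \<in> space H. stat q (haar_gram G) \<le> \<tau>} - gcols.prob p q ?M) + err" .
    have f2: "2 * (H.prob {G \<in> space H. stat q (haar_gram G) \<le> \<tau>} - gcols.prob p q ?M)
      \<le> var_dist (scaled_block_law n p q H) (gauss_mat p q)"
      using var_dist_event[of \<tau>] unfolding measure_block_event measure_gauss_event .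
    have "b \<le> z / 2 + err" if "b < h + err" "2 * h \<le> z" for h z
      using that by (simp add: field_simps)
    from this[OF f1 f2] show ?thesis .
  qed
  then have dl: "d / sqrt (12 * v + d\<^sup>2) \<le> var_dist (scaled_block_law n p q H) (gauss_mat p q) / 2 + err"
    by (rule dense_le)
  have "2 * (a - e) \<le> z" if "a \<le> z / 2 + e" for a e z :: real
    using that by (simp add: field_simps)
  from this[OF dl] show ?thesis unfolding err_def v_def .
qed

end

section \<open>Asymptotics\<close>

lemma floor_sqrt_ratio_tendsto:
  assumes "x > 0"
  shows "(\<lambda>n. real (nat \<lfloor>x * sqrt (real n)\<rfloor>) / sqrt (real n)) \<longlonglongrightarrow> x"
proof (rule tendsto_sandwich)
  have pos: "eventually (\<lambda>n::nat. n > 0) sequentially" by (rule eventually_gt_at_top)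
  show "\<forall>\<^sub>F n in sequentially. x - 1 / sqrt (real n) \<le> real (nat \<lfloor>x * sqrt (real n)\<rfloor>) / sqrt (real n)"
    using pos
  proof eventually_elim
    case (elim n)
    have "x * sqrt n - 1 \<le> real (nat \<lfloor>x * sqrt (real n)\<rfloor>)" by linarith
    from divide_right_mono[OF this, of "sqrt n"] show ?case
      using elim by (simp add: diff_divide_distrib)
  qed
  show "\<forall>\<^sub>F n in sequentially. real (nat \<lfloor>x * sqrt (real n)\<rfloor>) / sqrt (real n) \<le> x"
    using pos
  proof eventually_elim
    case (elim n)
    have "real (nat \<lfloor>x * sqrt (real n)\<rfloor>) \<le> x * sqrt n" using assms by simp
    from divide_right_mono[OF this, of "sqrt n"] show ?case using elim by simp
  qed
  show "(\<lambda>n. x - 1 / sqrt (real n)) \<longlonglongrightarrow> x" by real_asymp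
qed simp

text \<open>All quantities are rescaled by powers of N = sqrt n. The truncation levels exceed the typical
  orders N^3, N^2 and N^4 by a slowly growing factor \<kappa>.\<close>

lemma var_dist_ge_scaled:
  fixes n p q :: nat and N \<kappa> \<rho> h u v \<epsilon> :: real
  assumes H: "haar_orthogonal n H" and pos: "N > 0" "\<rho> > 0" "h > 0" "\<epsilon> > 0"
    and n: "real n = N\<^sup>2" and \<kappa>: "\<kappa> = \<rho>\<^sup>2" and h: "N = h\<^sup>2" and p: "real p = u * N" and q: "real q = v * N"
    and small: "v / N < 1" "u / N < 1" "\<epsilon> < u * v" "\<kappa> / N < \<epsilon>"
  defines "D \<equiv> (u * v - \<epsilon>)\<^sup>2 - 5 * \<epsilon>"
  assumes D: "D > 0"
  shows "2 * (D / sqrt (48 * v\<^sup>2 * u * (u + 1 / N) + D\<^sup>2) -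
     (24 * (2 * (\<rho> * \<kappa> * h / N) + (v - 1 / N)\<^sup>2 * (\<kappa> / N)) / \<epsilon>\<^sup>2 + 8 * (\<kappa> ^ 3 / N) / \<epsilon>\<^sup>2 + 3 * (\<kappa> / N) / \<epsilon>
      + (v\<^sup>2 * u + v * (u\<^sup>2 + 2 * u * (1 / N))) * (1 / \<kappa>) + u * v * (1 / \<kappa>)
      + (v ^ 3 * u + 3 * v\<^sup>2 * (u\<^sup>2 + 2 * u * (1 / N)) + 15 * v * u ^ 3) * (1 / \<kappa>)
      + 2 * u * v * (1 / N)\<^sup>2 / \<epsilon>\<^sup>2 + (v\<^sup>2 * u + v * (u\<^sup>2 + 2 * u * (1 / N))) * (1 / N) / \<epsilon>))
    \<le> var_dist (scaled_block_law n p q H) (gauss_mat p q)"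
proof -
  \<comment> \<open>The tolerance is a fixed fraction of the order n of the shift, so that the shift
    stays of the form N^2 D.\<close>
  define \<eta> where "\<eta> = \<epsilon> * N\<^sup>2"
  define k1 where "k1 = \<kappa> * N ^ 3"
  define k2 where "k2 = \<kappa> * N\<^sup>2"
  define k3 where "k3 = \<kappa> * N ^ 4"
  have \<kappa>0: "\<kappa> > 0" using pos \<kappa> by simp
  have \<eta>: "\<eta> > 0" and kpos: "k1 > 0" "k2 > 0" "k3 > 0"
    using pos \<kappa>0 by (auto simp: \<eta>_def k1_def k2_def k3_def)
  have qn: "q < n"
  proof -
    have "real q < real n" using small(1) pos by (simp add: q n power2_eq_square field_simps)
    then show ?thesis by simp
  qed
  have pn: "p \<le> n"
  proof -
    have "real p < real n" using small(2) pos by (simp add: p n power2_eq_square field_simps)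
    then show ?thesis by simp
  qed
  have \<eta>pq: "\<eta> \<le> real p * real q"
    using small(3) pos mult_right_mono[of \<epsilon> "u * v" "N\<^sup>2"] by (simp add: \<eta>_def p q power2_eq_square mult_ac)
  have k1n: "k1 \<le> n * \<eta>"
  proof -
    have "\<kappa> \<le> \<epsilon> * N" using small(4) pos by (simp add: field_simps)
    from mult_right_mono[OF this, of "N ^ 3"] show ?thesis
      using pos by (simp add: k1_def n \<eta>_def power2_eq_square power3_eq_cube mult_ac)
  qed
  have d: "(real p * real q - \<eta>)\<^sup>2 / n - 5 * \<eta> = N\<^sup>2 * D"
    using pos by (simp add: p q n \<eta>_def D_def power2_eq_square field_simps)
  have dpos: "N\<^sup>2 * D > 0" using D pos by simp
  have sq: "sqrt (12 * (4 * (real q)\<^sup>2 * p * (p + 1)) + (N\<^sup>2 * D)\<^sup>2) = N\<^sup>2 * sqrt (48 * v\<^sup>2 * u * (u + 1 / N) + D\<^sup>2)"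
  proof -
    have "12 * (4 * (real q)\<^sup>2 * p * (p + 1)) + (N\<^sup>2 * D)\<^sup>2 = (N\<^sup>2)\<^sup>2 * (48 * v\<^sup>2 * u * (u + 1 / N) + D\<^sup>2)"
      using pos by (simp add: p q power2_eq_square field_simps)
    then show ?thesis
      by (simp only: real_sqrt_mult real_sqrt_abs abs_power2)
  qed
  have main: "N\<^sup>2 * D / sqrt (12 * (4 * (real q)\<^sup>2 * p * (p + 1)) + (N\<^sup>2 * D)\<^sup>2) = D / sqrt (48 * v\<^sup>2 * u * (u + 1 / N) + D\<^sup>2)"
    unfolding sq using pos by simp
  \<comment> \<open>The reason for having \<open>\<rho>\<close> and \<open>h\<close> as square roots
    of \<open>\<kappa>\<close> and \<open>N\<close>: the square root of \<kappa> N^3 becomes a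
    monomial.\<close>
  have sk1: "sqrt k1 = \<rho> * h * N"
  proof (rule real_sqrt_unique)
    show "(\<rho> * h * N)\<^sup>2 = k1" by (simp add: k1_def \<kappa> h power_mult_distrib flip: power_mult power_add)
  qed (use pos in simp)
  have E2: "(real q)\<^sup>2 * p + q * ((real p)\<^sup>2 + 2 * p) = N ^ 3 * (v\<^sup>2 * u + v * (u\<^sup>2 + 2 * u * (1 / N)))"
    using pos by (simp add: p q power2_eq_square power3_eq_cube field_simps)
  have E3: "real q ^ 3 * p + 3 * (real q)\<^sup>2 * ((real p)\<^sup>2 + 2 * p) + q * (15 * real p ^ 3)
    = N ^ 4 * (v ^ 3 * u + 3 * v\<^sup>2 * (u\<^sup>2 + 2 * u * (1 / N)) + 15 * v * u ^ 3)"
    using pos by (simp add: p q power2_eq_square power3_eq_cube power4_eq_xxxx field_simps)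
  have t1: "24 * (2 * sqrt k1 * k3 + (real q - 1)\<^sup>2 * k1) / (real n * \<eta>\<^sup>2) =
     24 * (2 * (\<rho> * \<kappa> * h / N) + (v - 1 / N)\<^sup>2 * (\<kappa> / N)) / \<epsilon>\<^sup>2"
  proof -
    have "2 * sqrt k1 * k3 + (real q - 1)\<^sup>2 * k1 = N ^ 6 * (2 * (\<rho> * \<kappa> * h / N) + (v - 1 / N)\<^sup>2 * (\<kappa> / N))"
    proof -
      have a: "2 * sqrt k1 * k3 = N ^ 6 * (2 * (\<rho> * \<kappa> * h / N))"
        unfolding sk1 using pos by (simp add: k3_def eval_nat_numeral mult_ac)
      have b: "(real q - 1)\<^sup>2 * k1 = N ^ 6 * ((v - 1 / N)\<^sup>2 * (\<kappa> / N))"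
      proof -
        have "real q - 1 = N * (v - 1 / N)" using pos by (simp add: q field_simps)
        then show ?thesis using pos by (simp add: k1_def power_mult_distrib eval_nat_numeral mult_ac)
      qed
      show ?thesis unfolding a b by (simp only: distrib_left)
    qed
    moreover have "real n * \<eta>\<^sup>2 = N ^ 6 * \<epsilon>\<^sup>2"
      by (simp add: n \<eta>_def power_mult_distrib flip: power_mult power_add)
    ultimately show ?thesis using pos by simp
  qed
  have t2: "8 * k1 * k2\<^sup>2 / ((real n)\<^sup>2 * \<eta>\<^sup>2) = 8 * (\<kappa> ^ 3 / N) / \<epsilon>\<^sup>2"
    using pos \<kappa>0 by (simp add: k1_def k2_def n \<eta>_def eval_nat_numeral field_simps)
  have t3: "3 * k1 / (real n * \<eta>) = 3 * (\<kappa> / N) / \<epsilon>"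
    using pos by (simp add: k1_def n \<eta>_def eval_nat_numeral field_simps)
  have t4: "N ^ 3 * z / k1 = z * (1 / \<kappa>)" "N ^ 4 * z / k3 = z * (1 / \<kappa>)" "N ^ 3 * z / (n * \<eta>) = z * (1 / N) / \<epsilon>" for z
    using pos \<kappa>0 by (simp_all add: k1_def k3_def n \<eta>_def eval_nat_numeral field_simps)
  have t5: "real p * real q / k2 = u * v * (1 / \<kappa>)"
    using pos \<kappa>0 by (simp add: k2_def p q eval_nat_numeral field_simps)
  have t6: "2 * real p * real q / \<eta>\<^sup>2 = 2 * u * v * (1 / N)\<^sup>2 / \<epsilon>\<^sup>2"
    using pos by (simp add: \<eta>_def p q eval_nat_numeral field_simps)
  show ?thesis
    using var_dist_ge[OF H qn pn \<eta> \<eta>pq kpos k1n] dpos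
    unfolding d main shift_error_def t1 t2 t3 E2 E3 t4 t5 t6 by blast
qed

text \<open>With R = sqrt (48 + s^2) and s = x y: for s < 4 one has R < 8 and s / 4 is beaten; for s
  >= 4 one has R <= 2 s and the right side is at least 1. The threshold solves 48 + s^2 = 64 = (2
  s)^2.\<close>

lemma phi_less_separation:
  assumes "x > 0" "y > 0"
  shows "phi x y < 2 * ((x * y)\<^sup>2 / sqrt (48 * y\<^sup>2 * x * x + ((x * y)\<^sup>2)\<^sup>2))"
proof -
  define s where "s = x * y"
  have s: "s > 0" using assms by (simp add: s_def)
  define R where "R = sqrt (48 + s\<^sup>2)"
  have R: "R > 0" by (auto simp: R_def intro: add_pos_nonneg)
  have "48 * y\<^sup>2 * x * x + ((x * y)\<^sup>2)\<^sup>2 = s\<^sup>2 * (48 + s\<^sup>2)"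
    by (simp add: s_def power2_eq_square algebra_simps)
  then have "sqrt (48 * y\<^sup>2 * x * x + ((x * y)\<^sup>2)\<^sup>2) = s * R"
    using s by (simp add: real_sqrt_mult R_def)
  then have eq: "2 * ((x * y)\<^sup>2 / sqrt (48 * y\<^sup>2 * x * x + ((x * y)\<^sup>2)\<^sup>2)) = 2 * s / R"
    using s by (simp add: s_def[symmetric] power2_eq_square)
  have "phi x y < 2 * s / R"
  proof (cases "s < 4")
    case True
    have "s\<^sup>2 < 4\<^sup>2" using True s by (intro power_strict_mono) auto
    then have "48 + s\<^sup>2 < 8\<^sup>2" by simp
    then have "R < 8" unfolding R_def by (rule real_less_lsqrt[rotated -1]) auto
    then have "s * R < s * 8" using s by simp
    then have "s / 4 < 2 * s / R" using R by (simp add: field_simps)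
    then show ?thesis using phi_bounds(3)[OF assms] by (simp add: s_def)
  next
    case False
    have "4\<^sup>2 \<le> s\<^sup>2" using False by (intro power_mono) auto
    then have "48 + s\<^sup>2 \<le> (2 * s)\<^sup>2" by (simp add: power_mult_distrib)
    then have "R \<le> 2 * s" unfolding R_def using s by (intro real_le_lsqrt) auto
    then have "1 \<le> 2 * s / R" using R by simp
    then show ?thesis using phi_bounds(2)[OF assms] by simp
  qed
  then show ?thesis by (simp only: eq)
qed

theorem theorem2:
  fixes x y :: real and H :: "nat \<Rightarrow> (nat \<times> nat \<Rightarrow> real) measure"
    and p q :: "nat \<Rightarrow> nat"
  assumes "x > 0" and "y > 0"
    and "\<And>n. p n = nat \<lfloor>x * sqrt (real n)\<rfloor>"
    and "\<And>n. q n = nat \<lfloor>y * sqrt (real n)\<rfloor>"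
    and "\<And>n. haar_orthogonal n (H n)"
  shows "liminf (\<lambda>n. ereal (var_dist (scaled_block_law n (p n) (q n) (H n)) (gauss_mat (p n) (q n))))
           \<ge> ereal (phi x y)
         \<and> 0 < phi x y \<and> phi x y < 1"
proof -
  note x = \<open>x > 0\<close> and y = \<open>y > 0\<close>
  define D where "D \<epsilon> u v = (u * v - \<epsilon>)\<^sup>2 - 5 * \<epsilon>" for \<epsilon> u v :: real
  have s: "x * y > 0" using x y by simp
  have "((\<lambda>\<epsilon>. D \<epsilon> x y) \<longlongrightarrow> (x * y - 0)\<^sup>2 - 5 * 0) (at_right 0)"
    unfolding D_def by (intro tendsto_intros)
  then have Dlim: "((\<lambda>\<epsilon>. D \<epsilon> x y) \<longlongrightarrow> (x * y)\<^sup>2) (at_right 0)" by simp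
  have "((\<lambda>\<epsilon>. 2 * (D \<epsilon> x y / sqrt (48 * y\<^sup>2 * x * x + (D \<epsilon> x y)\<^sup>2))) \<longlongrightarrow>
      2 * ((x * y)\<^sup>2 / sqrt (48 * y\<^sup>2 * x * x + ((x * y)\<^sup>2)\<^sup>2))) (at_right 0)"
    using x y by (intro tendsto_intros Dlim) (auto simp: add_pos_pos less_imp_neq[symmetric])
  then have "eventually (\<lambda>\<epsilon>. phi x y < 2 * (D \<epsilon> x y / sqrt (48 * y\<^sup>2 * x * x + (D \<epsilon> x y)\<^sup>2))) (at_right 0)"
    by (rule order_tendstoD(1)) (rule phi_less_separation[OF x y])
  moreover have "eventually (\<lambda>\<epsilon>. 0 < D \<epsilon> x y) (at_right 0)"
    using Dlim by (rule order_tendstoD(1)) (use x y in simp)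
  moreover have "eventually (\<lambda>\<epsilon>. \<epsilon> \<in> {0<..<x * y}) (at_right 0)"
    using s by (rule eventually_at_right_real)
  ultimately have "eventually (\<lambda>\<epsilon>. phi x y < 2 * (D \<epsilon> x y / sqrt (48 * y\<^sup>2 * x * x + (D \<epsilon> x y)\<^sup>2)) \<and> 0 < D \<epsilon> x y \<and> \<epsilon> \<in> {0<..<x * y}) (at_right 0)"
    by (intro eventually_conj)
  \<comment> \<open>One \<open>\<epsilon>\<close> is fixed for all n: the separation is strict, so
    it survives replacing the limiting shift by the reduced one.\<close>
  from eventually_happens'[OF trivial_limit_at_right_real this] obtain \<epsilon>
    where "phi x y < 2 * (D \<epsilon> x y / sqrt (48 * y\<^sup>2 * x * x + (D \<epsilon> x y)\<^sup>2)) \<and> 0 < D \<epsilon> x y \<and> \<epsilon> \<in> {0<..<x * y}"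
    by (rule exE)
  then have \<epsilon>: "phi x y < 2 * (D \<epsilon> x y / sqrt (48 * y\<^sup>2 * x * x + (D \<epsilon> x y)\<^sup>2))" "0 < D \<epsilon> x y" "0 < \<epsilon>" "\<epsilon> < x * y"
    by simp_all
  define N where "N n = sqrt (real n)" for n :: nat
  \<comment> \<open>With the exponent 1/16, \<kappa> = n^(1/8) tends to infinity, while \<rho>
    \<kappa> h / N = n^(-1/16) and \<kappa>^3 / N = n^(-1/8) still tend to 0.\<close>
  define \<rho> where "\<rho> n = real n powr (1 / 16)" for n :: nat
  define \<kappa> where "\<kappa> n = (\<rho> n)\<^sup>2" for n
  define h where "h n = sqrt (N n)" for n
  define u where "u n = real (p n) / N n" for n
  define v where "v n = real (q n) / N n" for n
  have ul: "u \<longlonglongrightarrow> x" unfolding u_def N_def assms(3) by (rule floor_sqrt_ratio_tendsto[OF x])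
  have vl: "v \<longlonglongrightarrow> y" unfolding v_def N_def assms(4) by (rule floor_sqrt_ratio_tendsto[OF y])
  have N0: "(\<lambda>n. 1 / N n) \<longlonglongrightarrow> 0" unfolding N_def by real_asymp
  have k0: "(\<lambda>n. 1 / \<kappa> n) \<longlonglongrightarrow> 0" unfolding \<kappa>_def \<rho>_def by real_asymp
  have kN: "(\<lambda>n. \<kappa> n / N n) \<longlonglongrightarrow> 0" unfolding \<kappa>_def \<rho>_def N_def by real_asymp
  have k3N: "(\<lambda>n. \<kappa> n ^ 3 / N n) \<longlonglongrightarrow> 0" unfolding \<kappa>_def \<rho>_def N_def by real_asymp
  have rkh: "(\<lambda>n. \<rho> n * \<kappa> n * h n / N n) \<longlonglongrightarrow> 0" unfolding \<kappa>_def \<rho>_def N_def h_def by real_asymp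
  have Dl: "(\<lambda>n. D \<epsilon> (u n) (v n)) \<longlonglongrightarrow> D \<epsilon> x y"
    unfolding D_def by (intro tendsto_intros ul vl)
  \<comment> \<open>The lower bound of \<open>var_dist_ge_scaled\<close>, written in quantities
    whose limits are known, so that its own limit follows termwise and every error product has a
    factor tending to 0.\<close>
  define B where "B n = 2 * (D \<epsilon> (u n) (v n) / sqrt (48 * (v n)\<^sup>2 * u n * (u n + 1 / N n) + (D \<epsilon> (u n) (v n))\<^sup>2) -
     (24 * (2 * (\<rho> n * \<kappa> n * h n / N n) + (v n - 1 / N n)\<^sup>2 * (\<kappa> n / N n)) / \<epsilon>\<^sup>2 + 8 * (\<kappa> n ^ 3 / N n) / \<epsilon>\<^sup>2 + 3 * (\<kappa> n / N n) / \<epsilon>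
      + ((v n)\<^sup>2 * u n + v n * ((u n)\<^sup>2 + 2 * u n * (1 / N n))) * (1 / \<kappa> n) + u n * v n * (1 / \<kappa> n)
      + (v n ^ 3 * u n + 3 * (v n)\<^sup>2 * ((u n)\<^sup>2 + 2 * u n * (1 / N n)) + 15 * v n * u n ^ 3) * (1 / \<kappa> n)
      + 2 * u n * v n * (1 / N n)\<^sup>2 / \<epsilon>\<^sup>2 + ((v n)\<^sup>2 * u n + v n * ((u n)\<^sup>2 + 2 * u n * (1 / N n))) * (1 / N n) / \<epsilon>))" for n
  have "B \<longlonglongrightarrow> 2 * (D \<epsilon> x y / sqrt (48 * y\<^sup>2 * x * (x + 0) + (D \<epsilon> x y)\<^sup>2) -
     (24 * (2 * 0 + (y - 0)\<^sup>2 * 0) / \<epsilon>\<^sup>2 + 8 * 0 / \<epsilon>\<^sup>2 + 3 * 0 / \<epsilon>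
      + (y\<^sup>2 * x + y * (x\<^sup>2 + 2 * x * 0)) * 0 + x * y * 0
      + (y ^ 3 * x + 3 * y\<^sup>2 * (x\<^sup>2 + 2 * x * 0) + 15 * y * x ^ 3) * 0
      + 2 * x * y * 0\<^sup>2 / \<epsilon>\<^sup>2 + (y\<^sup>2 * x + y * (x\<^sup>2 + 2 * x * 0)) * 0 / \<epsilon>))"
    unfolding B_def
  proof (intro tendsto_intros ul vl N0 k0 kN k3N rkh Dl)
    have "0 < 48 * y\<^sup>2 * x * (x + 0) + (D \<epsilon> x y)\<^sup>2" using x y by (intro add_pos_nonneg) auto
    then show "sqrt (48 * y\<^sup>2 * x * (x + 0) + (D \<epsilon> x y)\<^sup>2) \<noteq> 0" by simp
  qed (use \<epsilon> in auto)
  then have "B \<longlonglongrightarrow> 2 * (D \<epsilon> x y / sqrt (48 * y\<^sup>2 * x * x + (D \<epsilon> x y)\<^sup>2))" by simp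
  from order_tendstoD(1)[OF this \<epsilon>(1)] have e1: "eventually (\<lambda>n. phi x y < B n) sequentially" .
  have e2: "eventually (\<lambda>n. 0 < D \<epsilon> (u n) (v n)) sequentially"
    using Dl \<epsilon>(2) by (rule order_tendstoD(1))
  have "(\<lambda>n. v n * (1 / N n)) \<longlonglongrightarrow> y * 0" "(\<lambda>n. u n * (1 / N n)) \<longlonglongrightarrow> x * 0" "(\<lambda>n. u n * v n) \<longlonglongrightarrow> x * y"
    by (intro tendsto_intros ul vl N0)+
  then have e3: "eventually (\<lambda>n. v n / N n < 1) sequentially" "eventually (\<lambda>n. u n / N n < 1) sequentially"
    "eventually (\<lambda>n. \<epsilon> < u n * v n) sequentially"
    using order_tendstoD(2)[of "\<lambda>n. v n * (1 / N n)" 0 sequentially 1] order_tendstoD(2)[of "\<lambda>n. u n * (1 / N n)" 0 sequentially 1]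
      order_tendstoD(1)[of "\<lambda>n. u n * v n" "x * y" sequentially \<epsilon>] \<epsilon>(4) by auto
  have e4: "eventually (\<lambda>n. \<kappa> n / N n < \<epsilon>) sequentially"
    using kN \<epsilon>(3) by (rule order_tendstoD(2))
  have e5: "eventually (\<lambda>n::nat. n > 0) sequentially" by (rule eventually_gt_at_top)
  have "eventually (\<lambda>n. phi x y \<le> var_dist (scaled_block_law n (p n) (q n) (H n)) (gauss_mat (p n) (q n))) sequentially"
    using e1 e2 e3 e4 e5
  proof eventually_elim
    case (elim n)
    have pos: "N n > 0" "\<rho> n > 0" "h n > 0" using elim by (auto simp: N_def \<rho>_def h_def)
    have "B n \<le> var_dist (scaled_block_law n (p n) (q n) (H n)) (gauss_mat (p n) (q n))"
      unfolding B_def D_def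
      by (rule var_dist_ge_scaled[OF assms(5) pos \<epsilon>(3)])
        (use elim pos in \<open>auto simp: N_def[of n] \<kappa>_def h_def u_def v_def D_def\<close>)
    then show ?case using elim by simp
  qed
  then have "ereal (phi x y) \<le> liminf (\<lambda>n. ereal (var_dist (scaled_block_law n (p n) (q n) (H n)) (gauss_mat (p n) (q n))))"
    by (intro Liminf_bounded) simp
  then show ?thesis using phi_bounds[OF x y] by simp
qed

end
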